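(* Let $(N,c_N,D^N)$ be a Weyl space, let $1\le r<\tfrac12\dim N$, and let $M\subseteq N$ be a submanifold with $\dim M=2r$. Let $c_M=c_N|_M$ and let $D^M$ be the Weyl connection on $(M,c_M)$ induced by $D^N$. Suppose that there exists a section $p$ of $Q_{N,r}$ over $M$ which is tangent to $M$ (i.e. $p_x\subseteq T_x^{\mathbb{C}}M$ for all $x\in M$), let $J^p$ be the almost Hermitian structure on $(M,c_M)$ whose eigenbundle corresponding to $-\mathrm{i}$ is $p$, and orient $M$ by $J^p$. With $(Q_{N,r},\mathcal{J}'_{N,r})$ and $(Q_M,\mathcal{J}'_M)$ as in the context, the following assertions are equivalent: (i) $p:(M,J^p)\to(Q_{N,r},\mathcal{J}'_{N,r})$ is holomorphic. (ii) $(M,J^p)$ is a $(1,1)$-geodesic submanifold of $(N,c_N,D^N)$ and the map $p:(M,J^p)\to(Q_M,\mathcal{J}'_M)$ is holomorphic.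
   Context: Manifolds are smooth and connected. A Weyl space $(N,c_N,D^N)$ is a manifold with a conformal structure $c_N$ (conformal class of Riemannian metrics) and a torsion-free connection $D^N$ on $TN$ preserving $c_N$. Conformal structures are extended complex-bilinearly to complexified tangent bundles; a complex subspace is isotropic if the conformal structure vanishes on it. The Weyl connection $D^M$ induced on a submanifold $M$ is given by $D^M_XY=$ the $c_N$-orthogonal projection of $D^N_XY$ onto $TM$. An almost CR-structure on a manifold is a section $J$ of $\mathrm{End}(\mathscr{D})$ with $J^2=-\mathrm{Id}$, for some distribution $\mathscr{D}$ (an almost complex structure if $\mathscr{D}$ is the whole tangent bundle); its associated complex distribution is its $(-\mathrm{i})$-eigenbundle. A map between manifolds endowed with almost CR-structures is holomorphic if its differential maps the associated complex distribution of the domain into that of the codomain. $\pi_{N,r}:Q_{N,r}\to N$ is the bundle whose fibre at $x$ is the complex manifold of isotropic complex $r$-dimensional subspaces of $T_x^{\mathbb{C}}N$ (a complex submanifold of a Grassmannian). Let $\mathscr{H}\subseteq TQ_{N,r}$ be the connection induced by $D^N$ and let $\mathscr{G}_0\subseteq\mathscr{H}^{\mathbb{C}}$ be the complex subbundle with $\mathrm{d}\pi_{N,r}\bigl((\mathscr{G}_0)_p\bigr)=p$ for all $p\in Q_{N,r}$. $\mathcal{J}'_{N,r}$ is the almost CR-structure on $Q_{N,r}$ whose eigenbundle corresponding to $-\mathrm{i}$ is $\mathscr{G}_0\oplus(\ker\mathrm{d}\pi_{N,r})^{1,0}$. $\pi_M:Q_M\to M$ is the bundle of positive maximal isotropic spaces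 on the oriented even-dimensional conformal manifold $(M,c_M)$, i.e. the $(-\mathrm{i})$-eigenspaces of positive orthogonal complex structures on the tangent spaces of $M$; its fibres are complex submanifolds of Grassmannians. $\mathcal{J}'_M$ is the almost complex structure on $Q_M$ whose eigenbundle corresponding to $-\mathrm{i}$ is $\mathscr{G}_{0,M}\oplus(\ker\mathrm{d}\pi_M)^{1,0}$, where $\mathscr{G}_{0,M}$ is contained in the complexification of the connection induced by $D^M$ on $Q_M$ and $\mathrm{d}\pi_M$ maps $\mathscr{G}_{0,M}$ at $q\in Q_M$ onto $q$. $(M,J^p)$ is a $(1,1)$-geodesic submanifold of $(N,c_N,D^N)$ if its second fundamental form $B(X,Y)=D^N_XY-D^M_XY$, extended complex-bilinearly, has vanishing $(1,1)$-part with respect to $J^p$: $B(\overline{X},Y)=0$ for all $x\in M$ and $X,Y\in p_x$. *)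

theory Defs
  imports "HOL-Analysis.Analysis"
begin

section \<open>Smooth manifolds\<close>

primrec Ck_on :: "nat \<Rightarrow> 'e::euclidean_space set \<Rightarrow> ('e \<Rightarrow> 'f::real_normed_vector) \<Rightarrow> bool" where
  "Ck_on 0 S f \<longleftrightarrow> continuous_on S f"
| "Ck_on (Suc k) S f \<longleftrightarrow>
     (\<forall>x\<in>S. f differentiable at x) \<and> (\<forall>v. Ck_on k S (\<lambda>x. frechet_derivative f (at x) v))"

definition smooth_on :: "'e::euclidean_space set \<Rightarrow> ('e \<Rightarrow> 'f::real_normed_vector) \<Rightarrow> bool" where
  "smooth_on S f \<longleftrightarrow> (\<forall>k. Ck_on k S f)"

text \<open>A space with an indexed family of coordinate maps \<open>coord A i\<close>, each defined on
  \<open>patch A i\<close> and injective there.  For a manifold modelled on a Euclidean space the images are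
  open sets (\<open>smooth_manifold\<close> below); for the bundles of isotropic subspaces the images are
  embedded submanifolds of a larger Euclidean space.\<close>

record ('i, 'a, 'e) charted =
  idx :: "'i set"
  patch :: "'i \<Rightarrow> 'a set"
  coord :: "'i \<Rightarrow> 'a \<Rightarrow> 'e"

definition points :: "('i, 'a, 'e) charted \<Rightarrow> 'a set" where
  "points A = (\<Union>i\<in>idx A. patch A i)"

definition charts_at :: "('i, 'a, 'e) charted \<Rightarrow> 'a \<Rightarrow> 'i set" where
  "charts_at A x = {i \<in> idx A. x \<in> patch A i}"

definition local_rep ::
  "('i, 'a, 'e) charted \<Rightarrow> ('j, 'b, 'f) charted \<Rightarrow> ('a \<Rightarrow> 'b) \<Rightarrow> 'i \<Rightarrow> 'j \<Rightarrow> 'e \<Rightarrow> 'f" where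
  "local_rep A B F i j = (\<lambda>y. coord B j (F (inv_into (patch A i) (coord A i) y)))"

text \<open>The differential of \<open>F\<close> at \<open>x\<close>, expressed in the charts \<open>i\<close> and \<open>j\<close>.\<close>

definition jac ::
  "('i, 'a, 'e::euclidean_space) charted \<Rightarrow> ('j, 'b, 'f::real_normed_vector) charted \<Rightarrow> ('a \<Rightarrow> 'b)
    \<Rightarrow> 'i \<Rightarrow> 'j \<Rightarrow> 'a \<Rightarrow> 'e \<Rightarrow> 'f" where
  "jac A B F i j x = frechet_derivative (local_rep A B F i j) (at (coord A i x))"

definition smooth_map ::
  "('i, 'a, 'e::euclidean_space) charted \<Rightarrow> ('j, 'b, 'f::real_normed_vector) charted
    \<Rightarrow> ('a \<Rightarrow> 'b) \<Rightarrow> bool" where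
  "smooth_map A B F \<longleftrightarrow> F ` points A \<subseteq> points B \<and>
     (\<forall>i\<in>idx A. \<forall>j\<in>idx B.
        open (coord A i ` {x \<in> patch A i. F x \<in> patch B j}) \<and>
        smooth_on (coord A i ` {x \<in> patch A i. F x \<in> patch B j}) (local_rep A B F i j))"

text \<open>Connected smooth manifold.  The topology is determined by the charts.\<close>

definition smooth_manifold :: "('i, 'a, 'e::euclidean_space) charted \<Rightarrow> bool" where
  "smooth_manifold A \<longleftrightarrow>
     (\<exists>T. topspace T = points A \<and> Hausdorff_space T \<and> second_countable T \<and> connected_space T \<and>
        (\<forall>i\<in>idx A. openin T (patch A i) \<and> open (coord A i ` patch A i) \<and>
           homeomorphic_map (subtopology T (patch A i)) (top_of_set (coord A i ` patch A i))
             (coord A i))) \<and>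
     smooth_map A A id"

text \<open>A submanifold is a subset with a manifold structure of its own for which the inclusion is an
  immersion; its topology may be finer than the subspace topology.\<close>

definition submanifold ::
  "('k, 'a, 'e::euclidean_space) charted \<Rightarrow> ('i, 'a, 'f::euclidean_space) charted \<Rightarrow> bool" where
  "submanifold M N \<longleftrightarrow> smooth_manifold M \<and> smooth_map M N id \<and>
     (\<forall>x\<in>points M. \<forall>k\<in>charts_at M x. \<forall>i\<in>charts_at N x. inj (jac M N id k i x))"


section \<open>Complexification\<close>

definition vec_Re :: "complex^'n \<Rightarrow> real^'n" where "vec_Re Z = (\<chi> a. Re (Z $ a))"
definition vec_Im :: "complex^'n \<Rightarrow> real^'n" where "vec_Im Z = (\<chi> a. Im (Z $ a))"
definition vec_Complex :: "real^'n \<Rightarrow> real^'n \<Rightarrow> complex^'n" where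
  "vec_Complex u v = (\<chi> a. Complex (u $ a) (v $ a))"
definition vec_cnj :: "complex^'n \<Rightarrow> complex^'n" where "vec_cnj Z = (\<chi> a. cnj (Z $ a))"

definition clinear_ext :: "(real^'m \<Rightarrow> real^'n) \<Rightarrow> complex^'m \<Rightarrow> complex^'n" where
  "clinear_ext L Z = vec_Complex (L (vec_Re Z)) (L (vec_Im Z))"

definition cbilinear_form_ext ::
  "(real^'n \<Rightarrow> real^'n \<Rightarrow> real) \<Rightarrow> complex^'n \<Rightarrow> complex^'n \<Rightarrow> complex" where
  "cbilinear_form_ext b Z W =
     Complex (b (vec_Re Z) (vec_Re W) - b (vec_Im Z) (vec_Im W))
             (b (vec_Re Z) (vec_Im W) + b (vec_Im Z) (vec_Re W))"

definition cbilinear_ext ::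
  "(real^'m \<Rightarrow> real^'m \<Rightarrow> real^'n) \<Rightarrow> complex^'m \<Rightarrow> complex^'m \<Rightarrow> complex^'n" where
  "cbilinear_ext b Z W =
     vec_Complex (b (vec_Re Z) (vec_Re W) - b (vec_Im Z) (vec_Im W))
                 (b (vec_Re Z) (vec_Im W) + b (vec_Im Z) (vec_Re W))"

text \<open>A vector in the complexified tangent space at \<open>x\<close> is given by its components in all charts
  at \<open>x\<close>, related by the differentials of the coordinate changes.\<close>

definition tangent_C :: "('i, 'a, real^'n) charted \<Rightarrow> 'a \<Rightarrow> ('i \<Rightarrow> complex^'n) set" where
  "tangent_C A x = {v.
     (\<forall>i\<in>charts_at A x. \<forall>j\<in>charts_at A x. v j = clinear_ext (jac A A id i j x) (v i)) \<and>
     (\<forall>i. i \<notin> charts_at A x \<longrightarrow> v i = 0)}"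

definition comps :: "'i \<Rightarrow> ('i \<Rightarrow> 'v) set \<Rightarrow> 'v set" where
  "comps i P = (\<lambda>v. v i) ` P"

text \<open>The graph of the complexified differential of the inclusion \<open>M \<subseteq> N\<close> at \<open>x\<close>.\<close>

definition inclusion_differential ::
  "('k, 'a, real^'m) charted \<Rightarrow> ('i, 'a, real^'n) charted \<Rightarrow> 'a
    \<Rightarrow> (('k \<Rightarrow> complex^'m) \<times> ('i \<Rightarrow> complex^'n)) set" where
  "inclusion_differential M N x = {(v, w). v \<in> tangent_C M x \<and> w \<in> tangent_C N x \<and>
     (\<forall>k\<in>charts_at M x. \<forall>i\<in>charts_at N x. w i = clinear_ext (jac M N id k i x) (v k))}"


section \<open>Weyl spaces\<close>

text \<open>A metric \<open>g\<close> is given by its bilinear form \<open>g i x\<close> at \<open>x\<close> in each chart \<open>i\<close> at \<open>x\<close>.\<close>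

definition riemannian_metric ::
  "('i, 'a, real^'n) charted \<Rightarrow> ('i \<Rightarrow> 'a \<Rightarrow> real^'n \<Rightarrow> real^'n \<Rightarrow> real) \<Rightarrow> bool" where
  "riemannian_metric A g \<longleftrightarrow>
     (\<forall>x\<in>points A. \<forall>i\<in>charts_at A x.
        bilinear (g i x) \<and> (\<forall>X Y. g i x X Y = g i x Y X) \<and> (\<forall>X. X \<noteq> 0 \<longrightarrow> g i x X X > 0) \<and>
        (\<forall>j\<in>charts_at A x. \<forall>X Y.
           g i x X Y = g j x (jac A A id i j x X) (jac A A id i j x Y))) \<and>
     (\<forall>i\<in>idx A. \<forall>X Y.
        smooth_on (coord A i ` patch A i) (\<lambda>y. g i (inv_into (patch A i) (coord A i) y) X Y))"

definition conformal_class ::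
  "('i, 'a, real^'n) charted \<Rightarrow> ('i \<Rightarrow> 'a \<Rightarrow> real^'n \<Rightarrow> real^'n \<Rightarrow> real)
    \<Rightarrow> ('i \<Rightarrow> 'a \<Rightarrow> real^'n \<Rightarrow> real^'n \<Rightarrow> real) set" where
  "conformal_class A g = {h. riemannian_metric A h \<and>
     (\<exists>\<rho>. \<forall>x\<in>points A. \<rho> x > 0 \<and>
        (\<forall>i\<in>charts_at A x. \<forall>X Y. h i x X Y = \<rho> x * g i x X Y))}"

definition conformal_structure ::
  "('i, 'a, real^'n) charted \<Rightarrow> ('i \<Rightarrow> 'a \<Rightarrow> real^'n \<Rightarrow> real^'n \<Rightarrow> real) set \<Rightarrow> bool" where
  "conformal_structure A c \<longleftrightarrow> (\<exists>g. riemannian_metric A g \<and> c = conformal_class A g)"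

text \<open>The covariant derivative, at \<open>y\<close> in the direction \<open>X\<close>, of a vector field \<open>W\<close> along a map with
  local representative \<open>f\<close>, where \<open>G\<close> is the Christoffel form of the target at \<open>f y\<close>.\<close>

definition cov_deriv ::
  "('e::euclidean_space \<Rightarrow> 'f::euclidean_space) \<Rightarrow> ('f \<Rightarrow> 'f \<Rightarrow> 'f) \<Rightarrow> ('e \<Rightarrow> 'f) \<Rightarrow> 'e \<Rightarrow> 'e \<Rightarrow> 'f" where
  "cov_deriv f G W y X = frechet_derivative W (at y) X + G (frechet_derivative f (at y) X) (W y)"

text \<open>A connection on the tangent bundle is given by its Christoffel forms \<open>\<Gamma> i x\<close> in all charts.
  The last condition is the transformation rule making the covariant derivative independent of
  the chart: for the local representative \<open>\<tau>\<close> of a coordinate change and a constant local field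
  \<open>Y\<close>, differentiating \<open>d\<tau> Y\<close> along \<open>\<tau>\<close> gives the image under \<open>d\<tau>\<close> of the derivative of \<open>Y\<close>.\<close>

definition connection ::
  "('i, 'a, real^'n) charted \<Rightarrow> ('i \<Rightarrow> 'a \<Rightarrow> real^'n \<Rightarrow> real^'n \<Rightarrow> real^'n) \<Rightarrow> bool" where
  "connection A \<Gamma> \<longleftrightarrow>
     (\<forall>i\<in>idx A. \<forall>X Y.
        smooth_on (coord A i ` patch A i) (\<lambda>y. \<Gamma> i (inv_into (patch A i) (coord A i) y) X Y)) \<and>
     (\<forall>x\<in>points A. \<forall>i\<in>charts_at A x. bilinear (\<Gamma> i x) \<and>
        (\<forall>j\<in>charts_at A x. \<forall>X Y.
           cov_deriv (local_rep A A id i j) (\<Gamma> j x)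
             (\<lambda>y. frechet_derivative (local_rep A A id i j) (at y) Y) (coord A i x) X
           = jac A A id i j x (\<Gamma> i x X Y)))"

definition torsion_free ::
  "('i, 'a, real^'n) charted \<Rightarrow> ('i \<Rightarrow> 'a \<Rightarrow> real^'n \<Rightarrow> real^'n \<Rightarrow> real^'n) \<Rightarrow> bool" where
  "torsion_free A \<Gamma> \<longleftrightarrow>
     (\<forall>x\<in>points A. \<forall>i\<in>charts_at A x. \<forall>X Y. \<Gamma> i x X Y = \<Gamma> i x Y X)"

text \<open>\<open>\<Gamma>\<close> preserves \<open>c\<close>: every \<open>g \<in> c\<close> satisfies \<open>D g = \<alpha> \<otimes> g\<close> for some one-form \<open>\<alpha>\<close>.\<close>

definition preserves_conformal ::
  "('i, 'a, real^'n) charted \<Rightarrow> ('i \<Rightarrow> 'a \<Rightarrow> real^'n \<Rightarrow> real^'n \<Rightarrow> real) set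
    \<Rightarrow> ('i \<Rightarrow> 'a \<Rightarrow> real^'n \<Rightarrow> real^'n \<Rightarrow> real^'n) \<Rightarrow> bool" where
  "preserves_conformal A c \<Gamma> \<longleftrightarrow>
     (\<forall>g\<in>c. \<exists>\<alpha>. \<forall>x\<in>points A. \<forall>i\<in>charts_at A x. \<forall>X Y Z.
        frechet_derivative (\<lambda>y. g i (inv_into (patch A i) (coord A i) y) Y Z) (at (coord A i x)) X
          - g i x (\<Gamma> i x X Y) Z - g i x Y (\<Gamma> i x X Z)
        = \<alpha> i x X * g i x Y Z)"

definition weyl_space ::
  "('i, 'a, real^'n) charted \<Rightarrow> ('i \<Rightarrow> 'a \<Rightarrow> real^'n \<Rightarrow> real^'n \<Rightarrow> real) set
    \<Rightarrow> ('i \<Rightarrow> 'a \<Rightarrow> real^'n \<Rightarrow> real^'n \<Rightarrow> real^'n) \<Rightarrow> bool" where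
  "weyl_space A c \<Gamma> \<longleftrightarrow> smooth_manifold A \<and> conformal_structure A c \<and>
     connection A \<Gamma> \<and> torsion_free A \<Gamma> \<and> preserves_conformal A c \<Gamma>"

text \<open>The conformal class on \<open>M\<close> of the restrictions of the metrics in \<open>c\<close>.\<close>

definition restricted_conformal ::
  "('k, 'a, real^'m) charted \<Rightarrow> ('i, 'a, real^'n) charted
    \<Rightarrow> ('i \<Rightarrow> 'a \<Rightarrow> real^'n \<Rightarrow> real^'n \<Rightarrow> real) set
    \<Rightarrow> ('k \<Rightarrow> 'a \<Rightarrow> real^'m \<Rightarrow> real^'m \<Rightarrow> real) set" where
  "restricted_conformal M N c = {h. riemannian_metric M h \<and>
     (\<exists>g\<in>c. \<exists>\<rho>. \<forall>x\<in>points M. \<rho> x > 0 \<and>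
        (\<forall>k\<in>charts_at M x. \<forall>i\<in>charts_at N x. \<forall>X Y.
           h k x X Y = \<rho> x * g i x (jac M N id k i x X) (jac M N id k i x Y)))}"

text \<open>\<open>D\<^sup>N\<^sub>X Y\<close> at \<open>x\<close> for a vector field \<open>Y\<close> on \<open>M\<close>, in the charts \<open>k\<close> of \<open>M\<close> and \<open>i\<close> of \<open>N\<close>.\<close>

definition ambient_deriv ::
  "('k, 'a, real^'m) charted \<Rightarrow> ('i, 'a, real^'n) charted
    \<Rightarrow> ('i \<Rightarrow> 'a \<Rightarrow> real^'n \<Rightarrow> real^'n \<Rightarrow> real^'n)
    \<Rightarrow> 'k \<Rightarrow> 'i \<Rightarrow> 'a \<Rightarrow> real^'m \<Rightarrow> (real^'m \<Rightarrow> real^'m) \<Rightarrow> real^'n" where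
  "ambient_deriv M N DN k i x X Y =
     cov_deriv (local_rep M N id k i) (DN i x)
       (\<lambda>y. frechet_derivative (local_rep M N id k i) (at y) (Y y)) (coord M k x) X"

text \<open>\<open>DM\<close> is the connection on \<open>M\<close> such that \<open>D\<^sup>M\<^sub>X Y\<close> is the orthogonal projection of \<open>D\<^sup>N\<^sub>X Y\<close>
  onto the tangent space of \<open>M\<close>.\<close>

definition induced_connection ::
  "('k, 'a, real^'m) charted \<Rightarrow> ('i, 'a, real^'n) charted
    \<Rightarrow> ('i \<Rightarrow> 'a \<Rightarrow> real^'n \<Rightarrow> real^'n \<Rightarrow> real) set
    \<Rightarrow> ('i \<Rightarrow> 'a \<Rightarrow> real^'n \<Rightarrow> real^'n \<Rightarrow> real^'n)
    \<Rightarrow> ('k \<Rightarrow> 'a \<Rightarrow> real^'m \<Rightarrow> real^'m \<Rightarrow> real^'m) \<Rightarrow> bool" where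
  "induced_connection M N c DN DM \<longleftrightarrow> connection M DM \<and>
     (\<forall>x\<in>points M. \<forall>k\<in>charts_at M x. \<forall>i\<in>charts_at N x. \<forall>Y.
        smooth_on (coord M k ` patch M k) Y \<longrightarrow>
        (\<forall>g\<in>c. \<forall>X V.
           g i x (ambient_deriv M N DN k i x X Y
                    - jac M N id k i x (cov_deriv id (DM k x) Y (coord M k x) X))
                 (jac M N id k i x V) = 0))"

text \<open>\<open>B(X,Y) = D\<^sup>N\<^sub>X Y - D\<^sup>M\<^sub>X Y\<close>.  Since \<open>B\<close> is tensorial, the vector \<open>Y\<close> may be
  extended to a field with constant components.\<close>

definition second_fundamental_form ::
  "('k, 'a, real^'m) charted \<Rightarrow> ('i, 'a, real^'n) charted
    \<Rightarrow> ('i \<Rightarrow> 'a \<Rightarrow> real^'n \<Rightarrow> real^'n \<Rightarrow> real^'n)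
    \<Rightarrow> ('k \<Rightarrow> 'a \<Rightarrow> real^'m \<Rightarrow> real^'m \<Rightarrow> real^'m)
    \<Rightarrow> 'k \<Rightarrow> 'i \<Rightarrow> 'a \<Rightarrow> real^'m \<Rightarrow> real^'m \<Rightarrow> real^'n" where
  "second_fundamental_form M N DN DM k i x X Y =
     ambient_deriv M N DN k i x X (\<lambda>_. Y)
       - jac M N id k i x (cov_deriv id (DM k x) (\<lambda>_. Y) (coord M k x) X)"

text \<open>Here \<open>q x\<close> is the \<open>(-\<i>)\<close>-eigenspace of the almost complex structure at \<open>x\<close>.\<close>

definition one_one_geodesic ::
  "('k, 'a, real^'m) charted \<Rightarrow> ('i, 'a, real^'n) charted
    \<Rightarrow> ('i \<Rightarrow> 'a \<Rightarrow> real^'n \<Rightarrow> real^'n \<Rightarrow> real^'n)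
    \<Rightarrow> ('k \<Rightarrow> 'a \<Rightarrow> real^'m \<Rightarrow> real^'m \<Rightarrow> real^'m)
    \<Rightarrow> ('a \<Rightarrow> ('k \<Rightarrow> complex^'m) set) \<Rightarrow> bool" where
  "one_one_geodesic M N DN DM q \<longleftrightarrow>
     (\<forall>x\<in>points M. \<forall>X\<in>q x. \<forall>Y\<in>q x. \<forall>k\<in>charts_at M x. \<forall>i\<in>charts_at N x.
        cbilinear_ext (second_fundamental_form M N DN DM k i x) (vec_cnj (X k)) (Y k) = 0)"


section \<open>Almost CR-structures\<close>

text \<open>The complexification of a real vector space \<open>'e\<close> is \<open>'e \<times> 'e\<close>, with \<open>(a, b)\<close> standing for
  \<open>a + \<i> b\<close>.  At a point, an almost CR-structure is a pair \<open>(\<D>, J)\<close> of a subspace and an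
  endomorphism of it; \<open>J (a + \<i> b) = -\<i> (a + \<i> b)\<close> reads \<open>J a = b\<close> and \<open>J b = -a\<close>.\<close>

definition minus_i_eigenspace ::
  "'e::real_vector set \<times> ('e \<Rightarrow> 'e) \<Rightarrow> ('e \<times> 'e) set" where
  "minus_i_eigenspace S =
     {(a, b). a \<in> fst S \<and> b \<in> fst S \<and> snd S a = b \<and> snd S b = - a}"

text \<open>The almost CR-structure with a given \<open>(-\<i>)\<close>-eigenspace \<open>C\<close>, where \<open>C\<close> meets its conjugate
  trivially.  For \<open>a + \<i> b \<in> C\<close> one has \<open>J a = b\<close>.\<close>

definition cr_of :: "('e \<times> 'e) set \<Rightarrow> 'e::real_vector set \<times> ('e \<Rightarrow> 'e)" where
  "cr_of C = (fst ` C, \<lambda>a. THE b. (a, b) \<in> C)"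

lemma
  assumes sub: "subspace C"
    and mult_i: "\<And>a b. (a, b) \<in> C \<Longrightarrow> (- b, a) \<in> C"
    and conj: "\<And>a b. (a, b) \<in> C \<Longrightarrow> (a, - b) \<in> C \<Longrightarrow> a = 0 \<and> b = 0"
  shows minus_i_eigenspace_cr_of: "minus_i_eigenspace (cr_of C) = C"
    and cr_of_square: "a \<in> fst (cr_of C) \<Longrightarrow>
          snd (cr_of C) a \<in> fst (cr_of C) \<and> snd (cr_of C) (snd (cr_of C) a) = - a"
proof -
  have uniq: "b = b'" if "(a, b) \<in> C" "(a, b') \<in> C" for a b b'
  proof -
    have d: "(0, b - b') \<in> C" using subspace_diff[OF sub that] by simp
    have "(0, - (b - b')) \<in> C" using subspace_neg[OF sub d] by simp
    then show ?thesis using conj[OF d] by simp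
  qed
  have J: "snd (cr_of C) a = b" if "(a, b) \<in> C" for a b
    using that uniq by (auto simp: cr_of_def intro!: the_equality)
  have i3: "(b, - a) \<in> C" if "(a, b) \<in> C" for a b
    using subspace_neg[OF sub mult_i[OF that]] by simp
  show "minus_i_eigenspace (cr_of C) = C"
  proof (intro set_eqI iffI)
    fix z assume "z \<in> minus_i_eigenspace (cr_of C)"
    then obtain a b where z: "z = (a, b)" "a \<in> fst ` C" "snd (cr_of C) a = b"
      by (auto simp: minus_i_eigenspace_def cr_of_def)
    then show "z \<in> C" using J by force
  next
    fix z assume "z \<in> C"
    then obtain a b where z: "z = (a, b)" "(a, b) \<in> C" by (cases z) auto
    have "a \<in> fst (cr_of C)" "b \<in> fst (cr_of C)"
      using z(2) i3[OF z(2)] by (force simp: cr_of_def)+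
    then show "z \<in> minus_i_eigenspace (cr_of C)"
      using z J[OF z(2)] J[OF i3[OF z(2)]] by (simp add: minus_i_eigenspace_def)
  qed
  show "snd (cr_of C) a \<in> fst (cr_of C) \<and> snd (cr_of C) (snd (cr_of C) a) = - a"
    if "a \<in> fst (cr_of C)"
  proof -
    from that obtain b where b: "(a, b) \<in> C" by (auto simp: cr_of_def)
    have "b \<in> fst (cr_of C)" using i3[OF b] by (force simp: cr_of_def)
    then show ?thesis using J[OF b] J[OF i3[OF b]] by simp
  qed
qed

definition holomorphic ::
  "('i, 'a, 'e::euclidean_space) charted \<Rightarrow> ('i \<Rightarrow> 'a \<Rightarrow> 'e set \<times> ('e \<Rightarrow> 'e))
    \<Rightarrow> ('j, 'b, 'f::real_normed_vector) charted \<Rightarrow> ('j \<Rightarrow> 'b \<Rightarrow> 'f set \<times> ('f \<Rightarrow> 'f))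
    \<Rightarrow> ('a \<Rightarrow> 'b) \<Rightarrow> bool" where
  "holomorphic A JA B JB F \<longleftrightarrow> smooth_map A B F \<and>
     (\<forall>x\<in>points A. \<forall>i\<in>charts_at A x. \<forall>j\<in>charts_at B (F x).
        \<forall>(a, b)\<in>minus_i_eigenspace (JA i x).
          (jac A B F i j x a, jac A B F i j x b) \<in> minus_i_eigenspace (JB j (F x)))"

definition acs_of :: "('a \<Rightarrow> ('k \<Rightarrow> complex^'m) set) \<Rightarrow> 'k \<Rightarrow> 'a
    \<Rightarrow> (real^'m) set \<times> (real^'m \<Rightarrow> real^'m)" where
  "acs_of q k x = cr_of ((\<lambda>Z. (vec_Re Z, vec_Im Z)) ` comps k (q x))"


section \<open>Bundles of isotropic subspaces\<close>

definition isotropic_bundle ::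
  "('i, 'a, real^'n) charted \<Rightarrow> ('i \<Rightarrow> 'a \<Rightarrow> real^'n \<Rightarrow> real^'n \<Rightarrow> real) set \<Rightarrow> nat
    \<Rightarrow> ('a \<times> ('i \<Rightarrow> complex^'n) set) set" where
  "isotropic_bundle A c r = {(x, P). x \<in> points A \<and> P \<subseteq> tangent_C A x \<and>
     (\<forall>i\<in>charts_at A x. vec.subspace (comps i P) \<and> vec.dim (comps i P) = r \<and>
        (\<forall>g\<in>c. \<forall>Z\<in>comps i P. \<forall>W\<in>comps i P. cbilinear_form_ext (g i x) Z W = 0))}"

text \<open>Two complex structures on \<open>real^'m\<close> induce the same orientation if they have equally
  oriented bases of the form \<open>e\<^sub>0, J e\<^sub>0, e\<^sub>1, J e\<^sub>1, \<dots>\<close>; the bijection \<open>\<sigma>\<close> only numbers the rows.\<close>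

definition complex_frame ::
  "('m \<Rightarrow> nat) \<Rightarrow> (real^'m \<Rightarrow> real^'m) \<Rightarrow> (nat \<Rightarrow> real^'m) \<Rightarrow> real^'m^'m" where
  "complex_frame \<sigma> J e = (\<chi> a. if even (\<sigma> a) then e (\<sigma> a div 2) else J (e (\<sigma> a div 2)))"

definition same_orientation ::
  "(real^'m \<Rightarrow> real^'m) \<Rightarrow> (real^'m \<Rightarrow> real^'m) \<Rightarrow> bool" where
  "same_orientation J J' \<longleftrightarrow>
     (\<exists>\<sigma> e e'. bij_betw \<sigma> (UNIV :: 'm set) {..<CARD('m)} \<and>
        det (complex_frame \<sigma> J e) * det (complex_frame \<sigma> J' e') > 0)"

text \<open>The bundle of positive maximal isotropic spaces, for the orientation given by the almost
  complex structure with \<open>(-\<i>)\<close>-eigenbundle \<open>o\<^sub>M\<close>.\<close>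

definition positive_isotropic_bundle ::
  "('k, 'a, real^'m) charted \<Rightarrow> ('k \<Rightarrow> 'a \<Rightarrow> real^'m \<Rightarrow> real^'m \<Rightarrow> real) set
    \<Rightarrow> ('a \<Rightarrow> ('k \<Rightarrow> complex^'m) set) \<Rightarrow> ('a \<times> ('k \<Rightarrow> complex^'m) set) set" where
  "positive_isotropic_bundle M c o\<^sub>M =
     {(x, q) \<in> isotropic_bundle M c (CARD('m) div 2). \<forall>k\<in>charts_at M x.
        same_orientation (snd (acs_of o\<^sub>M k x)) (snd (acs_of (\<lambda>_. q) k x))}"

text \<open>The Grassmannian of \<open>complex^'n\<close> is embedded in the space of matrices by sending a subspace to
  the orthogonal projector onto it, for the standard Hermitian product.  The projector depends on
  the chart, but is only used as a coordinate.\<close>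

definition adjoint_matrix :: "complex^'n^'n \<Rightarrow> complex^'n^'n" where
  "adjoint_matrix A = (\<chi> a b. cnj (A $ b $ a))"

definition projector :: "(complex^'n) set \<Rightarrow> complex^'n^'n" where
  "projector P = (THE E. E ** E = E \<and> adjoint_matrix E = E \<and> range ((*v) E) = P)"

definition bundle_charts ::
  "('i, 'a, real^'n) charted \<Rightarrow> ('a \<times> ('i \<Rightarrow> complex^'n) set) set
    \<Rightarrow> ('i, 'a \<times> ('i \<Rightarrow> complex^'n) set, (real^'n) \<times> (complex^'n^'n)) charted" where
  "bundle_charts A Q =
     \<lparr>idx = idx A, patch = (\<lambda>i. {q \<in> Q. fst q \<in> patch A i}),
      coord = (\<lambda>i q. (coord A i (fst q), projector (comps i (snd q))))\<rparr>"

text \<open>The set of velocities at \<open>s\<close> of curves in \<open>S\<close>, which for an embedded submanifold \<open>S\<close> is the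
  tangent space (differentiability of the curves at \<open>s\<close> suffices for this).\<close>

definition tangent_space :: "'e::real_normed_vector set \<Rightarrow> 'e \<Rightarrow> 'e set" where
  "tangent_space S s = {v. \<exists>\<gamma>. \<gamma> 0 = s \<and> (\<gamma> has_vector_derivative v) (at 0) \<and>
     (\<forall>\<^sub>F t in at (0::real). \<gamma> t \<in> S)}"

definition bundle_tangent ::
  "('i, 'a, real^'n) charted \<Rightarrow> ('a \<times> ('i \<Rightarrow> complex^'n) set) set
    \<Rightarrow> 'i \<Rightarrow> 'a \<times> ('i \<Rightarrow> complex^'n) set \<Rightarrow> ((real^'n) \<times> (complex^'n^'n)) set" where
  "bundle_tangent A Q i q =
     tangent_space (coord (bundle_charts A Q) i ` patch (bundle_charts A Q) i)
       (coord (bundle_charts A Q) i q)"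

text \<open>Let \<open>(y(t), E(t))\<close> be a curve in the bundle with velocity \<open>(X, S)\<close> at \<open>t = 0\<close>, and \<open>u(t)\<close> a
  curve with \<open>E(t) u(t) = u(t)\<close>.  Then \<open>u' = S u + E u'\<close>, so \<open>S\<close> induces the map
  \<open>u \<mapsto> u'\<close> modulo \<open>P\<close>, the usual identification of the tangent space of the
  Grassmannian at \<open>P\<close> with the complex linear maps from \<open>P\<close> to its quotient space.  Consequently:

  \<^item> the covariant derivative of \<open>u\<close> is \<open>S u + \<Gamma>(X, u)\<close> modulo \<open>P\<close>, and \<open>(X, S)\<close> is horizontal if
    this lies in \<open>P\<close> for all \<open>u\<close> in \<open>P\<close>;

  \<^item> as \<open>S E = (1 - E) S E\<close> and \<open>E S = (S E)\<^sup>*\<close>, multiplication by \<open>\<i>\<close> on the complex linear maps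
    becomes \<open>S \<mapsto> \<i> (S E - E S)\<close> on vertical vectors.\<close>

definition horizontal ::
  "('i, 'a, real^'n) charted \<Rightarrow> ('i \<Rightarrow> 'a \<Rightarrow> real^'n \<Rightarrow> real^'n \<Rightarrow> real^'n)
    \<Rightarrow> ('a \<times> ('i \<Rightarrow> complex^'n) set) set
    \<Rightarrow> 'i \<Rightarrow> 'a \<times> ('i \<Rightarrow> complex^'n) set \<Rightarrow> ((real^'n) \<times> (complex^'n^'n)) set" where
  "horizontal A \<Gamma> Q i q = {(X, S) \<in> bundle_tangent A Q i q.
     \<forall>u\<in>comps i (snd q). S *v u + clinear_ext (\<Gamma> i (fst q) X) u \<in> comps i (snd q)}"

definition vertical ::
  "('i, 'a, real^'n) charted \<Rightarrow> ('a \<times> ('i \<Rightarrow> complex^'n) set) set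
    \<Rightarrow> 'i \<Rightarrow> 'a \<times> ('i \<Rightarrow> complex^'n) set \<Rightarrow> ((real^'n) \<times> (complex^'n^'n)) set" where
  "vertical A Q i q = {(X, S) \<in> bundle_tangent A Q i q. X = 0}"

definition fibre_J ::
  "complex^'n^'n \<Rightarrow> (real^'n) \<times> (complex^'n^'n) \<Rightarrow> (real^'n) \<times> (complex^'n^'n)" where
  "fibre_J E = (\<lambda>(X, S). (X, \<chi> a b. \<i> * (S ** E - E ** S) $ a $ b))"

definition G0 ::
  "('i, 'a, real^'n) charted \<Rightarrow> ('i \<Rightarrow> 'a \<Rightarrow> real^'n \<Rightarrow> real^'n \<Rightarrow> real^'n)
    \<Rightarrow> ('a \<times> ('i \<Rightarrow> complex^'n) set) set \<Rightarrow> 'i \<Rightarrow> 'a \<times> ('i \<Rightarrow> complex^'n) set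
    \<Rightarrow> (((real^'n) \<times> (complex^'n^'n)) \<times> ((real^'n) \<times> (complex^'n^'n))) set" where
  "G0 A \<Gamma> Q i q = {(h, h'). h \<in> horizontal A \<Gamma> Q i q \<and> h' \<in> horizontal A \<Gamma> Q i q \<and>
     vec_Complex (fst h) (fst h') \<in> comps i (snd q)}"

definition vertical_10 ::
  "('i, 'a, real^'n) charted \<Rightarrow> ('a \<times> ('i \<Rightarrow> complex^'n) set) set
    \<Rightarrow> 'i \<Rightarrow> 'a \<times> ('i \<Rightarrow> complex^'n) set
    \<Rightarrow> (((real^'n) \<times> (complex^'n^'n)) \<times> ((real^'n) \<times> (complex^'n^'n))) set" where
  "vertical_10 A Q i q =
     {(v, - fibre_J (projector (comps i (snd q))) v) | v. v \<in> vertical A Q i q}"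

text \<open>The structure \<open>\<J>'\<close>, on a bundle \<open>Q\<close> of isotropic subspaces.\<close>

definition J_prime ::
  "('i, 'a, real^'n) charted \<Rightarrow> ('i \<Rightarrow> 'a \<Rightarrow> real^'n \<Rightarrow> real^'n \<Rightarrow> real^'n)
    \<Rightarrow> ('a \<times> ('i \<Rightarrow> complex^'n) set) set \<Rightarrow> 'i \<Rightarrow> 'a \<times> ('i \<Rightarrow> complex^'n) set
    \<Rightarrow> ((real^'n) \<times> (complex^'n^'n)) set
        \<times> ((real^'n) \<times> (complex^'n^'n) \<Rightarrow> (real^'n) \<times> (complex^'n^'n))" where
  "J_prime A \<Gamma> Q i q = cr_of {z + w | z w. z \<in> G0 A \<Gamma> Q i q \<and> w \<in> vertical_10 A Q i q}"

end

theory Submission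
  imports Defs
begin

text \<open>For a section \<open>p\<close> along \<open>M\<close>, the differential of \<open>p\<close> at \<open>X\<close> splits into the horizontal lift of \<open>X\<close> and
  the vertical vector \<open>u \<mapsto> D\<^sub>X u\<close> modulo \<open>p\<close> in \<open>Hom(p, T/p)\<close>.  Since the \<open>(-\<i>)\<close>-eigenspace contains
  the vertical \<open>(1,0)\<close>-vectors, holomorphy of \<open>p\<close> means that \<open>D\<^sub>X u\<close> is a section of \<open>p\<close> for all sections \<open>u\<close> of
  \<open>p\<close> and all \<open>X\<close> in the conjugate of \<open>p\<close>.  Applying this to \<open>D\<^sup>N\<close> and to \<open>D\<^sup>M\<close> and writing
  \<open>D\<^sup>N = D\<^sup>M + B\<close>, where \<open>B\<close> is normal to \<open>M\<close>, gives the equivalence.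

  The analytic input is that horizontal lifts are tangent to the bundle, that is, a first order
  deformation of an isotropic subspace that satisfies the linearised isotropy equation is the velocity
  of a curve of isotropic subspaces.\<close>

section \<open>Complex matrices and orthogonal projectors\<close>

text \<open>Tangent vectors of the bundles are velocities of curves that need be differentiable at a
  single time only. A deformed subspace can therefore be corrected separately at each time:
  Brouwer's theorem supplies a correction no larger than the isotropy defect, which is o(t), and no
  regularity in t of the chosen corrections matters. Horizontal lifts satisfy the linearised
  equation because the one-form of a Weyl connection enters only multiplied by the metric, which
  vanishes on isotropic subspaces. Tangent vectors are handled through the orthogonal projector
  \<open>E\<close>: the block \<open>(1 - E)(S + \<Gamma>)E\<close> represents the vertical part,
  and self-adjointness recovers a vertical \<open>S\<close> from that block. The bundles over
  \<open>N\<close> and over \<open>M\<close> are instances of the same locales, the second with the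
  identity of \<open>M\<close> as immersion. The positive bundle needs one extra fact, that
  positivity is an open condition and so leaves the tangent spaces unchanged; this rests on the
  continuity of determinants of real frames.\<close>

lemma matrix_sub_ldistrib: "A ** (B - C) = A ** B - A ** (C :: 'a::ring_1^'n^'m)"
  by (simp add: matrix_matrix_mult_def vec_eq_iff algebra_simps sum_subtractf)

lemma matrix_sub_rdistrib: "(B - C) ** A = B ** A - C ** (A :: 'a::ring_1^'n^'m)"
  by (simp add: matrix_matrix_mult_def vec_eq_iff algebra_simps sum_subtractf)

lemma matrix_neg_left [simp]: "(- B) ** A = - (B ** (A :: 'a::ring_1^'n^'m))"
  by (simp add: matrix_matrix_mult_def vec_eq_iff sum_negf)

lemma matrix_neg_right [simp]: "B ** (- A) = - (B ** (A :: 'a::ring_1^'n^'m))"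
  by (simp add: matrix_matrix_mult_def vec_eq_iff sum_negf)

lemma matrix_zero_right [simp]: "A ** 0 = (0 :: 'a::semiring_1^'n^'m)"
  by (simp add: matrix_matrix_mult_def vec_eq_iff)

lemma matrix_plus_rdistrib: "(B + C) ** A = B ** A + C ** (A :: 'a::semiring_1^'n^'m)"
  by (simp add: matrix_matrix_mult_def vec_eq_iff algebra_simps sum.distrib)

lemmas matrix_ring_simps = matrix_mul_assoc matrix_sub_ldistrib matrix_sub_rdistrib
  matrix_add_ldistrib matrix_plus_rdistrib

lemma transpose_add: "transpose (A + B) = transpose A + transpose B"
  and transpose_diff: "transpose (A - B) = transpose A - transpose (B :: 'a::ring_1^'n^'m)"
  and transpose_zero [simp]: "transpose (0 :: 'a::ring_1^'n^'m) = 0"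
  by (simp_all add: transpose_def vec_eq_iff)

lemma bounded_bilinear_matrix_mult:
  "bounded_bilinear ((**) :: complex^'n^'m \<Rightarrow> complex^'p^'n \<Rightarrow> complex^'p^'m)"
proof -
  have "c *\<^sub>R A ** B = c *\<^sub>R (A ** B)" "A ** c *\<^sub>R B = c *\<^sub>R (A ** B)"
    for c and A :: "complex^'n^'m" and B :: "complex^'p^'n"
    by (simp_all add: matrix_matrix_mult_def vec_eq_iff scaleR_sum_right)
  then show ?thesis
    by (simp add: bilinear_conv_bounded_bilinear [symmetric] bilinear_def linear_iff
        matrix_add_ldistrib matrix_plus_rdistrib)
qed

lemma bounded_bilinear_matrix_vector_mult:
  "bounded_bilinear ((*v) :: complex^'n^'m \<Rightarrow> complex^'n \<Rightarrow> complex^'m)"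
proof -
  have "c *\<^sub>R A *v x = c *\<^sub>R (A *v x)" "A *v c *\<^sub>R x = c *\<^sub>R (A *v x)"
    for c and A :: "complex^'n^'m" and x
    by (simp_all add: matrix_vector_mult_def vec_eq_iff scaleR_sum_right)
  then show ?thesis
    by (simp add: bilinear_conv_bounded_bilinear [symmetric] bilinear_def linear_iff
        matrix_vector_right_distrib matrix_vector_mult_add_rdistrib)
qed

lemma bounded_linear_transpose: "bounded_linear (transpose :: complex^'n^'m \<Rightarrow> complex^'m^'n)"
  by (simp add: linear_conv_bounded_linear [symmetric] linear_iff transpose_def vec_eq_iff)

lemma adjoint_matrix_nth [simp]: "adjoint_matrix A $ a $ b = cnj (A $ b $ a)"
  by (simp add: adjoint_matrix_def)

lemma adjoint_matrix_mult: "adjoint_matrix (A ** B) = adjoint_matrix B ** adjoint_matrix A"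
  by (simp add: matrix_matrix_mult_def vec_eq_iff mult.commute)

lemma adjoint_matrix_add: "adjoint_matrix (A + B) = adjoint_matrix A + adjoint_matrix B"
  and adjoint_matrix_diff: "adjoint_matrix (A - B) = adjoint_matrix A - adjoint_matrix B"
  and adjoint_matrix_minus: "adjoint_matrix (- A) = - adjoint_matrix A"
  and adjoint_matrix_zero [simp]: "adjoint_matrix 0 = 0"
  and adjoint_matrix_one [simp]: "adjoint_matrix (mat 1) = mat 1"
  and adjoint_matrix_invol [simp]: "adjoint_matrix (adjoint_matrix A) = A"
  by (simp_all add: vec_eq_iff mat_def)

lemma bounded_linear_adjoint_matrix: "bounded_linear adjoint_matrix"
  by (simp add: linear_conv_bounded_linear [symmetric] linear_iff vec_eq_iff)

text \<open>The real inner product on \<open>complex^'n\<close> is the real part of the Hermitian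
  product, which makes the conjugate transpose the adjoint. The matrix is written out because
  \<open>adjoint_matrix\<close> is confined to square matrices, while the differential of an
  immersion is rectangular.\<close>

lemma inner_conjugate_transpose:
  fixes A :: "complex^'n^'m"
  shows "inner (A *v v) w = inner v ((\<chi> a b. cnj (A $ b $ a)) *v w)"
proof -
  have c: "inner z u = Re (cnj z * u)" for z u :: complex by (simp add: inner_complex_def)
  have "inner (A *v v) w = (\<Sum>a\<in>UNIV. \<Sum>b\<in>UNIV. Re (cnj (A $ a $ b) * cnj (v $ b) * w $ a))"
    unfolding inner_vec_def c matrix_vector_mult_def
    by (simp only: vec_lambda_beta cnj_sum sum_distrib_right Re_sum complex_cnj_mult)
  also have "\<dots> = (\<Sum>b\<in>UNIV. \<Sum>a\<in>UNIV. Re (cnj (A $ a $ b) * cnj (v $ b) * w $ a))"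
    by (rule sum.swap)
  also have "\<dots> = inner v ((\<chi> a b. cnj (A $ b $ a)) *v w)"
    unfolding inner_vec_def c matrix_vector_mult_def
    by (simp only: vec_lambda_beta sum_distrib_left Re_sum mult_ac)
  finally show ?thesis .
qed

lemma inner_adjoint_matrix: "inner (A *v v) w = inner v (adjoint_matrix A *v w)"
  unfolding adjoint_matrix_def by (rule inner_conjugate_transpose)

lemma vec_smult_simps:
  "A *v (c *s x) = c *s (A *v (x :: complex^'n))"
  by (simp add: matrix_vector_mult_def vec_eq_iff sum_distrib_left algebra_simps)

lemma invertible_if_inj:
  fixes A :: "'a::field^'n^'n"
  assumes "\<And>x. A *v x = 0 \<Longrightarrow> x = 0"
  shows "invertible A"
  by (simp add: invertible_left_inverse matrix_left_invertible_ker assms)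

lemma matrix_inv_works:
  fixes A :: "'a::field^'n^'n"
  assumes "invertible A"
  shows "A ** matrix_inv A = mat 1" "matrix_inv A ** A = mat 1"
  using someI_ex[OF assms[unfolded invertible_def]] by (simp_all add: matrix_inv_def)

lemma matrix_inv_eqI:
  fixes A :: "'a::field^'n^'n"
  assumes "A ** B = mat 1"
  shows "matrix_inv A = B"
proof -
  have "invertible A" unfolding invertible_right_inverse using assms by (rule exI)
  then show ?thesis
    by (metis assms matrix_inv_works(2) matrix_mul_assoc matrix_mul_lid matrix_mul_rid)
qed

text \<open>A classical formula for the orthogonal projector with the same range as an idempotent
  \<open>F\<close>. It uses only algebra, the adjoint and a matrix inverse, so smoothness of an
  oblique projection passes to the orthogonal one.\<close>

definition orth_projector_of :: "complex^'n^'n \<Rightarrow> complex^'n^'n" where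
  "orth_projector_of F = F ** matrix_inv (F + adjoint_matrix F - mat 1)"

text \<open>The shift is self-adjoint and its square is \<open>1 + K K'\<close>, where
  \<open>K\<close> is \<open>F\<close> minus its adjoint and \<open>K'\<close> is the adjoint of
  \<open>K\<close>; such a square is positive definite.\<close>

lemma invertible_idempotent_shift:
  assumes F: "F ** F = F"
  shows "invertible (F + adjoint_matrix F - mat 1)"
proof (rule invertible_if_inj)
  let ?S = "F + adjoint_matrix F - mat 1" and ?K = "F - adjoint_matrix F"
  have F': "adjoint_matrix F ** adjoint_matrix F = adjoint_matrix F"
    by (simp add: F flip: adjoint_matrix_mult)
  have sq: "?S ** ?S = mat 1 + ?K ** adjoint_matrix ?K"
    by (simp add: matrix_ring_simps adjoint_matrix_diff F F' algebra_simps)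
  fix v assume v: "?S *v v = 0"
  have "0 = inner (?S *v (?S *v v)) v" by (simp add: v)
  also have "\<dots> = inner v v + inner (?K *v (adjoint_matrix ?K *v v)) v"
    by (simp add: matrix_vector_mul_assoc sq matrix_vector_mult_add_rdistrib inner_add_left)
  also have "\<dots> = inner v v + inner (adjoint_matrix ?K *v v) (adjoint_matrix ?K *v v)"
    by (simp only: inner_adjoint_matrix)
  finally have "inner v v \<le> 0" by (smt (verit) inner_ge_zero)
  then have "inner v v = 0" by (rule order.antisym) (rule inner_ge_zero)
  then show "v = 0" by (simp only: inner_eq_zero_iff)
qed

lemma orth_projector_of:
  assumes F: "F ** F = F"
  defines "E \<equiv> orth_projector_of F"
  shows "E ** E = E" "adjoint_matrix E = E" "range ((*v) E) = range ((*v) F)"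
proof -
  let ?S = "F + adjoint_matrix F - mat 1" and ?F' = "adjoint_matrix F"
  let ?R = "matrix_inv ?S"
  have F': "?F' ** ?F' = ?F'"
    by (simp add: F flip: adjoint_matrix_mult)
  note R = matrix_inv_works[OF invertible_idempotent_shift[OF F]]
  have E: "E = F ** ?R" by (simp add: E_def orth_projector_of_def)
  \<comment> \<open>Both sides of \<open>c1\<close> equal \<open>F F'\<close>, both sides of
    \<open>c2\<close> equal \<open>F' F\<close>. By \<open>swap\<close>, moving the inverse of the
    shift across a factor exchanges \<open>F\<close> and \<open>F'\<close>.\<close>
  have c1: "F ** ?S = ?S ** ?F'" and c2: "?F' ** ?S = ?S ** F"
    by (simp_all add: matrix_ring_simps F F')
  have swap: "?R ** X = Y ** ?R" if "X ** ?S = ?S ** Y" for X Y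
  proof -
    have "?R ** X = ?R ** (X ** ?S) ** ?R" by (metis R(1) matrix_mul_assoc matrix_mul_rid)
    also have "\<dots> = Y ** ?R" by (metis that R(2) matrix_mul_assoc matrix_mul_lid)
    finally show ?thesis .
  qed
  have adj: "adjoint_matrix ?R = ?R"
  proof -
    have "adjoint_matrix (?R ** ?S) = mat 1" by (simp add: R)
    moreover have "adjoint_matrix ?S = ?S"
      by (simp add: adjoint_matrix_diff adjoint_matrix_add add.commute)
    ultimately show ?thesis by (metis adjoint_matrix_mult matrix_inv_eqI)
  qed
  show "adjoint_matrix E = E" by (simp add: E adjoint_matrix_mult adj swap[OF c2])
  have "E ** E = F ** (?R ** F) ** ?R" by (simp add: E matrix_mul_assoc)
  also have "\<dots> = F ** ?F' ** ?R ** ?R" by (simp add: swap[OF c1] matrix_mul_assoc)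
  also have "F ** ?F' = F ** ?S" by (simp add: matrix_ring_simps F)
  also have "F ** ?S ** ?R ** ?R = E"
    by (metis E R(1) matrix_mul_assoc matrix_mul_rid)
  finally show "E ** E = E" .
  have "E ** ?S = F" by (metis E R(2) matrix_mul_assoc matrix_mul_rid)
  then have e1: "F *v x = E *v (?S *v x)" for x by (simp add: matrix_vector_mul_assoc)
  have e2: "E *v x = F *v (?R *v x)" for x by (simp add: E matrix_vector_mul_assoc)
  show "range ((*v) E) = range ((*v) F)"
  proof (intro subset_antisym image_subsetI)
    show "E *v x \<in> range ((*v) F)" for x by (subst e2) (rule rangeI)
    show "F *v x \<in> range ((*v) E)" for x by (subst e1) (rule rangeI)
  qed
qed

lemma idempotent_range_iff:
  fixes E :: "complex^'n^'n"
  assumes "E ** E = E"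
  shows "u \<in> range ((*v) E) \<longleftrightarrow> E *v u = u"
proof
  assume "u \<in> range ((*v) E)"
  then obtain x where "u = E *v x" by auto
  then show "E *v u = u" by (simp add: matrix_vector_mul_assoc assms)
next
  assume "E *v u = u"
  then show "u \<in> range ((*v) E)" by (metis rangeI)
qed

lemma projector_eqI:
  assumes "E ** E = E" "adjoint_matrix E = E" "range ((*v) E) = P"
  shows "projector P = E"
  unfolding projector_def
proof (rule the_equality)
  show "E ** E = E \<and> adjoint_matrix E = E \<and> range ((*v) E) = P" using assms by simp
  fix D assume D: "D ** D = D \<and> adjoint_matrix D = D \<and> range ((*v) D) = P"
  have "D *v x \<in> range ((*v) E)" "E *v x \<in> range ((*v) D)" for x
    using D assms(3) by blast+
  then have "E *v (D *v x) = D *v x" "D *v (E *v x) = E *v x" for x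
    using D assms(1) idempotent_range_iff by blast+
  then have "E ** D = D" "D ** E = E"
    by (simp_all only: matrix_eq matrix_vector_mul_assoc [symmetric] simp_thms)
  \<comment> \<open>Taking adjoints in \<open>E ** D = D\<close> gives \<open>D ** E = D\<close>, to
    be compared with \<open>D ** E = E\<close>.\<close>
  then show "D = E" by (metis D assms(2) adjoint_matrix_mult)
qed

lemma projector:
  assumes P: "vec.subspace P"
  shows projector_idem: "projector P ** projector P = projector P"
    and projector_adjoint: "adjoint_matrix (projector P) = projector P"
    and range_projector: "range ((*v) (projector P)) = P"
proof -
  \<comment> \<open>A linear left inverse of the identity on \<open>P\<close>, with values in
    \<open>P\<close>, is an oblique projection onto \<open>P\<close>; it only remains to
    orthogonalise it.\<close>
  have "\<exists>g. g ` UNIV \<subseteq> P \<and> Vector_Spaces.linear (*s) (*s) g \<and> (\<forall>v\<in>P. g (id v) = v)"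
    using P by (intro vec.linear_exists_left_inverse_on) (auto simp: vec.linear_ident)
  then obtain g where g: "range g \<subseteq> P" "Vector_Spaces.linear (*s) (*s) g" "\<And>v. v \<in> P \<Longrightarrow> g v = v"
    by auto
  define F where "F = matrix g"
  have Fg: "F *v v = g v" for v unfolding F_def using g(2) by (rule matrix_works)
  have F: "F ** F = F" by (simp add: matrix_eq Fg g subset_eq flip: matrix_vector_mul_assoc)
       (use g in auto)
  have r: "range ((*v) F) = P" using g by (auto simp: Fg) (metis rangeI)
  note E = orth_projector_of[OF F, unfolded r]
  have "projector P = orth_projector_of F" by (rule projector_eqI[OF E])
  then show "projector P ** projector P = projector P" "adjoint_matrix (projector P) = projector P"
    "range ((*v) (projector P)) = P" using E by auto
qed

lemma projector_range: "F ** F = F \<Longrightarrow> projector (range ((*v) F)) = orth_projector_of F"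
  by (intro projector_eqI orth_projector_of)

lemma projector_mem_iff: "vec.subspace P \<Longrightarrow> u \<in> P \<longleftrightarrow> projector P *v u = u"
  using idempotent_range_iff[OF projector_idem] range_projector by blast

lemma projector_mem [simp]: "vec.subspace P \<Longrightarrow> projector P *v u \<in> P"
  using range_projector by blast

section \<open>Calculus of smooth maps\<close>

lemma Ck_on_subset: "Ck_on k S f \<Longrightarrow> T \<subseteq> S \<Longrightarrow> Ck_on k T f"
  by (induction k arbitrary: f) (auto intro: continuous_on_subset)

lemma smooth_on_subset: "smooth_on S f \<Longrightarrow> T \<subseteq> S \<Longrightarrow> smooth_on T f"
  by (auto simp: smooth_on_def intro: Ck_on_subset)

lemma frechet_derivative_cong_open:
  assumes "open S" "x \<in> S" "\<And>y. y \<in> S \<Longrightarrow> f y = g y"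
  shows "frechet_derivative f (at x) = frechet_derivative g (at x)"
    and "f differentiable at x \<longleftrightarrow> g differentiable at x"
proof -
  have iff: "(f has_derivative D) (at x) \<longleftrightarrow> (g has_derivative D) (at x)" for D
    using assms has_derivative_transform_within_open[of _ D x UNIV S] by metis
  then show "frechet_derivative f (at x) = frechet_derivative g (at x)"
    "f differentiable at x \<longleftrightarrow> g differentiable at x"
    by (simp_all add: frechet_derivative_def differentiable_def)
qed

lemma Ck_on_cong:
  assumes S: "open S" and eq: "\<And>x. x \<in> S \<Longrightarrow> f x = g x" and f: "Ck_on k S f"
  shows "Ck_on k S g"
  using eq f
proof (induction k arbitrary: f g)
  case 0
  then show ?case using continuous_on_cong[of S S f g] by simp
next
  case (Suc k)
  note d = frechet_derivative_cong_open[OF S _ Suc.prems(1)]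
  show ?case
    unfolding Ck_on.simps
  proof (intro conjI ballI allI)
    fix x assume "x \<in> S"
    then show "g differentiable at x" using d(2) Suc.prems(2) by auto
  next
    fix v
    show "Ck_on k S (\<lambda>x. frechet_derivative g (at x) v)"
      by (rule Suc.IH[of "\<lambda>x. frechet_derivative f (at x) v"]) (use d(1) Suc.prems in auto)
  qed
qed

lemma smooth_on_cong:
  "open S \<Longrightarrow> (\<And>x. x \<in> S \<Longrightarrow> f x = g x) \<Longrightarrow> smooth_on S f \<Longrightarrow> smooth_on S g"
  unfolding smooth_on_def using Ck_on_cong by blast

lemma Ck_on_local:
  assumes "\<And>x. x \<in> S \<Longrightarrow> \<exists>W. open W \<and> x \<in> W \<and> Ck_on k W f"
  shows "Ck_on k S f"
  using assms
proof (induction k arbitrary: f)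
  case 0
  then have "isCont f x" if "x \<in> S" for x
    using that by (metis Ck_on.simps(1) continuous_on_eq_continuous_at)
  then show ?case by (simp add: continuous_at_imp_continuous_on)
next
  case (Suc k)
  then show ?case
    unfolding Ck_on.simps by (metis (no_types, lifting))
qed

lemma smooth_on_local:
  assumes "\<And>x. x \<in> S \<Longrightarrow> \<exists>W. open W \<and> x \<in> W \<and> smooth_on W f"
  shows "smooth_on S f"
  using assms unfolding smooth_on_def by (metis Ck_on_local)

lemma Ck_on_Suc_imp: "Ck_on (Suc k) S f \<Longrightarrow> Ck_on k S f"
proof (induction k arbitrary: f)
  case 0
  then show ?case
    by (simp add: continuous_at_imp_continuous_on differentiable_imp_continuous_within)
next
  case (Suc k)
  then show ?case by (metis Ck_on.simps(2))
qed

lemma smooth_on_differentiable: "smooth_on S f \<Longrightarrow> x \<in> S \<Longrightarrow> f differentiable at x"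
  unfolding smooth_on_def by (metis Ck_on.simps(2))

lemma smooth_on_derivative: "smooth_on S f \<Longrightarrow> smooth_on S (\<lambda>x. frechet_derivative f (at x) v)"
  unfolding smooth_on_def by (metis Ck_on.simps(2))

lemma smooth_on_continuous: "smooth_on S f \<Longrightarrow> continuous_on S f"
  unfolding smooth_on_def by (metis Ck_on.simps(1))

lemma frechet_derivativeI: "(f has_derivative D) (at x) \<Longrightarrow> frechet_derivative f (at x) = D"
  using frechet_derivative_at by metis

text \<open>\<open>Ck_on\<close> speaks of \<open>frechet_derivative\<close>; on an open set,
  uniqueness of derivatives allows any explicitly computed family of derivatives to take its
  place.\<close>

lemma Ck_on_SucI:
  assumes S: "open S" and f: "\<And>x. x \<in> S \<Longrightarrow> (f has_derivative D x) (at x)"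
    and D: "\<And>v. Ck_on k S (\<lambda>x. D x v)"
  shows "Ck_on (Suc k) S f"
  unfolding Ck_on.simps
proof (intro conjI ballI allI)
  show "f differentiable at x" if "x \<in> S" for x
    using f[OF that] by (auto simp: differentiable_def)
  show "Ck_on k S (\<lambda>x. frechet_derivative f (at x) v)" for v
    by (rule Ck_on_cong[OF S _ D[of v]]) (simp add: frechet_derivativeI[OF f])
qed

lemma Ck_on_const: "Ck_on k S (\<lambda>x. c)"
  by (induction k arbitrary: c) (auto simp: frechet_derivative_const)

lemma Ck_on_bounded_linear:
  assumes S: "open S" and h: "bounded_linear h" and f: "Ck_on k S f"
  shows "Ck_on k S (\<lambda>x. h (f x))"
  using f
proof (induction k arbitrary: f)
  case 0
  then show ?case using h by (simp add: bounded_linear.continuous_on)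
next
  case (Suc k)
  show ?case
  proof (rule Ck_on_SucI[OF S])
    fix x assume "x \<in> S"
    then have "(f has_derivative frechet_derivative f (at x)) (at x)"
      using Suc.prems by (simp add: frechet_derivative_works)
    then show "((\<lambda>x. h (f x)) has_derivative (\<lambda>v. h (frechet_derivative f (at x) v))) (at x)"
      by (rule bounded_linear.has_derivative[OF h])
  qed (use Suc in simp)
qed

lemma Ck_on_add:
  assumes S: "open S" and f: "Ck_on k S f" and g: "Ck_on k S g"
  shows "Ck_on k S (\<lambda>x. f x + g x)"
  using f g
proof (induction k arbitrary: f g)
  case 0
  then show ?case by (simp add: continuous_on_add)
next
  case (Suc k)
  show ?case
  proof (rule Ck_on_SucI[OF S])
    fix x assume "x \<in> S"
    then show "((\<lambda>x. f x + g x) has_derivative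
        (\<lambda>v. frechet_derivative f (at x) v + frechet_derivative g (at x) v)) (at x)"
      using Suc.prems by (intro has_derivative_add) (simp_all add: frechet_derivative_works)
  qed (use Suc in simp)
qed

lemma Ck_on_sum:
  assumes S: "open S" and f: "\<And>i. i \<in> I \<Longrightarrow> Ck_on k S (f i)"
  shows "Ck_on k S (\<lambda>x. \<Sum>i\<in>I. f i x)"
  using f by (induction I rule: infinite_finite_induct) (simp_all add: Ck_on_const Ck_on_add[OF S])

lemma Ck_on_bilinear:
  assumes S: "open S" and h: "bounded_bilinear h" and f: "Ck_on k S f" and g: "Ck_on k S g"
  shows "Ck_on k S (\<lambda>x. h (f x) (g x))"
  using f g
proof (induction k arbitrary: f g)
  case 0
  then show ?case using h by (simp add: bounded_bilinear.continuous_on)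
next
  case (Suc k)
  show ?case
  proof (rule Ck_on_SucI[OF S])
    fix x assume "x \<in> S"
    then show "((\<lambda>x. h (f x) (g x)) has_derivative
        (\<lambda>v. h (f x) (frechet_derivative g (at x) v) + h (frechet_derivative f (at x) v) (g x))) (at x)"
      using Suc.prems
      by (intro bounded_bilinear.FDERIV[OF h]) (simp_all add: frechet_derivative_works)
  next
    fix v
    show "Ck_on k S (\<lambda>x. h (f x) (frechet_derivative g (at x) v) + h (frechet_derivative f (at x) v) (g x))"
      using Suc.prems by (intro Ck_on_add[OF S] Suc.IH) (simp_all add: Ck_on_Suc_imp del: Ck_on.simps(2), simp_all)
  qed
qed

lemma Ck_on_compose:
  assumes S: "open S" and T: "open T" and f: "Ck_on k S f" and g: "Ck_on k T g"
    and sub: "f ` S \<subseteq> T"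
  shows "Ck_on k S (\<lambda>x. g (f x))"
  using f g sub
proof (induction k arbitrary: f g)
  case 0
  then show ?case by (auto intro: continuous_on_compose2)
next
  case (Suc k)
  let ?f' = "\<lambda>x. frechet_derivative f (at x)" and ?g' = "\<lambda>y. frechet_derivative g (at y)"
  show ?case
  proof (rule Ck_on_SucI[OF S])
    fix x assume x: "x \<in> S"
    have df: "(f has_derivative ?f' x) (at x)"
      using x Suc.prems by (simp add: frechet_derivative_works)
    have dg: "(g has_derivative ?g' (f x)) (at (f x))"
      using x Suc.prems by (auto simp: frechet_derivative_works image_subset_iff)
    have lin: "linear (?g' (f x))" using dg by (rule has_derivative_linear)
    \<comment> \<open>\<open>Ck_on\<close> controls derivatives in fixed directions only, while the
      chain rule differentiates \<open>g\<close> in the moving direction \<open>?f' x v\<close>.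
      Expanding that direction in \<open>Basis\<close> leads back to fixed directions.\<close>
    have "?g' (f x) (?f' x v) = (\<Sum>b\<in>Basis. (?f' x v \<bullet> b) *\<^sub>R ?g' (f x) b)" for v
      by (subst euclidean_representation[of "?f' x v", symmetric])
         (simp add: linear_sum[OF lin] linear_scale[OF lin])
    then show "((\<lambda>x. g (f x)) has_derivative (\<lambda>v. \<Sum>b\<in>Basis. (?f' x v \<bullet> b) *\<^sub>R ?g' (f x) b)) (at x)"
      using has_derivative_compose[OF df dg] by simp
  next
    fix v
    show "Ck_on k S (\<lambda>x. \<Sum>b\<in>Basis. (?f' x v \<bullet> b) *\<^sub>R ?g' (f x) b)"
    proof (intro Ck_on_sum[OF S] Ck_on_bilinear[OF S bounded_bilinear_scaleR])
      fix b :: 'b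
      show "Ck_on k S (\<lambda>x. ?f' x v \<bullet> b)"
        using Suc.prems by (intro Ck_on_bounded_linear[OF S bounded_linear_inner_left]) simp
      show "Ck_on k S (\<lambda>x. ?g' (f x) b)"
        using Suc.prems by (intro Suc.IH[of f "\<lambda>y. ?g' y b"]) (simp_all add: Ck_on_Suc_imp del: Ck_on.simps(2), simp)
    qed
  qed
qed

lemma smooth_on_const: "smooth_on S (\<lambda>x. c)"
  and smooth_on_bounded_linear: "open S \<Longrightarrow> bounded_linear h \<Longrightarrow> smooth_on S f \<Longrightarrow> smooth_on S (\<lambda>x. h (f x))"
  and smooth_on_add: "open S \<Longrightarrow> smooth_on S f \<Longrightarrow> smooth_on S g \<Longrightarrow> smooth_on S (\<lambda>x. f x + g x)"
  and smooth_on_sum: "open S \<Longrightarrow> (\<And>i. i \<in> I \<Longrightarrow> smooth_on S (F i)) \<Longrightarrow> smooth_on S (\<lambda>x. \<Sum>i\<in>I. F i x)"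
  unfolding smooth_on_def by (auto intro: Ck_on_const Ck_on_bounded_linear Ck_on_add Ck_on_sum)

lemma smooth_on_bilinear:
  "open S \<Longrightarrow> bounded_bilinear h \<Longrightarrow> smooth_on S f \<Longrightarrow> smooth_on S g \<Longrightarrow> smooth_on S (\<lambda>x. h (f x) (g x))"
  unfolding smooth_on_def by (auto intro: Ck_on_bilinear)

lemma smooth_on_compose:
  "open S \<Longrightarrow> open T \<Longrightarrow> smooth_on S f \<Longrightarrow> smooth_on T g \<Longrightarrow> f ` S \<subseteq> T \<Longrightarrow> smooth_on S (\<lambda>x. g (f x))"
  unfolding smooth_on_def by (blast intro: Ck_on_compose)

lemma smooth_on_diff:
  assumes "open S" "smooth_on S f" "smooth_on S g"
  shows "smooth_on S (\<lambda>x. f x - g x)"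
  using smooth_on_add[OF assms(1,2) smooth_on_bounded_linear[OF assms(1)
        bounded_linear_minus[OF bounded_linear_ident] assms(3)]] by simp

lemma bounded_linear_axis: "bounded_linear (axis a :: 'a::real_normed_vector \<Rightarrow> 'a^'n)"
proof (rule bounded_linear_intro[where K = 1])
  show "norm (axis a x :: 'a^'n) \<le> norm x * 1" for x :: 'a
  proof -
    have "norm (axis a x :: 'a^'n) \<le> (\<Sum>b\<in>UNIV. norm ((axis a x :: 'a^'n) $ b))"
      unfolding norm_vec_def by (rule L2_set_le_sum) simp
    also have "\<dots> = (\<Sum>b\<in>UNIV. if b = a then norm x else 0)"
      by (rule sum.cong) (auto simp: axis_def)
    finally show ?thesis by simp
  qed
qed (auto simp: axis_def vec_eq_iff)

lemma vec_as_axis_sum: "(v :: 'a::comm_monoid_add^'n) = (\<Sum>a\<in>UNIV. axis a (v $ a))"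
  by (simp add: vec_eq_iff axis_def)

lemma smooth_on_vec:
  fixes f :: "'e::euclidean_space \<Rightarrow> 'f::real_normed_vector^'n"
  assumes S: "open S" and f: "\<And>a. smooth_on S (\<lambda>x. f x $ a)"
  shows "smooth_on S f"
proof -
  have "smooth_on S (\<lambda>x. \<Sum>a\<in>UNIV. axis a (f x $ a))"
    by (intro smooth_on_sum S smooth_on_bounded_linear[OF S bounded_linear_axis f])
  then show ?thesis by (simp flip: vec_as_axis_sum)
qed

lemma smooth_on_Pair:
  assumes S: "open S" and "smooth_on S f" "smooth_on S g"
  shows "smooth_on S (\<lambda>x. (f x, g x))"
proof -
  have 1: "bounded_linear (\<lambda>a. (a, 0))" and 2: "bounded_linear (\<lambda>b. (0, b))"
    by (auto intro: bounded_linear_Pair bounded_linear_ident bounded_linear_zero)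
  from smooth_on_add[OF S smooth_on_bounded_linear[OF S 1 assms(2)] smooth_on_bounded_linear[OF S 2 assms(3)]]
  show ?thesis by simp
qed

section \<open>Smoothness of matrix inversion and of orthogonal projectors\<close>

lemma tendsto_det:
  fixes A :: "'b \<Rightarrow> 'a::real_normed_field^'n^'n"
  assumes "\<And>i j. ((\<lambda>x. A x $ i $ j) \<longlongrightarrow> L $ i $ j) F"
  shows "((\<lambda>x. det (A x)) \<longlongrightarrow> det L) F"
  unfolding det_def by (intro tendsto_sum tendsto_mult tendsto_const tendsto_prod assms)

text \<open>Cramer's rule for the equation solved by column \<open>l\<close> of the inverse. Entries
  of the inverse become quotients of determinants, which gives continuity of inversion.\<close>

lemma matrix_inv_cramer:
  fixes A :: "'a::field^'n^'n"
  assumes "det A \<noteq> 0"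
  shows "matrix_inv A $ k $ l = det (\<chi> i j. if j = k then axis l 1 $ i else A $ i $ j) / det A"
proof -
  have "A *v (matrix_inv A *v axis l 1) = axis l 1"
    using matrix_inv_works(1)[of A] assms by (simp add: matrix_vector_mul_assoc invertible_det_nz)
  moreover have "matrix_inv A *v axis l 1 = column l (matrix_inv A)"
    by (simp add: matrix_vector_mult_def axis_def column_def if_distrib cong: if_cong)
  ultimately show ?thesis
    using cramer[OF assms, of "column l (matrix_inv A)" "axis l 1"] by (simp add: vec_eq_iff column_def)
qed

lemma isCont_matrix_inv:
  fixes A :: "'a::real_normed_field^'n^'n"
  assumes A: "det A \<noteq> 0"
  shows "(matrix_inv \<longlongrightarrow> matrix_inv A) (at A)"
proof (intro vec_tendstoI)
  fix k l
  have entries: "((\<lambda>B. B $ i $ j) \<longlongrightarrow> A $ i $ j) (at A)" for i j :: 'n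
    by (intro tendsto_vec_nth tendsto_ident_at)
  have d: "((\<lambda>B. det B) \<longlongrightarrow> det A) (at A)" by (intro tendsto_det entries)
  have "((\<lambda>B. det (\<chi> i j. if j = k then axis l 1 $ i else B $ i $ j) / det B) \<longlongrightarrow>
      det (\<chi> i j. if j = k then axis l 1 $ i else A $ i $ j) / det A) (at A)"
  proof (rule tendsto_divide[OF _ d A], rule tendsto_det)
    fix i j
    show "((\<lambda>B. (\<chi> i j. if j = k then axis l 1 $ i else B $ i $ j) $ i $ j) \<longlongrightarrow>
        (\<chi> i j. if j = k then axis l 1 $ i else A $ i $ j) $ i $ j) (at A)"
      by (cases "j = k") (simp_all add: entries)
  qed
  moreover have "\<forall>\<^sub>F B in at A. det B \<noteq> 0"
    using d A by (rule tendsto_imp_eventually_ne)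
  then have "\<forall>\<^sub>F B in at A. det (\<chi> i j. if j = k then axis l 1 $ i else B $ i $ j) / det B
      = matrix_inv B $ k $ l"
    by eventually_elim (simp add: matrix_inv_cramer)
  ultimately show "((\<lambda>B. matrix_inv B $ k $ l) \<longlongrightarrow> matrix_inv A $ k $ l) (at A)"
    unfolding matrix_inv_cramer[OF A]
    by (rule Lim_transform_eventually)
qed

lemma open_invertible: "open {A :: complex^'n^'n. invertible A}"
proof -
  have "isCont det (A :: complex^'n^'n)" for A
    unfolding isCont_def by (intro tendsto_det tendsto_vec_nth tendsto_ident_at)
  then have "open (det -` (- {0 :: complex}) :: (complex^'n^'n) set)"
    by (intro continuous_open_vimage) auto
  then show ?thesis by (simp add: vimage_def invertible_det_nz)
qed

text \<open>By the resolvent identity \<open>B^-1 - A^-1 = - A^-1 (B - A) B^-1\<close> the remainder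
  is \<open>- A^-1 (B - A) (B^-1 - A^-1)\<close>. Divided by \<open>norm (B - A)\<close> it is
  bounded by a constant times \<open>norm (B^-1 - A^-1)\<close>, which tends to 0 by continuity of
  inversion.\<close>

lemma has_derivative_matrix_inv:
  fixes A :: "complex^'n^'n"
  assumes A: "invertible A"
  shows "(matrix_inv has_derivative (\<lambda>V. - (matrix_inv A ** V ** matrix_inv A))) (at A)"
proof -
  let ?R = "matrix_inv A"
  obtain K where K: "\<And>(X :: complex^'n^'n) (Y :: complex^'n^'n). norm (X ** Y) \<le> norm X * norm Y * K" "K > 0"
    using bounded_bilinear.pos_bounded[OF bounded_bilinear_matrix_mult] by blast
  have lin: "bounded_linear (\<lambda>V. - (?R ** V ** ?R))"
    by (intro bounded_linear_minus bounded_linear_compose[OF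
          bounded_bilinear.bounded_linear_left[OF bounded_bilinear_matrix_mult]
          bounded_bilinear.bounded_linear_right[OF bounded_bilinear_matrix_mult]])
  have bnd: "norm ((matrix_inv B - ?R - - (?R ** (B - A) ** ?R)) /\<^sub>R norm (B - A))
      \<le> norm ?R * K * K * norm (matrix_inv B - ?R)" if B: "invertible B" "B \<noteq> A" for B
  proof -
    have "matrix_inv B - ?R = - (?R ** (B - A) ** matrix_inv B)"
      using matrix_inv_works[OF A] matrix_inv_works[OF B(1)]
      by (simp add: matrix_sub_ldistrib matrix_sub_rdistrib flip: matrix_mul_assoc)
    then have "matrix_inv B - ?R - - W = W - ?R ** (B - A) ** matrix_inv B" for W
      by (metis diff_minus_eq_add add.commute uminus_add_conv_diff)
    then have "matrix_inv B - ?R - - (?R ** (B - A) ** ?R)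
        = - (?R ** (B - A) ** (matrix_inv B - ?R))"
      by (metis matrix_sub_ldistrib minus_diff_eq)
    then have "norm (matrix_inv B - ?R - - (?R ** (B - A) ** ?R))
        \<le> norm (?R ** (B - A)) * norm (matrix_inv B - ?R) * K"
      by (simp only: norm_minus_cancel) (rule K(1))
    also have "\<dots> \<le> (norm ?R * norm (B - A) * K) * norm (matrix_inv B - ?R) * K"
      by (rule mult_right_mono[OF mult_right_mono[OF K(1) norm_ge_zero] less_imp_le[OF K(2)]])
    also have "\<dots> = norm (B - A) * (norm ?R * K * K * norm (matrix_inv B - ?R))"
      by (simp only: ac_simps)
    finally have "norm (matrix_inv B - ?R - - (?R ** (B - A) ** ?R))
        \<le> norm (B - A) * (norm ?R * K * K * norm (matrix_inv B - ?R))" .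
    moreover have "norm (B - A) > 0" using B(2) by simp
    ultimately show ?thesis
      unfolding norm_scaleR abs_inverse abs_norm_cancel divide_inverse_commute [symmetric]
      by (subst pos_divide_le_eq) (simp_all only: mult.commute)
  qed
  have ev: "\<forall>\<^sub>F B in at A. invertible B"
    using A eventually_at_topological open_invertible by blast
  have "((\<lambda>B. norm ?R * K * K * norm (matrix_inv B - ?R)) \<longlongrightarrow> norm ?R * K * K * norm (?R - ?R)) (at A)"
    using isCont_matrix_inv[of A] A by (intro tendsto_intros) (simp add: invertible_det_nz)
  then have "((\<lambda>B. norm ?R * K * K * norm (matrix_inv B - ?R)) \<longlongrightarrow> 0) (at A)" by simp
  then have "((\<lambda>B. (matrix_inv B - ?R - - (?R ** (B - A) ** ?R)) /\<^sub>R norm (B - A)) \<longlongrightarrow> 0) (at A)"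
    by (rule Lim_null_comparison[rotated])
       (use ev eventually_neq_at_within[of A A UNIV] in eventually_elim, rule bnd)
  then show ?thesis using lin unfolding has_derivative_at_within by simp
qed

text \<open>The derivative is a product built from the inverse itself and a constant, so class k of
  the inverse yields class k + 1.\<close>

lemma smooth_on_matrix_inv: "smooth_on {A :: complex^'n^'n. invertible A} matrix_inv"
  unfolding smooth_on_def
proof
  fix k
  show "Ck_on k {A :: complex^'n^'n. invertible A} matrix_inv"
  proof (induction k)
    case 0
    show ?case unfolding Ck_on.simps
      using has_derivative_continuous[OF has_derivative_matrix_inv]
      by (intro continuous_at_imp_continuous_on) auto
  next
    case (Suc k)
    show ?case
    proof (rule Ck_on_SucI[OF open_invertible])
      show "(matrix_inv has_derivative (\<lambda>V. - (matrix_inv A ** V ** matrix_inv A))) (at A)"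
        if "A \<in> {A. invertible A}" for A :: "complex^'n^'n"
        using that by (simp add: has_derivative_matrix_inv)
      show "Ck_on k {A. invertible A} (\<lambda>A. - (matrix_inv A ** V ** matrix_inv A))" for V :: "complex^'n^'n"
        by (intro Ck_on_bounded_linear[OF open_invertible bounded_linear_minus[OF bounded_linear_ident]]
            Ck_on_bilinear[OF open_invertible bounded_bilinear_matrix_mult] Ck_on_const Suc)
    qed
  qed
qed

lemma smooth_on_orth_projector_of:
  assumes S: "open S" and F: "smooth_on S F" and idem: "\<And>x. x \<in> S \<Longrightarrow> F x ** F x = F x"
  shows "smooth_on S (\<lambda>x. orth_projector_of (F x))"
  unfolding orth_projector_of_def
  by (intro smooth_on_bilinear[OF S bounded_bilinear_matrix_mult] F
      smooth_on_compose[OF S open_invertible _ smooth_on_matrix_inv] smooth_on_diff smooth_on_add S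
      smooth_on_const smooth_on_bounded_linear[OF S bounded_linear_adjoint_matrix])
     (auto simp: idem invertible_idempotent_shift)

section \<open>Curves of isotropic subspaces\<close>

lemma transpose_scaleR: "transpose (c *\<^sub>R A) = c *\<^sub>R transpose (A :: complex^'n^'m)"
  by (simp add: transpose_def vec_eq_iff)

lemma scaleR_matrix_mult: "(c *\<^sub>R A) ** B = c *\<^sub>R (A ** B)"
  and matrix_mult_scaleR: "A ** (c *\<^sub>R B) = c *\<^sub>R (A ** (B :: complex^'p^'n))"
  by (simp_all add: bounded_bilinear.scaleR_left[OF bounded_bilinear_matrix_mult]
      bounded_bilinear.scaleR_right[OF bounded_bilinear_matrix_mult])

lemma half_fixed_point_step:
  fixes y :: "'a::real_vector"
  assumes "v = h + y + y + l + q"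
  shows "y - (1 / 2) *\<^sub>R v = - ((1 / 2) *\<^sub>R (h + l + q))"
proof -
  have "y - (1 / 2) *\<^sub>R v = (1 / 2) *\<^sub>R (y + y - v)"
    by (simp only: scaleR_diff_right scaleR_half_double)
  also have "y + y - v = - (h + l + q)" by (simp add: assms)
  finally show ?thesis by (simp only: scaleR_minus_right)
qed

text \<open>The correction \<open>J ** Y\<close> is a fixed point: for \<open>Y\<close> symmetric with \<open>E\<^sup>T Y E = Y\<close>, the terms of the
  isotropy equation that are linear in \<open>Y\<close> are close to \<open>2 Y\<close>.\<close>

lemma isotropic_correction:
  fixes E G J B H D :: "complex^'n^'n"
  assumes E: "E ** E = E" and G: "transpose G = G"
    and D: "D = transpose B ** G ** J - mat 1"
    and H: "H = transpose E ** transpose B ** G ** B ** E"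
    and lin: "\<And>Y. norm (transpose E ** (D ** Y + Y ** transpose D) ** E) \<le> norm Y / 2"
    and quad: "\<And>Y. norm (transpose E ** Y ** (transpose J ** G ** J) ** Y ** E) \<le> b * norm Y * norm Y"
    and b: "0 \<le> b" "b * norm H \<le> 1 / 2"
  shows "\<exists>Y. norm Y \<le> norm H \<and>
    transpose E ** transpose (B + J ** Y) ** G ** (B + J ** Y) ** E = 0"
proof -
  \<comment> \<open>The defect \<open>V Y\<close> is itself symmetric and fixed by compression with
    \<open>E\<close>, so \<open>\<Phi>\<close> respects the two linear constraints; the radius is
    the bound claimed for the solution.\<close>
  define S where "S = {Y :: complex^'n^'n. transpose Y = Y} \<inter> {Y. transpose E ** Y ** E = Y} \<inter> cball 0 (norm H)"
  define V where "V Y = transpose E ** transpose (B + J ** Y) ** G ** (B + J ** Y) ** E" for Y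
  \<comment> \<open>The factor 1/2 cancels the two copies of \<open>Y\<close> in the expansion of
    \<open>V Y\<close>, leaving only \<open>H\<close> and small terms. A fixed point is a zero of
    the defect, and its mere existence suffices, so Brouwer's theorem replaces a contraction
    argument.\<close>
  define \<Phi> where "\<Phi> Y = Y - (1 / 2) *\<^sub>R V Y" for Y
  have tE: "transpose E ** transpose E = transpose E"
    by (simp add: E flip: matrix_transpose_mul)
  have sandwich: "transpose E ** (transpose E ** X ** E) ** E = transpose E ** X ** E" for X
  proof -
    have "transpose E ** (transpose E ** X ** E) ** E = (transpose E ** transpose E) ** X ** (E ** E)"
      by (simp only: matrix_mul_assoc)
    then show ?thesis by (simp only: tE E)
  qed
  have cont_tr: "continuous_on UNIV (transpose :: complex^'n^'n \<Rightarrow> complex^'n^'n)"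
    using bounded_linear_transpose by (rule linear_continuous_on)
  note [continuous_intros] = bounded_bilinear.continuous_on[OF bounded_bilinear_matrix_mult]
    bounded_linear.continuous_on[OF bounded_linear_transpose]
  have "compact S"
    unfolding S_def
    by (intro closed_Int_compact closed_Int closed_Collect_eq continuous_intros) auto
  moreover have "convex S"
    unfolding S_def
    by (intro convex_Int convex_cball)
       (auto simp: convex_alt transpose_add transpose_scaleR matrix_add_ldistrib matrix_plus_rdistrib
          scaleR_matrix_mult matrix_mult_scaleR)
  moreover have "0 \<in> S"
    by (simp add: S_def)
  then have "S \<noteq> {}" by auto
  moreover have "continuous_on S \<Phi>"
    unfolding \<Phi>_def V_def by (intro continuous_intros)
  moreover have "\<Phi> \<in> S \<rightarrow> S"
  proof
    fix Y assume "Y \<in> S"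
    then have sym: "transpose Y = Y" and EYE: "transpose E ** Y ** E = Y" and nY: "norm Y \<le> norm H"
      by (auto simp: S_def)
    have "transpose E ** Y = transpose E ** (transpose E ** Y ** E)" by (simp only: EYE)
    also have "\<dots> = Y" by (simp only: matrix_mul_assoc tE) (simp only: EYE)
    finally have EY: "transpose E ** Y = Y" .
    have "Y ** E = (transpose E ** Y ** E) ** E" by (simp only: EYE)
    also have "\<dots> = Y" by (simp only: matrix_mul_assoc [symmetric] E) (simp only: matrix_mul_assoc EYE)
    finally have YE: "Y ** E = Y" .
    have BGJ: "transpose B ** G ** J = mat 1 + D" by (simp add: D)
    have "transpose J ** G ** B = transpose (mat 1 + D)"
      by (simp add: BGJ [symmetric] matrix_transpose_mul G matrix_mul_assoc)
    then have JGB: "transpose J ** G ** B = mat 1 + transpose D" by (simp add: transpose_add)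
    have "transpose (B + J ** Y) ** G ** (B + J ** Y) = transpose B ** G ** B + (transpose B ** G ** J) ** Y
        + Y ** (transpose J ** G ** B) + Y ** (transpose J ** G ** J) ** Y"
      by (simp only: transpose_add matrix_transpose_mul sym matrix_ring_simps ac_simps)
    also have "\<dots> = transpose B ** G ** B + Y + Y + (D ** Y + Y ** transpose D) + Y ** (transpose J ** G ** J) ** Y"
      unfolding BGJ JGB by (simp only: matrix_plus_rdistrib matrix_add_ldistrib matrix_mul_lid matrix_mul_rid ac_simps)
    finally have "V Y = transpose E ** (transpose B ** G ** B + Y + Y + (D ** Y + Y ** transpose D)
        + Y ** (transpose J ** G ** J) ** Y) ** E"
      unfolding V_def by (metis matrix_mul_assoc)
    also have "\<dots> = H + Y + Y + transpose E ** (D ** Y + Y ** transpose D) ** E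
        + transpose E ** Y ** (transpose J ** G ** J) ** Y ** E"
      by (simp only: matrix_add_ldistrib [of "transpose E"] matrix_plus_rdistrib[of _ _ E] EYE H matrix_mul_assoc)
    finally have "\<Phi> Y = - ((1 / 2) *\<^sub>R (H + transpose E ** (D ** Y + Y ** transpose D) ** E
        + transpose E ** Y ** (transpose J ** G ** J) ** Y ** E))"
      unfolding \<Phi>_def by (rule half_fixed_point_step)
    then have "norm (\<Phi> Y) = (1 / 2) * norm (H + transpose E ** (D ** Y + Y ** transpose D) ** E
        + transpose E ** Y ** (transpose J ** G ** J) ** Y ** E)"
      by simp
    \<comment> \<open>As \<open>norm Y \<le> norm H\<close>, the linear term costs at most half of
      \<open>norm H\<close> by \<open>lin\<close>, and the quadratic term another half because
      \<open>b * norm H \<le> 1 / 2\<close>. The bracket is thus at most twice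
      \<open>norm H\<close>.\<close>
    also have "\<dots> \<le> (1 / 2) * (norm H + norm Y / 2 + b * norm Y * norm Y)"
      using lin[of Y] quad[of Y] by (smt (verit, best) mult_left_mono norm_triangle_ineq divide_nonneg_nonneg)
    also have "\<dots> \<le> norm H"
    proof -
      have "b * norm Y * norm Y \<le> b * norm H * norm H"
        by (intro mult_mono mult_left_mono mult_nonneg_nonneg b nY norm_ge_zero)
      also have "\<dots> \<le> norm H / 2" using mult_right_mono[OF b(2) norm_ge_zero[of H]] by simp
      finally show ?thesis using nY by simp
    qed
    finally have "norm (\<Phi> Y) \<le> norm H" .
    moreover have "transpose (V Y) = V Y"
      by (simp add: V_def matrix_transpose_mul G matrix_mul_assoc)
    then have "transpose (\<Phi> Y) = \<Phi> Y"
      by (simp add: \<Phi>_def transpose_diff transpose_scaleR sym)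
    moreover have "transpose E ** V Y ** E = V Y"
      using sandwich[of "transpose (B + J ** Y) ** G ** (B + J ** Y)"] by (simp only: V_def matrix_mul_assoc)
    then have "transpose E ** \<Phi> Y ** E = \<Phi> Y"
      by (simp add: \<Phi>_def matrix_sub_ldistrib matrix_sub_rdistrib matrix_mult_scaleR scaleR_matrix_mult EYE EY YE)
    ultimately show "\<Phi> Y \<in> S" by (simp add: S_def)
  qed
  ultimately obtain Y where Y: "Y \<in> S" "\<Phi> Y = Y" by (rule brouwer)
  then have "V Y = 0" by (simp add: \<Phi>_def)
  then show ?thesis using Y(1) by (auto simp: S_def V_def)
qed

lemma has_vector_derivative_dominated:
  fixes H :: "real \<Rightarrow> 'a::real_normed_vector" and Y :: "real \<Rightarrow> 'b::real_normed_vector"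
  assumes H: "(H has_vector_derivative 0) (at 0)" "H 0 = 0" and Y: "Y 0 = 0"
    and le: "\<forall>\<^sub>F t in at 0. norm (Y t) \<le> norm (H t)"
  shows "(Y has_vector_derivative 0) (at 0)"
proof -
  have "((\<lambda>t. norm (H t) / norm t) \<longlongrightarrow> 0) (at 0)"
    using H by (simp add: has_vector_derivative_def has_derivative_iff_norm)
  moreover have "\<forall>\<^sub>F t in at 0. norm (norm (Y t) / norm t) \<le> norm (H t) / norm t"
    using le by eventually_elim (simp add: divide_right_mono)
  ultimately have "((\<lambda>t. norm (Y t) / norm t) \<longlongrightarrow> 0) (at 0)"
    by (rule Lim_null_comparison[rotated])
  then show ?thesis
    by (simp add: has_vector_derivative_def has_derivative_iff_norm Y)
qed

lemma has_vector_derivative_tendsto: "(f has_vector_derivative D) (at x) \<Longrightarrow> (f \<longlongrightarrow> f x) (at x)"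
  using has_vector_derivative_continuous continuous_at isCont_def by blast

text \<open>The straight path \<open>1 + t K\<close> keeps the range of \<open>E\<close> isotropic
  up to a defect \<open>H\<close> with \<open>H 0 = 0\<close>, and the linearised equation says that
  the derivative of \<open>H\<close> at 0 vanishes too. A correction dominated by \<open>H\<close>
  has zero derivative, so the corrected path still has velocity \<open>K\<close>.\<close>

lemma isotropic_curve:
  fixes G :: "real \<Rightarrow> complex^'n^'n" and E K G' :: "complex^'n^'n"
  assumes G': "(G has_vector_derivative G') (at 0)"
    and sym: "\<forall>\<^sub>F t in at 0. transpose (G t) = G t"
    and inv: "invertible (G 0)" and E: "E ** E = E"
    and iso: "transpose E ** G 0 ** E = 0"
    and tangent: "transpose E ** (G' + transpose K ** G 0 + G 0 ** K) ** E = 0"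
  shows "\<exists>A. A 0 = mat 1 \<and> (A has_vector_derivative K) (at 0) \<and>
    (\<forall>\<^sub>F t in at 0. transpose E ** transpose (A t) ** G t ** A t ** E = 0)"
proof -
  \<comment> \<open>With the inverse of the form, the displacement \<open>J ** Y\<close> changes the
    isotropy equation to first order by \<open>2 Y\<close> for symmetric \<open>Y\<close>, up to the
    error measured by \<open>D t\<close>.\<close>
  define J where "J = matrix_inv (G 0)"
  define B where "B t = mat 1 + t *\<^sub>R K" for t :: real
  define D where "D t = transpose (B t) ** G t ** J - mat 1" for t
  define H where "H t = transpose E ** transpose (B t) ** G t ** B t ** E" for t
  define M where "M t = transpose J ** G t ** J" for t
  note hvd_mult = bounded_bilinear.has_vector_derivative[OF bounded_bilinear_matrix_mult]
  note hvd_transpose = bounded_linear.has_vector_derivative[OF bounded_linear_transpose]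
  note lim_mult = bounded_bilinear.tendsto[OF bounded_bilinear_matrix_mult]
  note lim_transpose = bounded_linear.tendsto[OF bounded_linear_transpose]
  have B0: "B 0 = mat 1" by (simp add: B_def)
  have B': "(B has_vector_derivative K) (at 0)"
    unfolding B_def by (auto intro!: derivative_eq_intros)
  have H0: "H 0 = 0" by (simp add: H_def B0 iso)
  have "(H has_vector_derivative
      (transpose E ** transpose (B 0) ** G 0 ** B 0 ** 0 +
        (transpose E ** transpose (B 0) ** G 0 ** K +
          (transpose E ** transpose (B 0) ** G' + (transpose E ** transpose K + 0 ** transpose (B 0)) ** G 0)
            ** B 0) ** E)) (at 0)"
    unfolding H_def by (intro hvd_mult hvd_transpose has_vector_derivative_const B' G')
  also have "transpose E ** transpose (B 0) ** G 0 ** B 0 ** 0 +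
        (transpose E ** transpose (B 0) ** G 0 ** K +
          (transpose E ** transpose (B 0) ** G' + (transpose E ** transpose K + 0 ** transpose (B 0)) ** G 0)
            ** B 0) ** E = transpose E ** (G' + transpose K ** G 0 + G 0 ** K) ** E"
    by (simp add: B0 matrix_ring_simps)
  finally have H': "(H has_vector_derivative 0) (at 0)" using tangent by simp
  have limB: "(B \<longlongrightarrow> mat 1) (at 0)" and limG: "(G \<longlongrightarrow> G 0) (at 0)" and limH: "(H \<longlongrightarrow> 0) (at 0)"
    using has_vector_derivative_tendsto[OF B'] has_vector_derivative_tendsto[OF G']
      has_vector_derivative_tendsto[OF H'] by (simp_all add: B0 H0)
  have "(D \<longlongrightarrow> transpose (mat 1) ** G 0 ** J - mat 1) (at 0)"
    unfolding D_def by (intro tendsto_intros lim_mult lim_transpose limB limG)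
  then have limD: "(D \<longlongrightarrow> 0) (at 0)" by (simp add: J_def matrix_inv_works[OF inv])
  have limM: "(M \<longlongrightarrow> transpose J ** G 0 ** J) (at 0)"
    unfolding M_def by (intro tendsto_intros lim_mult limG)
  obtain \<kappa> where \<kappa>: "\<And>(X :: complex^'n^'n) (Y :: complex^'n^'n). norm (X ** Y) \<le> norm X * norm Y * \<kappa>"
      "\<kappa> > 0"
    using bounded_bilinear.pos_bounded[OF bounded_bilinear_matrix_mult] by blast
  have "bounded_bilinear (\<lambda>(D :: complex^'n^'n) Y. transpose E ** (D ** Y + Y ** transpose D) ** E)"
    unfolding bilinear_conv_bounded_bilinear[symmetric] bilinear_def linear_iff
    by (simp add: matrix_ring_simps transpose_add transpose_scaleR matrix_mult_scaleR scaleR_matrix_mult scaleR_add_right)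
  from bounded_bilinear.bounded[OF this]
  obtain e where e: "\<And>D Y. norm (transpose E ** (D ** Y + Y ** transpose D) ** E) \<le> norm D * norm Y * e"
    by blast
  have "bounded_bilinear (\<lambda>(X :: complex^'n^'n) (Y :: complex^'n^'n). transpose E ** (X ** Y) ** E)"
    unfolding bilinear_conv_bounded_bilinear[symmetric] bilinear_def linear_iff
    by (simp add: matrix_ring_simps matrix_mult_scaleR scaleR_matrix_mult)
  from bounded_bilinear.nonneg_bounded[OF this]
  obtain e' where e': "\<And>(X :: complex^'n^'n) (Y :: complex^'n^'n). norm (transpose E ** (X ** Y) ** E) \<le> norm X * norm Y * e'" "0 \<le> e'"
    by blast
  have lin: "norm (transpose E ** (D t ** Y + Y ** transpose (D t)) ** E) \<le> (e * norm (D t)) * norm Y" for t Y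
    using e[of "D t" Y] by (simp add: mult_ac)
  have quad: "norm (transpose E ** Y ** M t ** Y ** E) \<le> (e' * \<kappa> * norm (M t)) * norm Y * norm Y" for t Y
  proof -
    have "norm (transpose E ** ((Y ** M t) ** Y) ** E) \<le> (norm Y * norm (M t) * \<kappa>) * norm Y * e'"
      using e'(2) by (intro order_trans[OF e'(1)] mult_right_mono \<kappa>(1)) auto
    then show ?thesis by (simp add: matrix_mul_assoc mult_ac)
  qed
  have "((\<lambda>t. e * norm (D t)) \<longlongrightarrow> e * norm (0 :: complex^'n^'n)) (at 0)"
    by (intro tendsto_intros limD)
  then have ev1: "\<forall>\<^sub>F t in at 0. e * norm (D t) < 1 / 2"
    by (rule order_tendstoD(2)) simp
  have "((\<lambda>t. e' * \<kappa> * norm (M t) * norm (H t)) \<longlongrightarrow>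
      e' * \<kappa> * norm (transpose J ** G 0 ** J) * norm (0 :: complex^'n^'n)) (at 0)"
    by (intro tendsto_intros limM limH)
  then have ev2: "\<forall>\<^sub>F t in at 0. e' * \<kappa> * norm (M t) * norm (H t) < 1 / 2"
    by (rule order_tendstoD(2)) simp
  let ?ok = "\<lambda>t Y. norm Y \<le> norm (H t) \<and>
      transpose E ** transpose (B t + J ** Y) ** G t ** (B t + J ** Y) ** E = 0"
  have ex: "\<forall>\<^sub>F t in at 0. \<exists>Y. ?ok t Y"
    using ev1 ev2 sym
  proof eventually_elim
    case (elim t)
    show ?case
    proof (rule isotropic_correction[OF E elim(3) D_def H_def])
      fix Y :: "complex^'n^'n"
      have "e * norm (D t) * norm Y \<le> 1 / 2 * norm Y"
        using elim(1) by (intro mult_right_mono) auto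
      then show "norm (transpose E ** (D t ** Y + Y ** transpose (D t)) ** E) \<le> norm Y / 2"
        using lin[of t Y] by simp
      show "norm (transpose E ** Y ** (transpose J ** G t ** J) ** Y ** E)
          \<le> (e' * \<kappa> * norm (M t)) * norm Y * norm Y"
        using quad[of Y t] by (simp add: M_def)
      show "0 \<le> e' * \<kappa> * norm (M t)" using e'(2) \<kappa>(2) by simp
      show "e' * \<kappa> * norm (M t) * norm (H t) \<le> 1 / 2" using elim(2) by simp
    qed
  qed
  \<comment> \<open>The filter at 0 disregards time 0 itself, where the value 0 is imposed so that
    the curve starts at the identity.\<close>
  define Y where "Y t = (if t = 0 then 0 else SOME Y. ?ok t Y)" for t
  have ok: "\<forall>\<^sub>F t in at 0. ?ok t (Y t)"
    using ex eventually_neq_at_within[of 0 0 UNIV]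
  proof eventually_elim
    case (elim t)
    have "?ok t (SOME Y. ?ok t Y)" by (rule someI_ex[OF elim(1)])
    then show ?case using elim(2) by (simp add: Y_def)
  qed
  have "(Y has_vector_derivative 0) (at 0)"
    by (rule has_vector_derivative_dominated[OF H' H0]) (use ok in \<open>auto simp: Y_def elim!: eventually_mono\<close>)
  from hvd_mult[OF has_vector_derivative_const[of J] this]
  have "((\<lambda>t. B t + J ** Y t) has_vector_derivative K) (at 0)"
    using has_vector_derivative_add[OF B'] by fastforce
  moreover have "B 0 + J ** Y 0 = mat 1" by (simp add: B0 Y_def)
  moreover have "\<forall>\<^sub>F t in at 0. transpose E ** transpose (B t + J ** Y t) ** G t ** (B t + J ** Y t) ** E = 0"
    using ok by (rule eventually_mono) simp
  ultimately show ?thesis by (intro exI[of _ "\<lambda>t. B t + J ** Y t"]) simp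
qed

text \<open>For invertible \<open>A t\<close> the image of \<open>P\<close> is the range of the
  idempotent \<open>A E A^-1\<close>, whose derivative at 0 is the commutator
  \<open>K E - E K\<close>. It remains to differentiate the formula for
  \<open>orth_projector_of\<close>; its shift at time 0 is the reflection \<open>2 E - 1\<close>,
  which is its own inverse.\<close>

lemma has_vector_derivative_projector_image:
  fixes A :: "real \<Rightarrow> complex^'n^'n"
  assumes P: "vec.subspace P" and A0: "A 0 = mat 1" and A': "(A has_vector_derivative K) (at 0)"
  defines "E \<equiv> projector P"
  shows "((\<lambda>t. projector ((*v) (A t) ` P)) has_vector_derivative
    ((mat 1 - E) ** K ** E + adjoint_matrix ((mat 1 - E) ** K ** E))) (at 0)"
proof -
  note E = projector[OF P, folded E_def]
  define F where "F t = A t ** E ** matrix_inv (A t)" for t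
  define S where "S t = F t + adjoint_matrix (F t) - mat 1" for t
  note hvd_mult = bounded_bilinear.has_vector_derivative[OF bounded_bilinear_matrix_mult]
  note hvd_adjoint = bounded_linear.has_vector_derivative[OF bounded_linear_adjoint_matrix]
  have hvd_inv: "((\<lambda>t. matrix_inv (X t)) has_vector_derivative - (matrix_inv (X 0) ** X' ** matrix_inv (X 0))) (at 0)"
    if X: "(X has_vector_derivative X') (at 0)" "invertible (X 0)" for X :: "real \<Rightarrow> complex^'n^'n" and X'
    using vector_derivative_diff_chain_within[OF X(1) has_derivative_at_withinI[OF has_derivative_matrix_inv[OF X(2)]]]
    by (simp add: o_def)
  have inv1: "matrix_inv (mat 1) = (mat 1 :: complex^'n^'n)" by (rule matrix_inv_eqI) simp
  have invA0: "invertible (A 0)" unfolding A0 invertible_right_inverse by (rule exI[of _ "mat 1"]) simp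
  have F0: "F 0 = E" by (simp add: F_def A0 inv1)
  have S0: "S 0 = E + E - mat 1" by (simp add: S_def F0 E)
  have idem: "F t ** F t = F t" if "invertible (A t)" for t
  proof -
    have "F t ** F t = A t ** E ** (matrix_inv (A t) ** A t) ** E ** matrix_inv (A t)"
      by (simp only: F_def matrix_mul_assoc)
    also have "\<dots> = A t ** (E ** E) ** matrix_inv (A t)"
      by (simp only: matrix_inv_works[OF that] matrix_mul_rid matrix_mul_assoc)
    finally show ?thesis by (simp only: E F_def)
  qed
  have rangeF: "range ((*v) (F t)) = (*v) (A t) ` P" if t: "invertible (A t)" for t
  proof -
    have "range ((*v) (F t)) = (*v) (A t) ` (*v) E ` range ((*v) (matrix_inv (A t)))"
      by (simp add: F_def image_image flip: matrix_vector_mul_assoc)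
    also have "range ((*v) (matrix_inv (A t))) = UNIV"
      using matrix_inv_works(2)[OF t] by (metis matrix_vector_mul_assoc matrix_vector_mul_lid surjI)
    finally show ?thesis using E(3) by simp
  qed
  \<comment> \<open>The full neighbourhood filter is used because transferring a derivative also
    requires equality of the two curves at time 0.\<close>
  have "\<forall>\<^sub>F t in nhds 0. invertible (A t)"
  proof -
    have "(A \<longlongrightarrow> A 0) (nhds 0)"
      using has_vector_derivative_tendsto[OF A'] by (simp add: tendsto_at_iff_tendsto_nhds)
    then show ?thesis
      using topological_tendstoD[OF _ open_invertible] invA0 by fastforce
  qed
  then have ev: "\<forall>\<^sub>F t in nhds 0. orth_projector_of (F t) = projector ((*v) (A t) ` P)"
    by (rule eventually_mono) (simp add: projector_range idem flip: rangeF)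
  let ?F' = "K ** E - E ** K"
  have "(F has_vector_derivative (A 0 ** E ** - (matrix_inv (A 0) ** K ** matrix_inv (A 0))
      + (A 0 ** 0 + K ** E) ** matrix_inv (A 0))) (at 0)"
    unfolding F_def by (intro hvd_mult hvd_inv A' invA0 has_vector_derivative_const)
  then have F': "(F has_vector_derivative ?F') (at 0)"
    by (simp add: A0 inv1 add.commute)
  have S': "(S has_vector_derivative ?F' + adjoint_matrix ?F') (at 0)"
    unfolding S_def using has_vector_derivative_diff_const
    by (intro has_vector_derivative_diff[where g' = 0, simplified] has_vector_derivative_add hvd_adjoint F'
        has_vector_derivative_const)
  have SS: "S 0 ** S 0 = mat 1"
    by (simp only: S0 matrix_ring_simps E(1) matrix_mul_lid matrix_mul_rid) simp
  have invS: "invertible (S 0)" unfolding invertible_right_inverse using SS by (rule exI)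
  have "((\<lambda>t. orth_projector_of (F t)) has_vector_derivative
     (F 0 ** - (matrix_inv (S 0) ** (?F' + adjoint_matrix ?F') ** matrix_inv (S 0)) + ?F' ** matrix_inv (S 0))) (at 0)"
    unfolding orth_projector_of_def S_def [symmetric]
    by (intro hvd_mult hvd_inv F' S' invS)
  also have "F 0 ** - (matrix_inv (S 0) ** (?F' + adjoint_matrix ?F') ** matrix_inv (S 0)) + ?F' ** matrix_inv (S 0)
      = (mat 1 - E) ** K ** E + adjoint_matrix ((mat 1 - E) ** K ** E)"
  proof -
    have EEX: "X ** E ** E = X ** E" for X by (simp add: E(1) flip: matrix_mul_assoc)
    have "matrix_inv (S 0) = E + E - mat 1" using matrix_inv_eqI[OF SS] by (simp only: S0)
    then show ?thesis
      by (simp only: F0 adjoint_matrix_diff adjoint_matrix_mult adjoint_matrix_add E(1,2)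
          matrix_ring_simps EEX matrix_neg_right matrix_mul_lid matrix_mul_rid adjoint_matrix_one)
         (simp add: algebra_simps)
  qed
  finally have "((\<lambda>t. orth_projector_of (F t)) has_vector_derivative
      (mat 1 - E) ** K ** E + adjoint_matrix ((mat 1 - E) ** K ** E)) (at 0)" .
  then show ?thesis
    unfolding has_vector_derivative_def
    by (rule has_derivative_transform_eventually)
       (use ev eventually_nhds_x_imp_x[OF ev] in \<open>auto simp: eventually_at_filter elim!: eventually_mono\<close>)
qed

section \<open>Complexification and charts\<close>

lemma vec_Complex_simps [simp]:
  "vec_Re (vec_Complex u v) = u" "vec_Im (vec_Complex u v) = v" "vec_Complex (vec_Re Z) (vec_Im Z) = Z"
  "vec_Complex 0 0 = 0"
  by (simp_all add: vec_Re_def vec_Im_def vec_Complex_def vec_eq_iff Complex_eq_0)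

lemma vec_Complex_eq_iff: "Z = W \<longleftrightarrow> vec_Re Z = vec_Re W \<and> vec_Im Z = vec_Im W"
  by (auto simp: vec_Re_def vec_Im_def vec_eq_iff complex_eq_iff)

lemma vec_Re_Im_simps [simp]:
  "vec_Re 0 = 0" "vec_Im 0 = 0"
  "vec_Re (Z + W) = vec_Re Z + vec_Re W" "vec_Im (Z + W) = vec_Im Z + vec_Im W"
  "vec_Re (Z - W) = vec_Re Z - vec_Re W" "vec_Im (Z - W) = vec_Im Z - vec_Im W"
  "vec_Re (- Z) = - vec_Re Z" "vec_Im (- Z) = - vec_Im Z"
  "vec_Re (vec_cnj Z) = vec_Re Z" "vec_Im (vec_cnj Z) = - vec_Im Z"
  "vec_Re (\<i> *s Z) = - vec_Im Z" "vec_Im (\<i> *s Z) = vec_Re Z"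
  "vec_Re (c *\<^sub>R Z) = c *\<^sub>R vec_Re Z" "vec_Im (c *\<^sub>R Z) = c *\<^sub>R vec_Im Z"
  by (simp_all add: vec_Re_def vec_Im_def vec_cnj_def vec_eq_iff)

definition cmat :: "(real^'m \<Rightarrow> real^'n) \<Rightarrow> complex^'m^'n" where
  "cmat L = (\<chi> a b. complex_of_real (L (axis b 1) $ a))"

lemma linear_component_sum:
  fixes L :: "real^'m \<Rightarrow> real^'n"
  assumes "linear L"
  shows "L x $ a = (\<Sum>b\<in>UNIV. L (axis b 1) $ a * x $ b)"
proof -
  have "L x = matrix L *v x" using assms by (simp add: matrix_works linear_matrix_vector_mul_eq)
  then show ?thesis by (simp add: matrix_vector_mult_def matrix_def)
qed

lemma clinear_ext_cmat:
  assumes "linear L"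
  shows "clinear_ext L Z = cmat L *v Z"
  by (simp add: clinear_ext_def vec_eq_iff vec_Complex_def matrix_vector_mult_def cmat_def complex_eq_iff
      linear_component_sum[OF assms, of "vec_Re Z"] linear_component_sum[OF assms, of "vec_Im Z"])
     (simp add: vec_Re_def vec_Im_def)

lemma clinear_ext_simps [simp]:
  "vec_Re (clinear_ext L Z) = L (vec_Re Z)" "vec_Im (clinear_ext L Z) = L (vec_Im Z)"
  by (simp_all add: clinear_ext_def)

lemma clinear_ext_compose: "clinear_ext (L \<circ> K) Z = clinear_ext L (clinear_ext K Z)"
  by (simp add: clinear_ext_def)

lemma clinear_ext_id [simp]: "clinear_ext id Z = Z"
  by (simp add: clinear_ext_def)

lemma inj_clinear_ext: "inj L \<Longrightarrow> inj (clinear_ext L)"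
  by (rule injI) (auto simp: vec_Complex_eq_iff[of "clinear_ext _ _"] vec_Complex_eq_iff dest: injD)

definition gmat :: "(real^'n \<Rightarrow> real^'n \<Rightarrow> real) \<Rightarrow> complex^'n^'n" where
  "gmat g = (\<chi> a b. complex_of_real (g (axis a 1) (axis b 1)))"

text \<open>Complex bilinear, without conjugation: it expresses isotropy rather than Hermitian
  orthogonality, and therefore transforms by \<open>transpose\<close> and not by
  \<open>adjoint_matrix\<close>.\<close>

definition mform :: "complex^'n^'m \<Rightarrow> complex^'m \<Rightarrow> complex^'n \<Rightarrow> complex" where
  "mform M Z W = (\<Sum>a\<in>UNIV. Z $ a * (M *v W) $ a)"

lemma bilinear_component_sum:
  fixes g :: "real^'n \<Rightarrow> real^'n \<Rightarrow> real"
  assumes "bilinear g"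
  shows "g x y = (\<Sum>a\<in>UNIV. \<Sum>b\<in>UNIV. x $ a * g (axis a 1) (axis b 1) * y $ b)"
proof -
  have "g x y = g (\<Sum>a\<in>UNIV. x $ a *\<^sub>R axis a 1) (\<Sum>b\<in>UNIV. y $ b *\<^sub>R axis b 1)"
    using basis_expansion[of x] basis_expansion[of y] by (simp add: scalar_mult_eq_scaleR)
  also have "\<dots> = (\<Sum>a\<in>UNIV. \<Sum>b\<in>UNIV. x $ a * g (axis a 1) (axis b 1) * y $ b)"
    by (simp add: bilinear_sum[OF assms] bilinear_lmul[OF assms] bilinear_rmul[OF assms] sum.cartesian_product
        mult_ac)
  finally show ?thesis .
qed

lemma cbilinear_form_ext_gmat:
  assumes "bilinear g"
  shows "cbilinear_form_ext g Z W = mform (gmat g) Z W"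
  unfolding cbilinear_form_ext_def complex_eq_iff mform_def
    bilinear_component_sum[OF assms, of "vec_Re Z"] bilinear_component_sum[OF assms, of "vec_Im Z"]
  by (simp add: matrix_vector_mult_def gmat_def sum_distrib_left vec_Re_def vec_Im_def algebra_simps
      sum_subtractf sum.distrib)

lemma mform_mult:
  fixes M :: "complex^'n^'m"
  shows "mform M (A *v Z) (B *v W) = mform (transpose A ** M ** B) Z W"
proof -
  have "mform M (A *v Z) W' = mform (transpose A ** M) Z W'" for W'
  proof -
    have "mform M (A *v Z) W' = (\<Sum>a\<in>UNIV. \<Sum>b\<in>UNIV. A $ a $ b * Z $ b * (M *v W') $ a)"
      by (simp add: mform_def matrix_vector_mult_def[of A] sum_distrib_right)
    also have "\<dots> = (\<Sum>b\<in>UNIV. \<Sum>a\<in>UNIV. A $ a $ b * Z $ b * (M *v W') $ a)"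
      by (rule sum.swap)
    also have "\<dots> = mform (transpose A ** M) Z W'"
    proof -
      have "(transpose A *v u) $ b = (\<Sum>a\<in>UNIV. A $ a $ b * u $ a)" for u b
        by (simp add: matrix_vector_mult_def transpose_def del: transpose_matrix_vector)
      then show ?thesis
        unfolding mform_def matrix_vector_mul_assoc[symmetric] by (simp only: sum_distrib_left mult_ac)
    qed
    finally show ?thesis .
  qed
  from this[of "B *v W"] show ?thesis by (simp add: mform_def matrix_vector_mul_assoc)
qed

lemma mform_axis: "mform M (axis a 1) (axis b 1) = M $ a $ b"
  by (simp add: mform_def matrix_vector_mult_def axis_def if_distrib if_distribR cong: if_cong)

lemma mform_zero_iff: "(\<forall>Z W. mform M Z W = 0) \<longleftrightarrow> M = 0"
proof
  assume "\<forall>Z W. mform M Z W = 0"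
  then show "M = 0" by (simp add: vec_eq_iff flip: mform_axis)
qed (simp add: mform_def)

text \<open>Isotropy becomes a polynomial equation in a matrix whose range is the subspace, and this
  equation can be differentiated along curves.\<close>

lemma isotropic_range_iff:
  "(\<forall>Z\<in>range ((*v) E). \<forall>W\<in>range ((*v) E). mform M Z W = 0) \<longleftrightarrow> transpose E ** M ** E = 0"
  by (simp add: mform_mult flip: mform_zero_iff)

section \<open>Charts, coordinate changes and the chain rule\<close>

lemma manifold_chart:
  assumes A: "smooth_manifold A" and i: "i \<in> idx A"
  shows inj_on_coord: "inj_on (coord A i) (patch A i)"
    and open_coord: "open (coord A i ` patch A i)"
proof -
  obtain T where T: "topspace T = points A" "\<And>i. i \<in> idx A \<Longrightarrow> openin T (patch A i) \<and> open (coord A i ` patch A i) \<and>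
           homeomorphic_map (subtopology T (patch A i)) (top_of_set (coord A i ` patch A i)) (coord A i)"
    using A unfolding smooth_manifold_def by blast
  have "patch A i \<subseteq> topspace T" using i T(1) by (auto simp: points_def)
  then have "topspace (subtopology T (patch A i)) = patch A i" by auto
  moreover have "homeomorphic_map (subtopology T (patch A i)) (top_of_set (coord A i ` patch A i)) (coord A i)"
    using T(2)[OF i] by blast
  then have "inj_on (coord A i) (topspace (subtopology T (patch A i)))"
    by (rule homeomorphic_imp_injective_map)
  ultimately show "inj_on (coord A i) (patch A i)" by (simp only:)
  show "open (coord A i ` patch A i)" using T(2)[OF i] by blast
qed

lemma charts_atD: "i \<in> charts_at A x \<Longrightarrow> i \<in> idx A" "i \<in> charts_at A x \<Longrightarrow> x \<in> patch A i"
  "i \<in> charts_at A x \<Longrightarrow> x \<in> points A"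
  by (auto simp: charts_at_def points_def)

lemma points_charts_at: "x \<in> points A \<Longrightarrow> charts_at A x \<noteq> {}"
  by (auto simp: charts_at_def points_def)

lemma inv_coord [simp]:
  assumes "smooth_manifold A" "i \<in> charts_at A x"
  shows "inv_into (patch A i) (coord A i) (coord A i x) = x"
  using assms by (intro inv_into_f_f inj_on_coord) (auto simp: charts_at_def)

lemma coord_inv:
  assumes "y \<in> coord A i ` patch A i"
  shows "coord A i (inv_into (patch A i) (coord A i) y) = y" "inv_into (patch A i) (coord A i) y \<in> patch A i"
  using assms by (auto intro: f_inv_into_f inv_into_into)

abbreviation inv_chart :: "('i, 'a, 'e) charted \<Rightarrow> 'i \<Rightarrow> 'e \<Rightarrow> 'a" where
  "inv_chart A i \<equiv> inv_into (patch A i) (coord A i)"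

definition rep_domain ::
  "('i, 'a, 'e) charted \<Rightarrow> ('j, 'b, 'f) charted \<Rightarrow> ('a \<Rightarrow> 'b) \<Rightarrow> 'i \<Rightarrow> 'j \<Rightarrow> 'e set" where
  "rep_domain A B F i j = coord A i ` {x \<in> patch A i. F x \<in> patch B j}"

lemma rep_domain:
  assumes F: "smooth_map A B F" and i: "i \<in> charts_at A x" and j: "j \<in> charts_at B (F x)"
  shows "open (rep_domain A B F i j)" "coord A i x \<in> rep_domain A B F i j"
    "rep_domain A B F i j \<subseteq> coord A i ` patch A i" "smooth_on (rep_domain A B F i j) (local_rep A B F i j)"
  using assms unfolding rep_domain_def smooth_map_def charts_at_def by blast+

lemma rep_domain_inv_chart:
  assumes A: "smooth_manifold A" and i: "i \<in> idx A" and j: "j \<in> idx B" and y: "y \<in> rep_domain A B F i j"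
  shows "i \<in> charts_at A (inv_chart A i y)" "j \<in> charts_at B (F (inv_chart A i y))"
    "coord A i (inv_chart A i y) = y"
proof -
  obtain x where x: "y = coord A i x" "x \<in> patch A i" "F x \<in> patch B j" using y by (auto simp: rep_domain_def)
  then have "i \<in> charts_at A x" using i by (simp add: charts_at_def)
  then show "i \<in> charts_at A (inv_chart A i y)" "j \<in> charts_at B (F (inv_chart A i y))"
    "coord A i (inv_chart A i y) = y"
    using x j by (simp_all add: inv_coord[OF A] charts_at_def)
qed

lemma jac_has_derivative:
  assumes "smooth_map A B F" "i \<in> charts_at A x" "j \<in> charts_at B (F x)"
  shows "(local_rep A B F i j has_derivative jac A B F i j x) (at (coord A i x))"
  using smooth_on_differentiable[OF rep_domain(4)[OF assms] rep_domain(2)[OF assms]]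
  by (simp add: jac_def frechet_derivative_works)

lemma jac_compose:
  assumes A: "smooth_manifold A" and B: "smooth_manifold B"
    and AB: "smooth_map A B id" and BC: "smooth_map B C F"
    and i: "i \<in> charts_at A x" and j: "j \<in> charts_at B x" and l: "l \<in> charts_at C (F x)"
  shows "jac A C F i l x = jac B C F j l x \<circ> jac A B id i j x"
proof -
  have j': "j \<in> charts_at B (id x)" using j by simp
  note W = rep_domain[OF AB i j']
  have eq: "local_rep B C F j l (local_rep A B id i j y) = local_rep A C F i l y" if "y \<in> rep_domain A B id i j" for y
    unfolding local_rep_def id_apply
    using inv_coord[OF B rep_domain_inv_chart(2)[OF A charts_atD(1)[OF i] charts_atD(1)[OF j] that]] by simp
  have at: "local_rep A B id i j (coord A i x) = coord B j x"
    using inv_coord[OF A i] by (simp add: local_rep_def)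
  have d: "(local_rep B C F j l has_derivative jac B C F j l x) (at (local_rep A B id i j (coord A i x)))"
    unfolding at by (rule jac_has_derivative[OF BC j l])
  have "((\<lambda>y. local_rep B C F j l (local_rep A B id i j y)) has_derivative
      (\<lambda>v. jac B C F j l x (jac A B id i j x v))) (at (coord A i x))"
    by (rule has_derivative_compose[OF jac_has_derivative[OF AB i j'] d])
  then have "(local_rep A C F i l has_derivative (\<lambda>v. jac B C F j l x (jac A B id i j x v))) (at (coord A i x))"
    by (rule has_derivative_transform_within_open[OF _ W(1) W(2)]) (rule eq)
  then show ?thesis unfolding jac_def[of A C] o_def by (rule frechet_derivativeI)
qed

lemma jac_self:
  assumes A: "smooth_manifold A" and i: "i \<in> charts_at A x"
  shows "jac A A id i i x = id"
proof -
  have i': "i \<in> idx A" "x \<in> patch A i" using i by (auto simp: charts_at_def)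
  have "((\<lambda>y. y) has_derivative (\<lambda>v. v)) (at (coord A i x))" by (rule has_derivative_ident)
  then have "(local_rep A A id i i has_derivative (\<lambda>v. v)) (at (coord A i x))"
    by (rule has_derivative_transform_within_open[OF _ open_coord[OF A i'(1)]])
       (use i' coord_inv(1)[of _ A i] in \<open>simp_all add: local_rep_def\<close>)
  then show ?thesis unfolding jac_def by (simp add: frechet_derivativeI id_def)
qed

lemma smooth_manifold_smooth_id: "smooth_manifold A \<Longrightarrow> smooth_map A A id"
  by (simp add: smooth_manifold_def)

lemma jac_linear:
  "smooth_map A B F \<Longrightarrow> i \<in> charts_at A x \<Longrightarrow> j \<in> charts_at B (F x) \<Longrightarrow> linear (jac A B F i j x)"
  by (rule has_derivative_linear[OF jac_has_derivative])

section \<open>Tangent spaces of the bundles of isotropic subspaces\<close>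

lemma has_derivative_vec:
  fixes f :: "'e::real_normed_vector \<Rightarrow> 'f::real_normed_vector^'n"
  assumes "\<And>a. ((\<lambda>x. f x $ a) has_derivative (\<lambda>v. D v $ a)) F"
  shows "(f has_derivative D) F"
proof -
  have "((\<lambda>x. \<Sum>a\<in>UNIV. axis a (f x $ a)) has_derivative (\<lambda>v. \<Sum>a\<in>UNIV. axis a (D v $ a))) F"
    by (intro has_derivative_sum bounded_linear.has_derivative[OF bounded_linear_axis] assms)
  then show ?thesis by (simp flip: vec_as_axis_sum)
qed

lemma transpose_gmat: "(\<And>X Y. g X Y = g Y X) \<Longrightarrow> transpose (gmat g) = gmat g"
  by (simp add: gmat_def transpose_def vec_eq_iff)

text \<open>Pairing \<open>Z\<close> with its conjugate gives
  \<open>g (Re Z) (Re Z) + g (Im Z) (Im Z)\<close>. This is why an isotropic subspace meets its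
  conjugate trivially.\<close>

lemma cbilinear_form_ext_cnj:
  assumes g: "bilinear g" and pos: "\<And>X. X \<noteq> 0 \<Longrightarrow> g X X > 0"
    and 0: "cbilinear_form_ext g (vec_cnj Z) Z = 0"
  shows "Z = 0"
proof -
  have eq: "g (vec_Re Z) (vec_Re Z) + g (vec_Im Z) (vec_Im Z) = 0"
    using 0 by (simp add: cbilinear_form_ext_def complex_eq_iff bilinear_lneg[OF g])
  have nn: "g X X \<ge> 0" for X
  proof (cases "X = 0")
    case True
    show ?thesis unfolding True bilinear_lzero[OF g] by simp
  qed (use pos in \<open>simp add: less_imp_le\<close>)
  have "\<not> g (vec_Re Z) (vec_Re Z) > 0" "\<not> g (vec_Im Z) (vec_Im Z) > 0"
    using eq nn[of "vec_Re Z"] nn[of "vec_Im Z"] by linarith+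
  then have "vec_Re Z = 0 \<and> vec_Im Z = 0" using pos by metis
  then show "Z = 0" by (simp add: vec_Complex_eq_iff)
qed

lemma invertible_gmat:
  assumes g: "bilinear g" and pos: "\<And>X. X \<noteq> 0 \<Longrightarrow> g X X > 0"
  shows "invertible (gmat g)"
proof (rule invertible_if_inj)
  fix Z assume "gmat g *v Z = 0"
  then have "mform (gmat g) (vec_cnj Z) Z = 0" by (simp add: mform_def)
  then show "Z = 0" using cbilinear_form_ext_cnj[OF g pos] by (simp add: cbilinear_form_ext_gmat[OF g])
qed

section \<open>Isotropic bundles in charts\<close>

lemma tangent_C_comp:
  "v \<in> tangent_C A x \<Longrightarrow> i \<in> charts_at A x \<Longrightarrow> j \<in> charts_at A x \<Longrightarrow> v j = clinear_ext (jac A A id i j x) (v i)"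
  unfolding tangent_C_def by blast

lemma comps_change:
  assumes "P \<subseteq> tangent_C A x" "i \<in> charts_at A x" "j \<in> charts_at A x"
  shows "comps j P = clinear_ext (jac A A id i j x) ` comps i P"
  unfolding comps_def image_image
proof (rule image_cong[OF refl])
  show "v j = clinear_ext (jac A A id i j x) (v i)" if "v \<in> P" for v
    using that assms by (intro tangent_C_comp) auto
qed

text \<open>A right inverse of \<open>comps i\<close>: complex tangent vectors are coherent families
  over all charts, so a subspace found in one chart has to be spread over the others.\<close>

definition chart_lift :: "('i, 'a, real^'n) charted \<Rightarrow> 'i \<Rightarrow> 'a \<Rightarrow> (complex^'n) set \<Rightarrow> ('i \<Rightarrow> complex^'n) set" where
  "chart_lift A i x C = {v \<in> tangent_C A x. v i \<in> C}"

lemma chart_lift_tangent: "chart_lift A i x C \<subseteq> tangent_C A x"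
  by (auto simp: chart_lift_def)

lemma tangent_C_extend:
  assumes A: "smooth_manifold A" and i: "i \<in> charts_at A x"
  shows "(\<lambda>j. if j \<in> charts_at A x then clinear_ext (jac A A id i j x) Z else 0) \<in> tangent_C A x"
  unfolding tangent_C_def
proof (intro CollectI conjI ballI allI impI)
  fix j l assume j: "j \<in> charts_at A x" and l: "l \<in> charts_at A x"
  have "jac A A id i l x = jac A A id j l x \<circ> jac A A id i j x"
    using smooth_manifold_smooth_id[OF A] i j l by (intro jac_compose A) simp_all
  then show "(if l \<in> charts_at A x then clinear_ext (jac A A id i l x) Z else 0) =
      clinear_ext (jac A A id j l x) (if j \<in> charts_at A x then clinear_ext (jac A A id i j x) Z else 0)"
    using j l by (simp add: clinear_ext_compose)
qed simp

lemma comps_chart_lift: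
  assumes A: "smooth_manifold A" and i: "i \<in> charts_at A x"
  shows "comps i (chart_lift A i x C) = C"
proof
  show "comps i (chart_lift A i x C) \<subseteq> C" by (auto simp: comps_def chart_lift_def)
  show "C \<subseteq> comps i (chart_lift A i x C)"
  proof
    fix Z assume "Z \<in> C"
    let ?v = "\<lambda>j. if j \<in> charts_at A x then clinear_ext (jac A A id i j x) Z else 0"
    have "?v i = Z" using i by (simp add: jac_self[OF A i])
    then show "Z \<in> comps i (chart_lift A i x C)"
      using tangent_C_extend[OF A i, of Z] \<open>Z \<in> C\<close> unfolding comps_def chart_lift_def
      by (intro image_eqI[of _ _ ?v]) auto
  qed
qed

lemma jac_inverse:
  assumes "smooth_manifold A" "i \<in> charts_at A x" "j \<in> charts_at A x"
  shows "jac A A id j i x (jac A A id i j x X) = X"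
proof -
  have "jac A A id i i x = jac A A id j i x \<circ> jac A A id i j x"
    using smooth_manifold_smooth_id[of A] assms by (intro jac_compose) simp_all
  then show ?thesis using jac_self[OF assms(1,2)] by (metis comp_apply id_apply)
qed

lemma dim_image_inj:
  assumes "inj ((*v) (M :: complex^'n^'m))"
  shows "vec.dim ((*v) M ` C) = vec.dim C"
  using assms by (intro vec.dim_image_eq) (auto intro: inj_on_subset)

lemma riemannian_metricD:
  assumes g: "riemannian_metric A g" and i: "i \<in> charts_at A x"
  shows "bilinear (g i x)" "g i x X Y = g i x Y X" "X \<noteq> 0 \<Longrightarrow> g i x X X > 0"
    and "j \<in> charts_at A x \<Longrightarrow> g i x X Y = g j x (jac A A id i j x X) (jac A A id i j x Y)"
  using g[unfolded riemannian_metric_def, THEN conjunct1, THEN bspec, OF charts_atD(3)[OF i], THEN bspec, OF i]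
  by simp_all

lemma riemannian_metric_smooth:
  assumes g: "riemannian_metric A g" and i: "i \<in> idx A"
  shows "smooth_on (coord A i ` patch A i) (\<lambda>y. g i (inv_chart A i y) X Y)"
  using g[unfolded riemannian_metric_def, THEN conjunct2, THEN bspec, OF i] by simp

text \<open>One chart and one metric suffice: coordinate changes are injective isometries of
  \<open>g\<close>, and at \<open>x\<close> every member of \<open>c\<close> is a multiple of
  \<open>g\<close>.\<close>

lemma isotropic_bundleI:
  assumes A: "smooth_manifold A" and g: "riemannian_metric A g"
    and conf: "\<And>h. h \<in> c \<Longrightarrow> \<exists>\<rho>. \<forall>i\<in>charts_at A x. \<forall>X Y. h i x X Y = \<rho> * g i x X Y"
    and i: "i \<in> charts_at A x" and P: "P \<subseteq> tangent_C A x"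
    and sub: "vec.subspace (comps i P)" and dim: "vec.dim (comps i P) = r"
    and iso: "\<And>Z W. Z \<in> comps i P \<Longrightarrow> W \<in> comps i P \<Longrightarrow> cbilinear_form_ext (g i x) Z W = 0"
  shows "(x, P) \<in> isotropic_bundle A c r"
  unfolding isotropic_bundle_def
proof (intro CollectI case_prodI conjI ballI)
  show "x \<in> points A" using i by (rule charts_atD)
  show "P \<subseteq> tangent_C A x" by fact
  fix j assume j: "j \<in> charts_at A x"
  define L where "L = jac A A id i j x"
  have lin: "linear L"
    unfolding L_def using smooth_manifold_smooth_id[OF A] i j by (intro jac_linear) simp_all
  have "inj L" using jac_inverse[OF A i j] unfolding L_def by (metis injI)
  have ext: "clinear_ext L = (*v) (cmat L)" by (rule ext) (rule clinear_ext_cmat[OF lin])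
  have inj: "inj ((*v) (cmat L))" using inj_clinear_ext[OF \<open>inj L\<close>] by (simp only: ext)
  have comps: "comps j P = (*v) (cmat L) ` comps i P"
    using comps_change[OF P i j] by (simp add: L_def[symmetric] clinear_ext_cmat[OF lin])
  show "vec.subspace (comps j P)"
    unfolding comps by (rule vec.linear_subspace_image[OF matrix_vector_mul_linear_gen sub])
  show "vec.dim (comps j P) = r"
    unfolding comps using dim_image_inj[OF inj] dim by simp
  fix h Z W assume h: "h \<in> c" and Z: "Z \<in> comps j P" and W: "W \<in> comps j P"
  obtain Z' W' where ZW: "Z = clinear_ext L Z'" "W = clinear_ext L W'" "Z' \<in> comps i P" "W' \<in> comps i P"
    using Z W unfolding comps clinear_ext_cmat[OF lin] by auto
  obtain \<rho> where \<rho>: "\<And>X Y. h j x X Y = \<rho> * g j x X Y" using conf[OF h] j by blast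
  have "g i x X Y = g j x (L X) (L Y)" for X Y
    unfolding L_def by (rule riemannian_metricD(4)[OF g i j])
  then have h': "h j x (L X) (L Y) = \<rho> * g i x X Y" for X Y using \<rho> by simp
  show "cbilinear_form_ext (h j x) Z W = 0"
    using iso[OF ZW(3,4)] unfolding ZW(1,2) cbilinear_form_ext_def
    by (simp add: h' complex_eq_iff flip: distrib_left right_diff_distrib)
qed

lemma has_vector_derivative_zero_unique:
  fixes f :: "real \<Rightarrow> 'b::real_normed_vector"
  assumes "(f has_vector_derivative D) (at 0)" "f 0 = 0" "\<forall>\<^sub>F t in at 0. f t = 0"
  shows "D = 0"
proof -
  have "((\<lambda>t. 0) has_vector_derivative D) (at 0)"
    using assms(1) unfolding has_vector_derivative_def
    by (rule has_derivative_transform_eventually[OF _ assms(3)]) (use assms(2) in simp_all)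
  then show ?thesis by (rule vector_derivative_unique_at) (rule has_vector_derivative_const)
qed

text \<open>Common setting for the bundle of all isotropic spaces of \<open>N\<close> and for the
  positive one of \<open>M\<close>. \<open>Q_stable\<close> expresses that \<open>Q\<close> is open
  in the full isotropic bundle, restricted to the kind of curve that realises tangent
  vectors.\<close>

locale isotropic_subbundle =
  fixes A :: "('i, 'a, real^'n) charted" and c g \<Gamma> Q r
  assumes manifold: "smooth_manifold A" and metric: "riemannian_metric A g" and g_in: "g \<in> c"
    and conformal: "\<And>h x. h \<in> c \<Longrightarrow> x \<in> points A \<Longrightarrow> \<exists>\<rho>. \<forall>i\<in>charts_at A x. \<forall>X Y. h i x X Y = \<rho> * g i x X Y"
    and bilinear_conn: "\<And>x i. i \<in> charts_at A x \<Longrightarrow> bilinear (\<Gamma> i x)"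
    and weyl: "\<And>x i X. i \<in> charts_at A x \<Longrightarrow> \<exists>\<alpha>. \<forall>Y Z.
        frechet_derivative (\<lambda>y. g i (inv_chart A i y) Y Z) (at (coord A i x)) X
          - g i x (\<Gamma> i x X Y) Z - g i x Y (\<Gamma> i x X Z) = \<alpha> * g i x Y Z"
    and Q_sub: "Q \<subseteq> isotropic_bundle A c r"
    and Q_stable: "\<And>x P i X B. (x, P) \<in> Q \<Longrightarrow> i \<in> charts_at A x \<Longrightarrow> (B \<longlongrightarrow> mat 1) (at (0::real)) \<Longrightarrow>
        \<forall>\<^sub>F t in at 0. \<forall>P'. (inv_chart A i (coord A i x + t *\<^sub>R X), P') \<in> isotropic_bundle A c r \<longrightarrow>
          comps i P' = (*v) (B t) ` comps i P \<longrightarrow>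
          (inv_chart A i (coord A i x + t *\<^sub>R X), P') \<in> Q"

locale isotropic_point = isotropic_subbundle A c g \<Gamma> Q r
  for A :: "('i, 'a, real^'n) charted" and c g \<Gamma> Q r +
  fixes x :: 'a and P :: "('i \<Rightarrow> complex^'n) set" and i :: 'i
  assumes in_Q: "(x, P) \<in> Q" and chart: "i \<in> charts_at A x"
begin

abbreviation "y\<^sub>0 \<equiv> coord A i x"
abbreviation "point y \<equiv> inv_chart A i y"
abbreviation "C \<equiv> comps i P"
abbreviation "E \<equiv> projector C"

definition "G y = gmat (g i (point y))"
definition "DG X = gmat (\<lambda>Y Z. frechet_derivative (\<lambda>y. g i (point y) Y Z) (at y\<^sub>0) X)"
abbreviation "conn X \<equiv> cmat (\<Gamma> i x X)"

text \<open>The equations of the bundle linearised at \<open>(y\<^sub>0, E)\<close>: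
  self-adjointness and idempotence of the projector and, compressed by \<open>E\<close>, isotropy of
  its range.\<close>

definition tangents :: "((real^'n) \<times> (complex^'n^'n)) set" where
  "tangents = {(X, S). adjoint_matrix S = S \<and> S = S ** E + E ** S \<and>
     transpose E ** (DG X + transpose S ** G y\<^sub>0 + G y\<^sub>0 ** S) ** E = 0}"

lemma idx: "i \<in> idx A" and x_patch: "x \<in> patch A i"
  using chart by (auto dest: charts_atD)

lemma point_y0 [simp]: "point y\<^sub>0 = x"
  by (rule inv_coord[OF manifold chart])

lemma metric_at:
  assumes "x' \<in> patch A i"
  shows "bilinear (g i x')" "g i x' X Y = g i x' Y X" "X \<noteq> 0 \<Longrightarrow> g i x' X X > 0"
proof -
  have i: "i \<in> charts_at A x'" using assms idx by (simp add: charts_at_def)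
  show "bilinear (g i x')" "g i x' X Y = g i x' Y X" "X \<noteq> 0 \<Longrightarrow> g i x' X X > 0"
    by (fact riemannian_metricD[OF metric i])+
qed

lemma chart_bundleD:
  assumes "(x', P') \<in> isotropic_bundle A c r" "x' \<in> patch A i"
  shows "vec.subspace (comps i P')" "vec.dim (comps i P') = r"
    and "transpose (projector (comps i P')) ** gmat (g i x') ** projector (comps i P') = 0"
proof -
  have "i \<in> charts_at A x'" using assms idx by (simp add: charts_at_def)
  then have *: "vec.subspace (comps i P') \<and> vec.dim (comps i P') = r \<and>
      (\<forall>Z\<in>comps i P'. \<forall>W\<in>comps i P'. cbilinear_form_ext (g i x') Z W = 0)"
    using assms(1) g_in unfolding isotropic_bundle_def by auto
  then show sub: "vec.subspace (comps i P')" and "vec.dim (comps i P') = r" by auto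
  have "\<forall>Z\<in>range ((*v) (projector (comps i P'))). \<forall>W\<in>range ((*v) (projector (comps i P'))). mform (gmat (g i x')) Z W = 0"
    using * unfolding range_projector[OF sub] cbilinear_form_ext_gmat[OF metric_at(1)[OF assms(2)]] by blast
  then show "transpose (projector (comps i P')) ** gmat (g i x') ** projector (comps i P') = 0"
    by (simp only: isotropic_range_iff)
qed

lemmas C_facts = chart_bundleD[OF subsetD[OF Q_sub in_Q] x_patch]
lemmas E_facts = projector[OF C_facts(1)]

lemma E_iso: "transpose E ** G y\<^sub>0 ** E = 0"
  using C_facts(3) by (simp add: G_def)

lemma G_has_derivative: "(G has_derivative DG) (at y\<^sub>0)"
  unfolding G_def
proof (intro has_derivative_vec)
  fix a b
  let ?f = "\<lambda>y. g i (point y) (axis a 1) (axis b 1)"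
  have "smooth_on (coord A i ` patch A i) ?f"
    by (rule riemannian_metric_smooth[OF metric idx])
  then have "?f differentiable at y\<^sub>0"
    by (rule smooth_on_differentiable) (use x_patch in auto)
  then have "(?f has_derivative frechet_derivative ?f (at y\<^sub>0)) (at y\<^sub>0)"
    by (simp add: frechet_derivative_works)
  then show "((\<lambda>y. gmat (g i (point y)) $ a $ b) has_derivative (\<lambda>v. DG v $ a $ b)) (at y\<^sub>0)"
    unfolding gmat_def DG_def by (simp add: bounded_linear.has_derivative[OF bounded_linear_of_real])
qed

lemma coord_set:
  "coord (bundle_charts A Q) i ` patch (bundle_charts A Q) i
    = {(coord A i x', projector (comps i P')) | x' P'. (x', P') \<in> Q \<and> x' \<in> patch A i}"
  by (force simp: bundle_charts_def)

lemma coord_set_facts: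
  assumes "(y, F) \<in> coord (bundle_charts A Q) i ` patch (bundle_charts A Q) i"
  shows "F ** F = F" "adjoint_matrix F = F" "transpose F ** G y ** F = 0"
proof -
  obtain x' P' where *: "y = coord A i x'" "F = projector (comps i P')" "(x', P') \<in> isotropic_bundle A c r" "x' \<in> patch A i"
    using assms Q_sub unfolding coord_set by blast
  have pt: "point y = x'" using * idx by (simp add: manifold charts_at_def)
  note bd = chart_bundleD[OF *(3,4)]
  show "F ** F = F" unfolding *(2) by (rule projector_idem[OF bd(1)])
  show "adjoint_matrix F = F" unfolding *(2) by (rule projector_adjoint[OF bd(1)])
  show "transpose F ** G y ** F = 0" unfolding G_def pt unfolding *(2) by (rule bd(3))
qed

text \<open>The equations of the bundle hold along the curve for all times near 0, so their
  derivatives at 0 vanish; the derivative of the isotropy equation is then compressed by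
  \<open>E\<close>.\<close>

lemma bundle_tangent_subset: "bundle_tangent A Q i (x, P) \<subseteq> tangents"
proof
  fix v assume "v \<in> bundle_tangent A Q i (x, P)"
  then obtain \<gamma> where \<gamma>: "\<gamma> 0 = (y\<^sub>0, E)" "(\<gamma> has_vector_derivative v) (at 0)"
    "\<forall>\<^sub>F t in at 0. \<gamma> t \<in> coord (bundle_charts A Q) i ` patch (bundle_charts A Q) i"
    unfolding bundle_tangent_def tangent_space_def by (auto simp: bundle_charts_def)
  obtain X S where v: "v = (X, S)" by fastforce
  define y where "y t = fst (\<gamma> t)" for t
  define F where "F t = snd (\<gamma> t)" for t
  have y0: "y 0 = y\<^sub>0" and F0: "F 0 = E" by (simp_all add: y_def F_def \<gamma>(1))
  have y': "(y has_vector_derivative X) (at 0)" and F': "(F has_vector_derivative S) (at 0)"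
    unfolding y_def F_def using bounded_linear.has_vector_derivative[OF bounded_linear_fst \<gamma>(2)]
      bounded_linear.has_vector_derivative[OF bounded_linear_snd \<gamma>(2)] by (simp_all add: v)
  have ev: "\<forall>\<^sub>F t in at 0. F t ** F t = F t \<and> adjoint_matrix (F t) = F t \<and> transpose (F t) ** G (y t) ** F t = 0"
    using \<gamma>(3)
  proof (rule eventually_mono)
    fix t assume "\<gamma> t \<in> coord (bundle_charts A Q) i ` patch (bundle_charts A Q) i"
    then have "(y t, F t) \<in> coord (bundle_charts A Q) i ` patch (bundle_charts A Q) i"
      by (simp only: y_def F_def prod.collapse)
    from coord_set_facts[OF this]
    show "F t ** F t = F t \<and> adjoint_matrix (F t) = F t \<and> transpose (F t) ** G (y t) ** F t = 0" by simp
  qed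
  have G': "((\<lambda>t. G (y t)) has_vector_derivative DG X) (at 0)"
    using vector_derivative_diff_chain_within[OF y' has_derivative_at_withinI[of G DG]] G_has_derivative
    by (simp add: o_def y0)
  note hvd_mult = bounded_bilinear.has_vector_derivative[OF bounded_bilinear_matrix_mult]
  have "((\<lambda>t. F t ** F t - F t) has_vector_derivative (F 0 ** S + S ** F 0 - S)) (at 0)"
    by (intro has_vector_derivative_diff hvd_mult F')
  then have 1: "F 0 ** S + S ** F 0 - S = 0"
    by (rule has_vector_derivative_zero_unique) (use ev in \<open>auto simp: F0 E_facts elim: eventually_mono\<close>)
  have "((\<lambda>t. adjoint_matrix (F t) - F t) has_vector_derivative (adjoint_matrix S - S)) (at 0)"
    by (intro has_vector_derivative_diff bounded_linear.has_vector_derivative[OF bounded_linear_adjoint_matrix] F')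
  then have 2: "adjoint_matrix S - S = 0"
    by (rule has_vector_derivative_zero_unique) (use ev in \<open>auto simp: F0 E_facts elim: eventually_mono\<close>)
  have "((\<lambda>t. transpose (F t) ** G (y t) ** F t) has_vector_derivative
      (transpose (F 0) ** G (y 0) ** S + (transpose (F 0) ** DG X + transpose S ** G (y 0)) ** F 0)) (at 0)"
    by (intro hvd_mult bounded_linear.has_vector_derivative[OF bounded_linear_transpose] F' G')
  then have 3: "transpose (F 0) ** G (y 0) ** S + (transpose (F 0) ** DG X + transpose S ** G (y 0)) ** F 0 = 0"
    by (rule has_vector_derivative_zero_unique) (use ev in \<open>auto simp: F0 y0 E_iso elim: eventually_mono\<close>)
  have tE: "transpose E ** transpose E = transpose E" by (simp add: E_facts flip: matrix_transpose_mul)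
  have "transpose E ** (transpose E ** G y\<^sub>0 ** S + (transpose E ** DG X + transpose S ** G y\<^sub>0) ** E) ** E
      = transpose E ** (DG X + transpose S ** G y\<^sub>0 + G y\<^sub>0 ** S) ** E"
  proof -
    have EE: "X ** E ** E = X ** E" for X :: "complex^'n^'n"
      by (simp add: E_facts(1) flip: matrix_mul_assoc)
    show ?thesis by (simp only: matrix_ring_simps tE EE) (simp only: ac_simps)
  qed
  then show "v \<in> tangents"
    using 1 2 3 by (simp add: tangents_def v F0 y0 algebra_simps)
qed

text \<open>The difference of two tangent vectors over the same \<open>X\<close> is determined by its component in
  \<open>Hom(P, T/P)\<close>.\<close>

lemma hermitian_determined:
  assumes S: "adjoint_matrix S = S" "S = S ** E + E ** S"
  shows "S = (mat 1 - E) ** S ** E + adjoint_matrix ((mat 1 - E) ** S ** E)"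
    and "E ** S ** E = 0" "(mat 1 - E) ** S ** E = S ** E"
proof -
  have "E ** S ** E = E ** (S ** E + E ** S) ** E" using S(2) by simp
  also have "\<dots> = E ** S ** (E ** E) + (E ** E) ** S ** E" by (simp only: matrix_ring_simps)
  finally show 0: "E ** S ** E = 0" by (simp add: E_facts(1))
  then show 1: "(mat 1 - E) ** S ** E = S ** E" by (simp add: matrix_ring_simps)
  show "S = (mat 1 - E) ** S ** E + adjoint_matrix ((mat 1 - E) ** S ** E)"
    unfolding 1 using S by (simp add: adjoint_matrix_mult E_facts(2))
qed

text \<open>The base point moves along the chart segment \<open>y\<^sub>0 + t X\<close>, and the
  subspace is carried along by the matrices that \<open>isotropic_curve\<close> provides for the
  velocity \<open>S\<close>. The projectors then have velocity \<open>S\<close> again by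
  \<open>hermitian_determined\<close>, and \<open>Q_stable\<close> keeps the curve in
  \<open>Q\<close>.\<close>

lemma bundle_tangent_supset:
  assumes "(X, S) \<in> tangents"
  shows "(X, S) \<in> bundle_tangent A Q i (x, P)"
proof -
  have adj: "adjoint_matrix S = S" and SE: "S = S ** E + E ** S"
    and tan: "transpose E ** (DG X + transpose S ** G y\<^sub>0 + G y\<^sub>0 ** S) ** E = 0"
    using assms by (auto simp: tangents_def)
  have lim_line: "((\<lambda>t. y\<^sub>0 + t *\<^sub>R X) \<longlongrightarrow> y\<^sub>0) (at (0::real))"
    by (auto intro!: tendsto_eq_intros)
  have patch_ev: "\<forall>\<^sub>F t in at (0::real). y\<^sub>0 + t *\<^sub>R X \<in> coord A i ` patch A i"
    using topological_tendstoD[OF lim_line open_coord[OF manifold idx]] x_patch by blast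
  have line': "((\<lambda>t. y\<^sub>0 + t *\<^sub>R X) has_vector_derivative X) (at 0)"
    by (auto intro!: derivative_eq_intros)
  have G': "((\<lambda>t. G (y\<^sub>0 + t *\<^sub>R X)) has_vector_derivative DG X) (at 0)"
    using vector_derivative_diff_chain_within[OF line' has_derivative_at_withinI[of G DG]] G_has_derivative
    by (simp add: o_def)
  have "\<exists>B. B 0 = mat 1 \<and> (B has_vector_derivative S) (at 0) \<and>
    (\<forall>\<^sub>F t in at 0. transpose E ** transpose (B t) ** G (y\<^sub>0 + t *\<^sub>R X) ** B t ** E = 0)"
  proof (rule isotropic_curve[OF G'])
    show "\<forall>\<^sub>F t in at 0. transpose (G (y\<^sub>0 + t *\<^sub>R X)) = G (y\<^sub>0 + t *\<^sub>R X)"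
      using patch_ev by (rule eventually_mono) (auto simp: G_def intro!: transpose_gmat metric_at coord_inv)
    show "invertible (G (y\<^sub>0 + 0 *\<^sub>R X))"
      using metric_at[OF x_patch] by (auto simp: G_def intro!: invertible_gmat)
  qed (use E_facts E_iso tan in simp_all)
  then obtain B where B: "B 0 = mat 1" "(B has_vector_derivative S) (at 0)"
    "\<forall>\<^sub>F t in at 0. transpose E ** transpose (B t) ** G (y\<^sub>0 + t *\<^sub>R X) ** B t ** E = 0"
    by blast
  have limB: "(B \<longlongrightarrow> mat 1) (at 0)" using has_vector_derivative_tendsto[OF B(2)] by (simp add: B(1))
  have "mat 1 \<in> {M :: complex^'n^'n. invertible M}" by (simp add: invertible_det_nz)
  then have inv_ev: "\<forall>\<^sub>F t in at 0. invertible (B t)"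
    using topological_tendstoD[OF limB open_invertible] by simp
  define \<gamma> where "\<gamma> t = (y\<^sub>0 + t *\<^sub>R X, projector ((*v) (B t) ` C))" for t
  have "(\<gamma> has_vector_derivative (X, (mat 1 - E) ** S ** E + adjoint_matrix ((mat 1 - E) ** S ** E))) (at 0)"
    unfolding \<gamma>_def by (intro has_vector_derivative_Pair line' has_vector_derivative_projector_image C_facts(1) B)
  moreover have "(mat 1 - E) ** S ** E + adjoint_matrix ((mat 1 - E) ** S ** E) = S"
    by (rule hermitian_determined(1)[OF adj SE, symmetric])
  moreover have "\<gamma> 0 = (y\<^sub>0, E)" by (simp add: \<gamma>_def B(1) image_def)
  moreover have "\<forall>\<^sub>F t in at 0. \<gamma> t \<in> coord (bundle_charts A Q) i ` patch (bundle_charts A Q) i"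
    using B(3) inv_ev patch_ev Q_stable[OF in_Q chart limB, of X]
  proof eventually_elim
    case (elim t)
    let ?x = "point (y\<^sub>0 + t *\<^sub>R X)" and ?C = "(*v) (B t) ` C"
    let ?P = "chart_lift A i ?x ?C"
    have x: "?x \<in> patch A i" "coord A i ?x = y\<^sub>0 + t *\<^sub>R X" using coord_inv[OF elim(3)] by auto
    then have i: "i \<in> charts_at A ?x" using idx by (simp add: charts_at_def)
    have comps: "comps i ?P = ?C" by (rule comps_chart_lift[OF manifold i])
    have inj: "inj ((*v) (B t))"
      using matrix_inv_works(2)[OF elim(2)] by (metis injI matrix_vector_mul_assoc matrix_vector_mul_lid)
    have rangeC: "?C = range ((*v) (B t ** E))"
      by (simp add: E_facts(3) flip: matrix_vector_mul_assoc image_image)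
    have "(?x, ?P) \<in> isotropic_bundle A c r"
    proof (rule isotropic_bundleI[OF manifold metric _ i chart_lift_tangent])
      show "\<exists>\<rho>. \<forall>i\<in>charts_at A ?x. \<forall>X Y. h i ?x X Y = \<rho> * g i ?x X Y" if "h \<in> c" for h
        using conformal[OF that charts_atD(3)[OF i]] .
      show "vec.subspace (comps i ?P)"
        unfolding comps by (rule vec.linear_subspace_image[OF matrix_vector_mul_linear_gen C_facts(1)])
      show "vec.dim (comps i ?P) = r"
        unfolding comps dim_image_inj[OF inj] by (rule C_facts(2))
      have "transpose (B t ** E) ** gmat (g i ?x) ** (B t ** E) = 0"
        using elim(1) by (simp add: G_def matrix_transpose_mul matrix_mul_assoc)
      then have "\<forall>Z\<in>?C. \<forall>W\<in>?C. mform (gmat (g i ?x)) Z W = 0"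
        unfolding rangeC isotropic_range_iff .
      then show "cbilinear_form_ext (g i ?x) Z W = 0" if "Z \<in> comps i ?P" "W \<in> comps i ?P" for Z W
        using that unfolding comps cbilinear_form_ext_gmat[OF metric_at(1)[OF x(1)]] by blast
    qed
    then have "(?x, ?P) \<in> Q" using elim(4) comps by blast
    then have "(coord A i ?x, projector (comps i ?P)) \<in> coord (bundle_charts A Q) i ` patch (bundle_charts A Q) i"
      unfolding coord_set using x(1) by blast
    then show "\<gamma> t \<in> coord (bundle_charts A Q) i ` patch (bundle_charts A Q) i"
      by (simp add: \<gamma>_def comps x(2))
  qed
  ultimately show ?thesis
    unfolding bundle_tangent_def tangent_space_def by (auto simp: bundle_charts_def)
qed

lemma bundle_tangent_eq: "bundle_tangent A Q i (x, P) = tangents"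
  using bundle_tangent_subset bundle_tangent_supset by auto

end

section \<open>The almost CR-structure\<close>

lemma transpose_minus: "transpose (- A) = - transpose (A :: 'a::ring_1^'n^'m)"
  by (simp add: transpose_def vec_eq_iff)

text \<open>Multiplication by the imaginary unit has to be entrywise: on a matrix, \<open>*s\<close>
  would expect a vector as its scalar.\<close>

definition imat :: "complex^'n^'m \<Rightarrow> complex^'n^'m" where
  "imat A = (\<chi> a b. \<i> * A $ a $ b)"

lemma imat_mult_left: "imat A ** B = imat (A ** B)"
  and imat_mult_right: "A ** imat B = imat (A ** B)"
  by (simp_all add: imat_def matrix_matrix_mult_def vec_eq_iff sum_distrib_left mult_ac)

lemma imat_simps:
  "imat (imat A) = - A" "imat (A + B) = imat A + imat B" "imat (A - B) = imat A - imat B"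
  "imat (- A) = - imat A" "imat 0 = 0" "transpose (imat A) = imat (transpose A)"
  "adjoint_matrix (imat D) = - imat (adjoint_matrix D)"
  by (simp_all add: imat_def vec_eq_iff transpose_def algebra_simps)

lemma imat_vector: "imat A *v x = \<i> *s (A *v x)"
  by (simp add: imat_def matrix_vector_mult_def vec_eq_iff sum_distrib_left mult_ac)

lemma fibre_J_imat: "fibre_J E v = (fst v, imat (snd v ** E - E ** snd v))"
  by (cases v) (simp add: fibre_J_def imat_def)

lemma gmat_linear:
  "gmat (\<lambda>Y Z. f Y Z + h Y Z) = gmat f + gmat h" "gmat (\<lambda>Y Z. s *\<^sub>R f Y Z) = s *\<^sub>R gmat f"
  by (simp_all add: gmat_def vec_eq_iff complex_eq_iff)

lemma cmat_add: "cmat (\<lambda>Y. L Y + K Y) = cmat L + cmat K"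
  and cmat_scaleR: "cmat (\<lambda>Y. s *\<^sub>R L Y) = s *\<^sub>R cmat L"
  by (simp_all add: cmat_def vec_eq_iff complex_eq_iff)

lemma linear_functional_sum:
  fixes f :: "real^'n \<Rightarrow> real"
  assumes "linear f"
  shows "f y = (\<Sum>b\<in>UNIV. f (axis b 1) * y $ b)"
proof -
  have "f y = f (\<Sum>b\<in>UNIV. y $ b *\<^sub>R axis b 1)"
    using basis_expansion[of y] by (simp add: scalar_mult_eq_scaleR)
  then show ?thesis by (simp add: linear_sum[OF assms] linear_scale[OF assms] mult.commute)
qed

lemma gmat_mult:
  assumes "bilinear g"
  shows "gmat (\<lambda>Y Z. g (L Y) Z) = transpose (cmat L) ** gmat g"
    and "gmat (\<lambda>Y Z. g Y (L Z)) = gmat g ** cmat L"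
proof -
  have "linear (\<lambda>u. g u v)" "linear (g v)" for v using assms by (simp_all add: bilinear_def)
  from linear_functional_sum[OF this(1)] linear_functional_sum[OF this(2)]
  have "g (L (axis a 1)) (axis b 1) = (\<Sum>k\<in>UNIV. g (axis k 1) (axis b 1) * L (axis a 1) $ k)"
    "g (axis a 1) (L (axis b 1)) = (\<Sum>k\<in>UNIV. g (axis a 1) (axis k 1) * L (axis b 1) $ k)" for a b
    by this+
  then show "gmat (\<lambda>Y Z. g (L Y) Z) = transpose (cmat L) ** gmat g"
    and "gmat (\<lambda>Y Z. g Y (L Z)) = gmat g ** cmat L"
    by (simp_all only: gmat_def cmat_def transpose_def matrix_matrix_mult_def vec_eq_iff vec_lambda_beta
        of_real_mult of_real_sum mult.commute simp_thms)
qed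

section \<open>Horizontal lifts, vertical parts and the eigenspace of \<open>J_prime\<close>\<close>

context isotropic_point begin

lemma mult_E_E: "X ** E ** E = X ** E" for X :: "complex^'n^'m"
  by (simp add: E_facts(1) flip: matrix_mul_assoc)

lemma linear_DG: "linear DG"
  by (rule has_derivative_linear[OF G_has_derivative])

lemma conn_add: "conn (X + Y) = conn X + conn Y" and conn_scaleR: "conn (s *\<^sub>R X) = s *\<^sub>R conn X"
proof -
  have "\<Gamma> i x (X + Y) = (\<lambda>V. \<Gamma> i x X V + \<Gamma> i x Y V)" "\<Gamma> i x (s *\<^sub>R X) = (\<lambda>V. s *\<^sub>R \<Gamma> i x X V)"
    by (intro ext bilinear_ladd[OF bilinear_conn[OF chart]] bilinear_lmul[OF bilinear_conn[OF chart]])+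
  then show "conn (X + Y) = conn X + conn Y" "conn (s *\<^sub>R X) = s *\<^sub>R conn X"
    by (simp_all only: cmat_add cmat_scaleR)
qed

text \<open>The Weyl condition writes \<open>DG X\<close> as connection terms plus a multiple of the
  metric, and that multiple vanishes after compression because the range of \<open>E\<close> is
  isotropic. This is where a conformal structure serves as well as a metric.\<close>

lemma DG_weyl: "transpose E ** DG X ** E = transpose E ** (transpose (conn X) ** G y\<^sub>0 + G y\<^sub>0 ** conn X) ** E"
proof -
  obtain \<alpha> where \<alpha>: "\<And>Y Z. frechet_derivative (\<lambda>y. g i (point y) Y Z) (at y\<^sub>0) X
          - g i x (\<Gamma> i x X Y) Z - g i x Y (\<Gamma> i x X Z) = \<alpha> * g i x Y Z"
    using weyl[OF chart] by blast
  have "DG X = gmat (\<lambda>Y Z. g i x (\<Gamma> i x X Y) Z + g i x Y (\<Gamma> i x X Z) + \<alpha> *\<^sub>R g i x Y Z)"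
    unfolding DG_def
  proof (rule arg_cong[of _ _ gmat], intro ext)
    show "frechet_derivative (\<lambda>y. g i (point y) Y Z) (at y\<^sub>0) X =
      g i x (\<Gamma> i x X Y) Z + g i x Y (\<Gamma> i x X Z) + \<alpha> *\<^sub>R g i x Y Z" for Y Z
      using \<alpha>[of Y Z] by simp
  qed
  also have "\<dots> = transpose (conn X) ** G y\<^sub>0 + G y\<^sub>0 ** conn X + \<alpha> *\<^sub>R G y\<^sub>0"
    unfolding gmat_linear gmat_mult[OF metric_at(1)[OF x_patch], of "\<Gamma> i x X"] by (simp add: G_def)
  finally have DG: "DG X = transpose (conn X) ** G y\<^sub>0 + G y\<^sub>0 ** conn X + \<alpha> *\<^sub>R G y\<^sub>0" .
  have "transpose E ** (\<alpha> *\<^sub>R G y\<^sub>0) ** E = 0"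
    by (simp add: matrix_mult_scaleR scaleR_matrix_mult E_iso)
  then show ?thesis unfolding DG by (simp only: matrix_add_ldistrib matrix_plus_rdistrib add_0_right)
qed

lemma subspace_tangents: "subspace tangents"
proof -
  have "linear (\<lambda>v :: (real^'n) \<times> (complex^'n^'n). adjoint_matrix (snd v) - snd v)"
    by (simp add: linear_iff adjoint_matrix_add algebra_simps
        linear_scale[OF bounded_linear.linear[OF bounded_linear_adjoint_matrix]])
  moreover have "linear (\<lambda>v :: (real^'n) \<times> (complex^'n^'n). snd v - (snd v ** E + E ** snd v))"
    by (simp add: linear_iff matrix_ring_simps matrix_mult_scaleR scaleR_matrix_mult algebra_simps)
  moreover have "linear (\<lambda>v. transpose E ** (DG (fst v) + transpose (snd v) ** G y\<^sub>0 + G y\<^sub>0 ** snd v) ** E)"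
    by (simp add: linear_iff linear_add[OF linear_DG] linear_scale[OF linear_DG] transpose_add transpose_scaleR
        matrix_ring_simps matrix_mult_scaleR scaleR_matrix_mult algebra_simps)
  moreover have "tangents = {v. adjoint_matrix (snd v) - snd v = 0} \<inter> {v. snd v - (snd v ** E + E ** snd v) = 0}
      \<inter> {v. transpose E ** (DG (fst v) + transpose (snd v) ** G y\<^sub>0 + G y\<^sub>0 ** snd v) ** E = 0}"
    by (auto simp: tangents_def)
  ultimately show ?thesis by (simp only: subspace_inter linear_subspace_kernel)
qed

text \<open>The fibre velocity of the horizontal lift of \<open>X\<close>: the block from
  \<open>P\<close> to its complement has to cancel the Christoffel term, and self-adjointness forces
  the opposite block.\<close>

definition hlift :: "real^'n \<Rightarrow> complex^'n^'n" where
  "hlift X = - ((mat 1 - E) ** conn X ** E) - adjoint_matrix ((mat 1 - E) ** conn X ** E)"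

lemma hlift_E: "hlift X ** E = - ((mat 1 - E) ** conn X ** E)"
  by (simp add: hlift_def adjoint_matrix_mult adjoint_matrix_diff E_facts matrix_ring_simps mult_E_E algebra_simps)

lemma hlift_tangents: "(X, hlift X) \<in> tangents"
proof -
  have adj: "adjoint_matrix (hlift X) = hlift X"
    by (simp add: hlift_def adjoint_matrix_diff adjoint_matrix_minus)
  have "E ** hlift X = adjoint_matrix (hlift X ** E)" by (simp add: adjoint_matrix_mult adj E_facts)
  also have "\<dots> = - adjoint_matrix ((mat 1 - E) ** conn X ** E)" by (simp only: hlift_E adjoint_matrix_minus)
  finally have EH: "E ** hlift X = - adjoint_matrix ((mat 1 - E) ** conn X ** E)" .
  have sum: "hlift X = hlift X ** E + E ** hlift X"
    unfolding hlift_E EH by (simp only: hlift_def diff_conv_add_uminus)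
  \<comment> \<open>The component of \<open>conn X\<close> along \<open>P\<close> is annihilated by
    \<open>E_iso\<close>, so the lift contributes exactly minus the connection term that appears in
    \<open>DG_weyl\<close>.\<close>
  have 1: "transpose E ** G y\<^sub>0 ** hlift X ** E = - (transpose E ** G y\<^sub>0 ** conn X ** E)"
  proof -
    have "transpose E ** G y\<^sub>0 ** hlift X ** E = transpose E ** G y\<^sub>0 ** (hlift X ** E)" by (simp only: matrix_mul_assoc)
    also have "\<dots> = - (transpose E ** G y\<^sub>0 ** conn X ** E) + (transpose E ** G y\<^sub>0 ** E) ** conn X ** E"
      by (simp add: hlift_E matrix_ring_simps)
    finally show ?thesis by (simp add: E_iso)
  qed
  have symG: "transpose (G y\<^sub>0) = G y\<^sub>0"
    using metric_at[OF x_patch] by (simp add: G_def transpose_gmat)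
  have 2: "transpose E ** transpose (hlift X) ** G y\<^sub>0 ** E = - (transpose E ** transpose (conn X) ** G y\<^sub>0 ** E)"
    using arg_cong[OF 1, of transpose]
    by (simp only: matrix_transpose_mul symG transpose_transpose matrix_mul_assoc transpose_minus)
  have "transpose E ** (DG X + transpose (hlift X) ** G y\<^sub>0 + G y\<^sub>0 ** hlift X) ** E
    = transpose E ** DG X ** E + transpose E ** transpose (hlift X) ** G y\<^sub>0 ** E + transpose E ** G y\<^sub>0 ** hlift X ** E"
    by (simp only: matrix_ring_simps)
  also have "\<dots> = 0" unfolding 1 2 DG_weyl by (simp add: matrix_ring_simps)
  finally show ?thesis using adj sum by (simp add: tangents_def)
qed

text \<open>The vertical part of \<open>v\<close>, with \<open>Hom(P, T/P)\<close> realised by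
  matrices that factor through \<open>E\<close> on the right and through \<open>1 - E\<close> on the
  left.\<close>

definition cov :: "(real^'n) \<times> (complex^'n^'n) \<Rightarrow> complex^'n^'n" where
  "cov v = (mat 1 - E) ** (snd v + conn (fst v)) ** E"

lemma mem_C_iff: "u \<in> C \<longleftrightarrow> (mat 1 - E) *v u = 0"
  using projector_mem_iff[OF C_facts(1), of u] by (auto simp: matrix_vector_mult_diff_rdistrib)

lemma cov_zero_iff: "cov v = 0 \<longleftrightarrow> (\<forall>u\<in>C. snd v *v u + conn (fst v) *v u \<in> C)"
proof -
  have "cov v = 0 \<longleftrightarrow> (\<forall>x. (mat 1 - E) *v ((snd v + conn (fst v)) *v (E *v x)) = 0)"
    by (simp add: cov_def matrix_eq matrix_vector_mul_assoc matrix_mul_assoc)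
  also have "\<dots> \<longleftrightarrow> (\<forall>u\<in>range ((*v) E). (mat 1 - E) *v ((snd v + conn (fst v)) *v u) = 0)" by blast
  finally show ?thesis
    unfolding E_facts(3) by (simp add: mem_C_iff matrix_vector_mult_add_rdistrib)
qed

lemma linear_conn: "linear (\<Gamma> i x X)"
  using bilinear_conn[OF chart] by (simp add: bilinear_def)

lemma horizontal_eq: "horizontal A \<Gamma> Q i (x, P) = {v \<in> tangents. cov v = 0}"
  unfolding horizontal_def bundle_tangent_eq cov_zero_iff
  by (auto simp: clinear_ext_cmat[OF linear_conn])

lemma cov_hlift: "cov (X, hlift X) = 0"
proof -
  have "cov (X, hlift X) = (mat 1 - E) ** (hlift X ** E) + (mat 1 - E) ** conn X ** E"
    by (simp add: cov_def matrix_ring_simps)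
  then show ?thesis by (simp add: hlift_E matrix_ring_simps E_facts)
qed

lemma cov_add: "cov (v + w) = cov v + cov w" and cov_scaleR: "cov (s *\<^sub>R v) = s *\<^sub>R cov v"
  by (simp_all add: cov_def conn_add conn_scaleR matrix_ring_simps matrix_mult_scaleR scaleR_matrix_mult
      scaleR_add_right scaleR_diff_right)

lemma cov_minus: "cov (- v) = - cov v" and cov_diff: "cov (v - w) = cov v - cov w"
  using cov_scaleR[of "-1" v] cov_add[of v "- w"] cov_scaleR[of "-1" w] by simp_all

text \<open>Over a fixed base velocity the Christoffel terms cancel in the difference, and a
  vertical vector is recovered from its off-diagonal block by self-adjointness.\<close>

lemma tangents_eqI:
  assumes "v \<in> tangents" "w \<in> tangents" "fst v = fst w" "cov v = cov w"
  shows "v = w"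
proof -
  have "v - w \<in> tangents" using subspace_tangents assms(1,2) by (rule subspace_diff)
  moreover obtain S where S: "v - w = (0, S)" using assms(3) by (metis cancel_comm_monoid_add_class.diff_cancel eq_fst_iff fst_diff)
  ultimately have "adjoint_matrix S = S" "S = S ** E + E ** S" by (auto simp: tangents_def)
  from hermitian_determined(1)[OF this]
  have "S = (mat 1 - E) ** S ** E + adjoint_matrix ((mat 1 - E) ** S ** E)" .
  moreover have "cov (v - w) = 0" by (simp add: cov_diff assms(4))
  then have "(mat 1 - E) ** S ** E = 0"
    using conn_scaleR[of 0 0] by (simp add: cov_def S)
  ultimately have "S = 0" by simp
  then show ?thesis using S by (simp add: zero_prod_def[symmetric])
qed

text \<open>An explicit description of the intended eigenspace, a pair standing for
  \<open>v + i w\<close>. A vertical (1,0)-vector is \<open>v - i J v\<close>, that is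
  \<open>w = - J v\<close>, which gives \<open>cov v = i cov w\<close>; horizontal parts have zero
  \<open>cov\<close> and do not affect this relation.\<close>

definition cr_space :: "(((real^'n) \<times> (complex^'n^'n)) \<times> ((real^'n) \<times> (complex^'n^'n))) set" where
  "cr_space = {(v, w). v \<in> tangents \<and> w \<in> tangents \<and> vec_Complex (fst v) (fst w) \<in> C \<and> cov v = imat (cov w)}"

text \<open>For vertical vectors the isotropy equation is complex linear in \<open>S E\<close>, and
  \<open>fibre_J\<close> multiplies \<open>S E\<close> by the imaginary unit. Geometrically, the
  fibres are complex submanifolds of the Grassmannian.\<close>

lemma fibre_J_tangents:
  assumes "(0, S) \<in> tangents"
  shows "fibre_J E (0, S) \<in> tangents" "cov (fibre_J E (0, S)) = imat (cov (0, S))"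
proof -
  have S: "adjoint_matrix S = S" "S = S ** E + E ** S"
      "transpose E ** (transpose S ** G y\<^sub>0 + G y\<^sub>0 ** S) ** E = 0"
    using assms by (auto simp: tangents_def linear_0[OF linear_DG])
  note ESE = hermitian_determined(2)[OF S(1,2)]
  define T where "T = imat (S ** E - E ** S)"
  have TE: "T ** E = imat (S ** E)" and ET: "E ** T = - imat (E ** S)"
    by (simp_all add: T_def imat_mult_left imat_mult_right matrix_ring_simps ESE mult_E_E E_facts(1) imat_simps)
  have adj: "adjoint_matrix T = T"
    by (simp add: T_def imat_simps adjoint_matrix_diff adjoint_matrix_mult S(1) E_facts(2))
  have TT: "T = T ** E + E ** T" by (simp add: TE ET) (simp add: T_def imat_simps)
  have "transpose E ** (transpose T ** G y\<^sub>0 + G y\<^sub>0 ** T) ** E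
    = transpose (T ** E) ** G y\<^sub>0 ** E + transpose E ** G y\<^sub>0 ** (T ** E)"
    by (simp add: matrix_transpose_mul matrix_ring_simps)
  also have "\<dots> = imat (transpose E ** (transpose S ** G y\<^sub>0 + G y\<^sub>0 ** S) ** E)"
    by (simp add: TE imat_mult_left imat_mult_right imat_simps matrix_transpose_mul matrix_ring_simps)
  finally have "transpose E ** (transpose T ** G y\<^sub>0 + G y\<^sub>0 ** T) ** E = 0"
    using S(3) by (simp add: imat_simps)
  then show "fibre_J E (0, S) \<in> tangents"
    using adj TT by (simp add: fibre_J_imat tangents_def linear_0[OF linear_DG] flip: T_def)
  have "conn 0 = 0" using conn_scaleR[of 0 0] by simp
  then have "cov (fibre_J E (0, S)) = (mat 1 - E) ** (T ** E)"
    by (simp add: cov_def fibre_J_imat matrix_mul_assoc flip: T_def)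
  then show "cov (fibre_J E (0, S)) = imat (cov (0, S))"
    using \<open>conn 0 = 0\<close> by (simp add: TE imat_mult_right cov_def matrix_mul_assoc)
qed

text \<open>Subtracting the horizontal lifts of the two base velocities leaves vertical vectors; the
  condition on \<open>cov\<close> and \<open>tangents_eqI\<close> identify the second one as minus
  \<open>fibre_J\<close> of the first.\<close>

lemma cr_space_eq: "{z + w | z w. z \<in> G0 A \<Gamma> Q i (x, P) \<and> w \<in> vertical_10 A Q i (x, P)} = cr_space"
proof (intro equalityI subsetI)
  fix u assume "u \<in> {z + w | z w. z \<in> G0 A \<Gamma> Q i (x, P) \<and> w \<in> vertical_10 A Q i (x, P)}"
  then obtain h h' v where u: "u = (h, h') + (v, - fibre_J E v)" and "(h, h') \<in> G0 A \<Gamma> Q i (x, P)"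
    and "v \<in> vertical A Q i (x, P)"
    unfolding vertical_10_def by fastforce
  then have h: "h \<in> tangents" "cov h = 0" "h' \<in> tangents" "cov h' = 0" "vec_Complex (fst h) (fst h') \<in> C"
    and v: "v \<in> tangents" "fst v = 0"
    by (auto simp: G0_def vertical_def horizontal_eq bundle_tangent_eq)
  then obtain S where S: "v = (0, S)" by (metis prod.collapse)
  note J = fibre_J_tangents[OF v(1)[unfolded S]]
  have "h + v \<in> tangents" using subspace_add[OF subspace_tangents h(1) v(1)] .
  moreover have "h' + - fibre_J E v \<in> tangents"
    using subspace_add[OF subspace_tangents h(3) subspace_neg[OF subspace_tangents J(1)]] by (simp add: S)
  moreover have "fst (h' + - fibre_J E v) = fst h'" by (simp add: fibre_J_imat v(2))
  moreover have "cov (h + v) = imat (cov (h' + - fibre_J E v))"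
    by (simp add: cov_add cov_diff h J S imat_simps)
  ultimately show "u \<in> cr_space"
    using h v by (simp add: cr_space_def u)
next
  fix u assume "u \<in> cr_space"
  then obtain v w where u: "u = (v, w)" and v: "v \<in> tangents" "w \<in> tangents" "vec_Complex (fst v) (fst w) \<in> C"
      "cov v = imat (cov w)"
    by (auto simp: cr_space_def)
  define h where "h = (fst v, hlift (fst v))"
  define h' where "h' = (fst w, hlift (fst w))"
  have h: "h \<in> tangents" "cov h = 0" "h' \<in> tangents" "cov h' = 0"
    by (simp_all add: h_def h'_def hlift_tangents cov_hlift)
  have z: "v - h \<in> tangents" "fst (v - h) = 0"
    using subspace_diff[OF subspace_tangents v(1) h(1)] by (simp_all add: h_def)
  then obtain S where S: "v - h = (0, S)" by (metis prod.collapse)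
  note J = fibre_J_tangents[OF z(1)[unfolded S]]
  have "w - h' = - fibre_J E (v - h)"
  proof (rule tangents_eqI)
    show "w - h' \<in> tangents" using subspace_diff[OF subspace_tangents v(2) h(3)] .
    show "- fibre_J E (v - h) \<in> tangents" using subspace_neg[OF subspace_tangents J(1)] by (simp add: S)
    show "fst (w - h') = fst (- fibre_J E (v - h))" unfolding fibre_J_imat S by (simp add: h'_def)
    have "cov (- fibre_J E (v - h)) = - imat (cov (v - h))" by (simp add: cov_minus S J(2))
    then show "cov (w - h') = cov (- fibre_J E (v - h))" by (simp add: cov_diff h v(4) imat_simps)
  qed
  then have "w = h' + - fibre_J E (v - h)" by (simp only: diff_eq_eq add.commute)
  then have "u = (h, h') + (v - h, - fibre_J E (v - h))" by (simp only: u add_Pair add_diff_eq add_diff_cancel_left')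
  moreover have "(h, h') \<in> G0 A \<Gamma> Q i (x, P)"
    using h v(3) by (simp add: G0_def horizontal_eq) (simp add: h_def h'_def)
  moreover have "v - h \<in> vertical A Q i (x, P)"
    using z by (auto simp: vertical_def bundle_tangent_eq S)
  then have "(v - h, - fibre_J E (v - h)) \<in> vertical_10 A Q i (x, P)"
    unfolding vertical_10_def snd_conv by blast
  ultimately show "u \<in> {z + w | z w. z \<in> G0 A \<Gamma> Q i (x, P) \<and> w \<in> vertical_10 A Q i (x, P)}" by blast
qed

lemma C_conj_trivial:
  assumes "Z \<in> C" "vec_cnj Z \<in> C"
  shows "Z = 0"
proof -
  note b = metric_at[OF x_patch]
  have "mform (gmat (g i x)) (vec_cnj Z) Z = 0"
    using C_facts(3) assms unfolding isotropic_range_iff[symmetric] E_facts(3) by blast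
  then show ?thesis
    using cbilinear_form_ext_cnj[OF b(1,3)] by (simp add: cbilinear_form_ext_gmat[OF b(1)])
qed

lemma vec_smult_mem_C: "Z \<in> C \<Longrightarrow> s *s Z \<in> C"
  using C_facts(1) by (rule vec.subspace_scale)

lemma subspace_cr_space: "subspace cr_space"
proof (rule subspaceI)
  have C: "u \<in> C" if "u' \<in> C" "u = u'" for u u' using that by simp
  show "0 \<in> cr_space"
    using subspace_0[OF subspace_tangents] vec.subspace_0[OF C_facts(1)] cov_scaleR[of 0 0]
    by (simp add: cr_space_def zero_prod_def imat_simps)
  show "u + w \<in> cr_space" if "u \<in> cr_space" "w \<in> cr_space" for u w
  proof -
    obtain a b a' b' where ab: "u = (a, b)" "w = (a', b')" by (metis prod.exhaust)
    have "vec_Complex (fst (a + a')) (fst (b + b')) = vec_Complex (fst a) (fst b) + vec_Complex (fst a') (fst b')"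
      by (simp add: vec_Complex_eq_iff)
    then show ?thesis
      using that subspace_add[OF subspace_tangents] vec.subspace_add[OF C_facts(1)]
      by (auto simp: cr_space_def ab cov_add imat_simps)
  qed
  show "s *\<^sub>R u \<in> cr_space" if "u \<in> cr_space" for s u
  proof -
    obtain a b where ab: "u = (a, b)" by (metis prod.exhaust)
    have "vec_Complex (fst (s *\<^sub>R a)) (fst (s *\<^sub>R b)) = of_real s *s vec_Complex (fst a) (fst b)"
      by (simp add: vec_Complex_def vec_eq_iff complex_eq_iff)
    moreover have "imat (s *\<^sub>R M) = s *\<^sub>R imat M" for M :: "complex^'n^'n"
      by (simp add: imat_def vec_eq_iff)
    ultimately show ?thesis
      using that subspace_scale[OF subspace_tangents] vec_smult_mem_C
      by (auto simp: cr_space_def ab cov_scaleR)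
  qed
qed

text \<open>\<open>cr_of\<close> returns the prescribed eigenspace only if this is a complex
  subspace meeting its conjugate trivially. The base velocities are handled by
  \<open>C_conj_trivial\<close>; for the vertical part, \<open>cov a\<close> would equal both
  \<open>i cov b\<close> and its negative.\<close>

lemma J_prime_eigenspace: "minus_i_eigenspace (J_prime A \<Gamma> Q i (x, P)) = cr_space"
  unfolding J_prime_def cr_space_eq
proof (rule minus_i_eigenspace_cr_of[OF subspace_cr_space])
  show "(- b, a) \<in> cr_space" if "(a, b) \<in> cr_space" for a b
  proof -
    have "vec_Complex (fst (- b)) (fst a) = \<i> *s vec_Complex (fst a) (fst b)"
      by (simp add: vec_Complex_eq_iff)
    then show ?thesis
      using that subspace_neg[OF subspace_tangents] vec_smult_mem_C
      by (auto simp: cr_space_def cov_minus imat_simps)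
  qed
  show "a = 0 \<and> b = 0" if ab: "(a, b) \<in> cr_space" "(a, - b) \<in> cr_space" for a b
  proof -
    have t: "a \<in> tangents" "b \<in> tangents" and f: "vec_Complex (fst a) (fst b) \<in> C" "vec_Complex (fst a) (- fst b) \<in> C"
      and c: "cov a = imat (cov b)" "cov a = - imat (cov b)"
      using ab by (auto simp: cr_space_def cov_minus imat_simps)
    have "vec_cnj (vec_Complex (fst a) (fst b)) = vec_Complex (fst a) (- fst b)" by (simp add: vec_Complex_eq_iff)
    then have "vec_Complex (fst a) (fst b) = 0" using C_conj_trivial[OF f(1)] f(2) by simp
    then have 0: "fst a = 0" "fst b = 0" by (simp_all add: vec_Complex_eq_iff)
    have "imat (cov b) = - imat (cov b)" using c by (rule trans[OF sym])
    then have "2 *\<^sub>R imat (cov b) = 0" by (simp only: scaleR_2 eq_neg_iff_add_eq_0)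
    then have "imat (cov b) = 0" by simp
    then have "cov b = 0" using imat_simps(1)[of "cov b"] by (simp add: imat_simps)
    moreover have "cov 0 = 0" using cov_scaleR[of 0 0] by simp
    ultimately show ?thesis
      using tangents_eqI[OF t(1) subspace_0[OF subspace_tangents]] tangents_eqI[OF t(2) subspace_0[OF subspace_tangents]]
        0 c by (simp add: imat_simps)
  qed
qed

text \<open>The relation between the two values of \<open>cov\<close> is tested on vectors of
  \<open>C\<close>, the form in which derivatives of sections produce it.\<close>

lemma J_prime_eigenspace_iff:
  "(v, w) \<in> minus_i_eigenspace (J_prime A \<Gamma> Q i (x, P)) \<longleftrightarrow>
    v \<in> bundle_tangent A Q i (x, P) \<and> w \<in> bundle_tangent A Q i (x, P) \<and> vec_Complex (fst v) (fst w) \<in> C \<and>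
    (\<forall>u\<in>C. (snd v *v u + clinear_ext (\<Gamma> i x (fst v)) u) - \<i> *s (snd w *v u + clinear_ext (\<Gamma> i x (fst w)) u) \<in> C)"
proof -
  have "cov v = imat (cov w) \<longleftrightarrow> (mat 1 - E) ** ((snd v + conn (fst v)) - imat (snd w + conn (fst w))) ** E = 0"
    by (simp add: cov_def matrix_sub_ldistrib matrix_sub_rdistrib imat_mult_left imat_mult_right)
  also have "\<dots> \<longleftrightarrow> (\<forall>x. (mat 1 - E) *v (((snd v + conn (fst v)) - imat (snd w + conn (fst w))) *v (E *v x)) = 0)"
    by (simp add: matrix_eq matrix_vector_mul_assoc matrix_mul_assoc)
  also have "\<dots> \<longleftrightarrow> (\<forall>u\<in>range ((*v) E). (mat 1 - E) *v (((snd v + conn (fst v)) - imat (snd w + conn (fst w))) *v u) = 0)"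
    by blast
  finally have "cov v = imat (cov w) \<longleftrightarrow> (\<forall>u\<in>C. (snd v *v u + clinear_ext (\<Gamma> i x (fst v)) u)
      - \<i> *s (snd w *v u + clinear_ext (\<Gamma> i x (fst w)) u) \<in> C)"
    unfolding E_facts(3) mem_C_iff
    by (simp add: matrix_vector_mult_diff_rdistrib matrix_vector_mult_add_rdistrib imat_vector clinear_ext_cmat[OF linear_conn])
  then show ?thesis
    unfolding J_prime_eigenspace bundle_tangent_eq cr_space_def by simp
qed

end

section \<open>Sections along an immersion\<close>

lemma smooth_on_cmat:
  fixes L :: "'e::euclidean_space \<Rightarrow> real^'m \<Rightarrow> real^'n"
  assumes S: "open S" and L: "\<And>b. smooth_on S (\<lambda>y. L y (axis b 1))"
  shows "smooth_on S (\<lambda>y. cmat (L y))"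
  unfolding cmat_def
proof (intro smooth_on_vec[OF S])
  fix a b
  have "bounded_linear (\<lambda>v :: real^'n. complex_of_real (v $ a))"
    by (rule bounded_linear_compose[OF bounded_linear_of_real bounded_linear_vec_nth])
  from smooth_on_bounded_linear[OF S this L[of b]]
  show "smooth_on S (\<lambda>y. (\<chi> a b. complex_of_real (L y (axis b 1) $ a)) $ a $ b)" by simp
qed

lemma has_derivative_cmat:
  fixes L :: "'e::real_normed_vector \<Rightarrow> real^'m \<Rightarrow> real^'n"
  assumes "\<And>b. ((\<lambda>y. L y (axis b 1)) has_derivative (\<lambda>v. D v (axis b 1))) F"
  shows "((\<lambda>y. cmat (L y)) has_derivative (\<lambda>v. cmat (D v))) F"
  unfolding cmat_def
proof (intro has_derivative_vec)
  fix a b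
  have "bounded_linear (\<lambda>v :: real^'n. complex_of_real (v $ a))"
    by (rule bounded_linear_compose[OF bounded_linear_of_real bounded_linear_vec_nth])
  from bounded_linear.has_derivative[OF this assms[of b]]
  show "((\<lambda>y. (\<chi> a b. complex_of_real (L y (axis b 1) $ a)) $ a $ b) has_derivative
      (\<lambda>v. (\<chi> a b. complex_of_real (D v (axis b 1) $ a)) $ a $ b)) F" by simp
qed

text \<open>\<open>L EM\<close> takes its values in the range of \<open>EA\<close>. Differentiating
  this invariance is the matrix version of the rule \<open>u' = S u + E u'\<close> for a moving
  vector in a moving subspace.\<close>

lemma invariant_frame_derivative:
  fixes EA :: "'e::real_normed_vector \<Rightarrow> complex^'n^'n" and L :: "'e \<Rightarrow> complex^'m^'n"
  assumes W: "open W" "y \<in> W" and eq: "\<And>z. z \<in> W \<Longrightarrow> EA z ** (L z ** EM z) = L z ** EM z"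
    and EA: "(EA has_derivative SA) (at y)" and L: "(L has_derivative L') (at y)"
    and EM: "(EM has_derivative SM) (at y)"
  shows "EA y ** (L y ** SM v + L' v ** EM y) + SA v ** (L y ** EM y) = L y ** SM v + L' v ** EM y"
proof -
  note hd = bounded_bilinear.FDERIV[OF bounded_bilinear_matrix_mult]
  have LE: "((\<lambda>z. L z ** EM z) has_derivative (\<lambda>v. L y ** SM v + L' v ** EM y)) (at y)"
    by (rule hd[OF L EM])
  have "((\<lambda>z. EA z ** (L z ** EM z)) has_derivative
      (\<lambda>v. EA y ** (L y ** SM v + L' v ** EM y) + SA v ** (L y ** EM y))) (at y)"
    by (rule hd[OF EA LE])
  then have "((\<lambda>z. L z ** EM z) has_derivative
      (\<lambda>v. EA y ** (L y ** SM v + L' v ** EM y) + SA v ** (L y ** EM y))) (at y)"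
    by (rule has_derivative_transform_within_open[OF _ W]) (rule eq)
  from has_derivative_unique[OF this LE] show ?thesis by (rule fun_cong)
qed

lemma comps_subset_tangent: "(x, P) \<in> isotropic_bundle A c r \<Longrightarrow> P \<subseteq> tangent_C A x"
  by (auto simp: isotropic_bundle_def)

lemma subspace_diff_mem_iff:
  assumes C: "vec.subspace C" and d: "a - b \<in> C"
  shows "a \<in> C \<longleftrightarrow> b \<in> C"
  using vec.subspace_add[OF C d, of b] vec.subspace_diff[OF C _ d, of a] by auto

text \<open>The derivatives at \<open>x\<close> in the direction conjugate to \<open>Z\<close>: of \<open>U\<close> extended with constant components,
  and of \<open>U\<close> extended by the projectors onto \<open>pM\<close>.\<close>

definition ambient_dbar :: "('k, 'a, real^'m) charted \<Rightarrow> ('i, 'a, real^'n) charted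
    \<Rightarrow> ('i \<Rightarrow> 'a \<Rightarrow> real^'n \<Rightarrow> real^'n \<Rightarrow> real^'n) \<Rightarrow> 'k \<Rightarrow> 'i \<Rightarrow> 'a \<Rightarrow> complex^'m \<Rightarrow> complex^'m \<Rightarrow> complex^'n" where
  "ambient_dbar M A \<Gamma> k j x Z U = clinear_ext (\<lambda>V. ambient_deriv M A \<Gamma> k j x (vec_Re Z) (\<lambda>_. V)) U
    - \<i> *s clinear_ext (\<lambda>V. ambient_deriv M A \<Gamma> k j x (vec_Im Z) (\<lambda>_. V)) U"

definition section_dbar :: "('k, 'a, real^'m) charted \<Rightarrow> ('a \<Rightarrow> ('k \<Rightarrow> complex^'m) set) \<Rightarrow> 'k \<Rightarrow> 'a
    \<Rightarrow> complex^'m \<Rightarrow> complex^'m \<Rightarrow> complex^'m" where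
  "section_dbar M pM k x Z U =
    (let S = frechet_derivative (\<lambda>y. projector (comps k (pM (inv_chart M k y)))) (at (coord M k x))
     in S (vec_Re Z) *v U - \<i> *s (S (vec_Im Z) *v U))"

text \<open>\<open>pA\<close> and \<open>pM\<close> are the same subspaces, seen in the ambient
  manifold and in \<open>M\<close>. The locale serves twice: with ambient manifold \<open>N\<close>,
  and with \<open>M\<close> itself and its identity as the immersion.\<close>

locale immersed_section = isotropic_subbundle A c g \<Gamma> Q r
  for A :: "('i, 'a, real^'n) charted" and c g \<Gamma> Q r +
  fixes M :: "('k, 'a, real^'m) charted" and pM :: "'a \<Rightarrow> ('k \<Rightarrow> complex^'m) set"
    and pA :: "'a \<Rightarrow> ('i \<Rightarrow> complex^'n) set"
  assumes manifold_M: "smooth_manifold M" and immersion: "smooth_map M A id"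
    and section_map: "smooth_map M (bundle_charts A Q) (\<lambda>x. (x, pA x))"
    and comps_pA: "\<And>x k j. k \<in> charts_at M x \<Longrightarrow> j \<in> charts_at A x \<Longrightarrow>
        comps j (pA x) = clinear_ext (jac M A id k j x) ` comps k (pM x)"
    and smooth_EM: "\<And>k. k \<in> idx M \<Longrightarrow>
        smooth_on (coord M k ` patch M k) (\<lambda>y. projector (comps k (pM (inv_chart M k y))))"
    and subspace_pM: "\<And>x k. k \<in> charts_at M x \<Longrightarrow> vec.subspace (comps k (pM x))"
begin

lemma section_in_Q: "x \<in> points M \<Longrightarrow> (x, pA x) \<in> Q"
  using section_map by (auto simp: smooth_map_def points_def bundle_charts_def)

lemma bundle_charts_at: "x \<in> points M \<Longrightarrow> charts_at (bundle_charts A Q) (x, pA x) = charts_at A x"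
  using section_in_Q by (auto simp: charts_at_def bundle_charts_def)

lemma section_rep:
  "local_rep M (bundle_charts A Q) (\<lambda>x. (x, pA x)) k j y =
    (local_rep M A id k j y, projector (comps j (pA (inv_chart M k y))))"
  by (simp add: local_rep_def bundle_charts_def)

context
  fixes x k j
  assumes k: "k \<in> charts_at M x" and j: "j \<in> charts_at A x"
begin

lemma x_point_M: "x \<in> points M" using k by (rule charts_atD)

lemma point_at: "isotropic_point A c g \<Gamma> Q r x (pA x) j"
  by unfold_locales (use section_in_Q[OF x_point_M] j in auto)

interpretation pt: isotropic_point A c g \<Gamma> Q r x "pA x" j by (rule point_at)

abbreviation "z\<^sub>0 \<equiv> coord M k x"
abbreviation "pointM y \<equiv> inv_chart M k y"
abbreviation "EA y \<equiv> projector (comps j (pA (pointM y)))"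
abbreviation "EM y \<equiv> projector (comps k (pM (pointM y)))"
abbreviation "rep \<equiv> local_rep M A id k j"
abbreviation "L \<equiv> jac M A id k j x"
abbreviation "SA \<equiv> frechet_derivative EA (at z\<^sub>0)"
abbreviation "SM \<equiv> frechet_derivative EM (at z\<^sub>0)"
abbreviation "hess a \<equiv> \<lambda>V. frechet_derivative (\<lambda>y. frechet_derivative rep (at y) V) (at z\<^sub>0) a"
abbreviation "amb a \<equiv> \<lambda>V. ambient_deriv M A \<Gamma> k j x a (\<lambda>_. V)"

lemma pointM_z0: "pointM z\<^sub>0 = x" by (rule inv_coord[OF manifold_M k])

lemma linear_L: "linear L" using j by (intro jac_linear[OF immersion k]) simp

abbreviation "W \<equiv> rep_domain M (bundle_charts A Q) (\<lambda>x. (x, pA x)) k j"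

lemma neighbourhood:
  shows "open W" "z\<^sub>0 \<in> W" "smooth_on W rep" "smooth_on W EA" "smooth_on W EM"
proof -
  have j': "j \<in> charts_at (bundle_charts A Q) (x, pA x)" using j by (simp add: bundle_charts_at[OF x_point_M])
  note W = rep_domain[OF section_map k j']
  show "open W" "z\<^sub>0 \<in> W" by (fact W)+
  show "smooth_on W rep"
    using smooth_on_bounded_linear[OF W(1) bounded_linear_fst W(4)] by (simp add: section_rep)
  show "smooth_on W EA"
    using smooth_on_bounded_linear[OF W(1) bounded_linear_snd W(4)] by (simp add: section_rep)
  show "smooth_on W EM"
    by (rule smooth_on_subset[OF smooth_EM[OF charts_atD(1)[OF k]] W(3)])
qed

lemma neighbourhood_charts:
  assumes "y \<in> W"
  shows "k \<in> charts_at M (pointM y)" "j \<in> charts_at A (pointM y)" "coord M k (pointM y) = y"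
proof -
  have j': "j \<in> idx (bundle_charts A Q)" using charts_atD(1)[OF j] by (simp add: bundle_charts_def)
  note ch = rep_domain_inv_chart[OF manifold_M charts_atD(1)[OF k] j' assms]
  show "k \<in> charts_at M (pointM y)" "coord M k (pointM y) = y" by (fact ch)+
  show "j \<in> charts_at A (pointM y)" using ch(2) by (simp only: bundle_charts_at[OF charts_atD(3)[OF ch(1)]])
qed

lemma derivatives:
  shows "(rep has_derivative L) (at z\<^sub>0)" "(EA has_derivative SA) (at z\<^sub>0)" "(EM has_derivative SM) (at z\<^sub>0)"
    and "((\<lambda>y. cmat (frechet_derivative rep (at y))) has_derivative (\<lambda>a. cmat (hess a))) (at z\<^sub>0)"
    and "linear (hess a)"
    and "((\<lambda>y. frechet_derivative rep (at y) V) has_derivative (\<lambda>a. hess a V)) (at z\<^sub>0)"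
proof -
  note W = neighbourhood
  show "(rep has_derivative L) (at z\<^sub>0)" using j by (intro jac_has_derivative[OF immersion k]) simp
  show "(EA has_derivative SA) (at z\<^sub>0)" "(EM has_derivative SM) (at z\<^sub>0)"
    using smooth_on_differentiable[OF W(4,2)] smooth_on_differentiable[OF W(5,2)]
    by (simp_all add: frechet_derivative_works)
  have hess: "((\<lambda>y. frechet_derivative rep (at y) V) has_derivative (\<lambda>a. hess a V)) (at z\<^sub>0)" for V
    using smooth_on_differentiable[OF smooth_on_derivative[OF W(3)] W(2)] by (simp add: frechet_derivative_works)
  show "((\<lambda>y. frechet_derivative rep (at y) V) has_derivative (\<lambda>a. hess a V)) (at z\<^sub>0)" by (rule hess)
  from hess show "((\<lambda>y. cmat (frechet_derivative rep (at y))) has_derivative (\<lambda>a. cmat (hess a))) (at z\<^sub>0)"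
    by (intro has_derivative_cmat)
  have lin: "linear (frechet_derivative rep (at y))" if "y \<in> W" for y
    using smooth_on_differentiable[OF W(3) that] by (rule linear_frechet_derivative)
  \<comment> \<open>A derivative is linear in its direction \<open>a\<close>, but linearity in
    \<open>V\<close> has to be inherited from the differentials of \<open>rep\<close> at nearby
    points, through uniqueness of derivatives.\<close>
  show "linear (hess a)"
  proof (rule linearI)
    fix V V' and s :: real
    have "((\<lambda>y. frechet_derivative rep (at y) V + frechet_derivative rep (at y) V') has_derivative
        (\<lambda>a. hess a V + hess a V')) (at z\<^sub>0)"
      by (intro has_derivative_add hess)
    then have "((\<lambda>y. frechet_derivative rep (at y) (V + V')) has_derivative (\<lambda>a. hess a V + hess a V')) (at z\<^sub>0)"
      by (rule has_derivative_transform_within_open[OF _ W(1,2)]) (simp add: linear_add[OF lin])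
    from has_derivative_unique[OF hess this] show "hess a (V + V') = hess a V + hess a V'" by (rule fun_cong)
    have "((\<lambda>y. s *\<^sub>R frechet_derivative rep (at y) V) has_derivative (\<lambda>a. s *\<^sub>R hess a V)) (at z\<^sub>0)"
      by (intro has_derivative_scaleR_right hess)
    then have "((\<lambda>y. frechet_derivative rep (at y) (s *\<^sub>R V)) has_derivative (\<lambda>a. s *\<^sub>R hess a V)) (at z\<^sub>0)"
      by (rule has_derivative_transform_within_open[OF _ W(1,2)]) (simp add: linear_scale[OF lin])
    from has_derivative_unique[OF hess this] show "hess a (s *\<^sub>R V) = s *\<^sub>R hess a V" by (rule fun_cong)
  qed
qed

lemma amb_eq: "amb a V = hess a V + \<Gamma> j x (L a) (L V)"
  by (simp add: ambient_deriv_def cov_deriv_def jac_def)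

lemma linear_amb_left: "linear (\<lambda>a. amb a V)"
proof -
  have "linear (\<lambda>b. \<Gamma> j x b (L V))" using bilinear_conn[OF j] by (simp add: bilinear_def)
  from linear_compose[OF linear_L this] have "linear (\<lambda>a. \<Gamma> j x (L a) (L V))" by (simp add: o_def)
  then show ?thesis unfolding amb_eq by (rule linear_compose_add[OF has_derivative_linear[OF derivatives(6)]])
qed

lemma jac_section: "jac M (bundle_charts A Q) (\<lambda>x. (x, pA x)) k j x a = (L a, SA a)"
proof -
  have "((\<lambda>y. (rep y, EA y)) has_derivative (\<lambda>a. (L a, SA a))) (at z\<^sub>0)"
    by (rule has_derivative_Pair[OF derivatives(1,2)])
  then show ?thesis
    unfolding jac_def section_rep[abs_def] by (simp only: frechet_derivativeI)
qed

text \<open>The section carries a chart segment of \<open>M\<close> through the point to a curve in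
  the bundle with this velocity.\<close>

lemma jac_section_tangent: "(L a, SA a) \<in> bundle_tangent A Q j (x, pA x)"
proof -
  note W = neighbourhood(1,2)
  define \<gamma> where "\<gamma> t = (rep (z\<^sub>0 + t *\<^sub>R a), EA (z\<^sub>0 + t *\<^sub>R a))" for t :: real
  have line': "((\<lambda>t. z\<^sub>0 + t *\<^sub>R a) has_vector_derivative a) (at (0::real))"
    by (auto intro!: derivative_eq_intros)
  have d: "((\<lambda>y. (rep y, EA y)) has_derivative (\<lambda>a. (L a, SA a))) (at (z\<^sub>0 + 0 *\<^sub>R a))"
    using has_derivative_Pair[OF derivatives(1,2)] by simp
  have "(\<gamma> has_vector_derivative (L a, SA a)) (at 0)"
    using vector_derivative_diff_chain_within[OF line' has_derivative_at_withinI[OF d]]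
    by (simp add: o_def \<gamma>_def[abs_def])
  moreover have "\<gamma> 0 = coord (bundle_charts A Q) j (x, pA x)"
    by (simp add: \<gamma>_def local_rep_def pointM_z0 bundle_charts_def)
  moreover have "((\<lambda>t. z\<^sub>0 + t *\<^sub>R a) \<longlongrightarrow> z\<^sub>0) (at (0::real))"
    by (auto intro!: tendsto_eq_intros)
  then have "\<forall>\<^sub>F t in at (0::real). z\<^sub>0 + t *\<^sub>R a \<in> W"
    using W(1,2) by (rule topological_tendstoD)
  then have "\<forall>\<^sub>F t in at 0. \<gamma> t \<in> coord (bundle_charts A Q) j ` patch (bundle_charts A Q) j"
  proof (rule eventually_mono)
    fix t :: real
    let ?x = "pointM (z\<^sub>0 + t *\<^sub>R a)"
    assume "z\<^sub>0 + t *\<^sub>R a \<in> W"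
    then have "k \<in> charts_at M ?x" "j \<in> charts_at A ?x" by (rule neighbourhood_charts)+
    then have "j \<in> charts_at (bundle_charts A Q) (?x, pA ?x)"
      by (simp only: bundle_charts_at[OF charts_atD(3)])
    then have "(?x, pA ?x) \<in> patch (bundle_charts A Q) j" by (rule charts_atD)
    then show "\<gamma> t \<in> coord (bundle_charts A Q) j ` patch (bundle_charts A Q) j"
      by (rule rev_image_eqI) (simp add: \<gamma>_def local_rep_def bundle_charts_def)
  qed
  ultimately show ?thesis unfolding bundle_tangent_def tangent_space_def by blast
qed

text \<open>\<open>U\<close> is extended to the local section \<open>EM y *v U\<close> of
  \<open>pM\<close>. The inclusion turns it into a section of \<open>pA\<close> with covariant
  derivative \<open>amb a U + L (SM a U)\<close>; computed from the velocity \<open>SA a\<close> of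
  the subspaces, that derivative is known modulo \<open>pA\<close>.\<close>

lemma section_derivative:
  assumes U: "U \<in> comps k (pM x)"
  shows "SA a *v clinear_ext L U + clinear_ext (\<Gamma> j x (L a)) (clinear_ext L U)
    - (clinear_ext (amb a) U + clinear_ext L (SM a *v U)) \<in> comps j (pA x)"
proof -
  let ?L = "\<lambda>y. cmat (frechet_derivative rep (at y))"
  note W = neighbourhood(1,2)
  have L0: "?L z\<^sub>0 = cmat L" by (simp add: jac_def)
  have inv: "EA y ** (?L y ** EM y) = ?L y ** EM y" if "y \<in> W" for y
  proof -
    note ch = neighbourhood_charts[OF that]
    have Ly: "jac M A id k j (pointM y) = frechet_derivative rep (at y)" by (simp add: jac_def ch(3))
    have lin: "linear (frechet_derivative rep (at y))"
      using jac_linear[OF immersion ch(1), of j] ch(2) by (simp add: Ly)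
    have subA: "vec.subspace (comps j (pA (pointM y)))"
      using Q_sub section_in_Q[OF charts_atD(3)[OF ch(1)]] ch(2) unfolding isotropic_bundle_def by auto
    have "EA y *v (?L y *v (EM y *v v)) = ?L y *v (EM y *v v)" for v
    proof -
      have "EM y *v v \<in> comps k (pM (pointM y))" by (rule projector_mem[OF subspace_pM[OF ch(1)]])
      then have "?L y *v (EM y *v v) \<in> comps j (pA (pointM y))"
        unfolding comps_pA[OF ch(1,2)] Ly by (simp add: clinear_ext_cmat[OF lin])
      then show ?thesis using projector_mem_iff[OF subA] by blast
    qed
    then show ?thesis by (simp add: matrix_eq matrix_vector_mul_assoc matrix_mul_assoc)
  qed
  have M: "EA z\<^sub>0 ** (cmat L ** SM a + cmat (hess a) ** EM z\<^sub>0) + SA a ** (cmat L ** EM z\<^sub>0)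
      = cmat L ** SM a + cmat (hess a) ** EM z\<^sub>0"
    using invariant_frame_derivative[OF W(1,2) inv derivatives(2,4,3)] by (simp only: L0)
  have EU: "EM z\<^sub>0 *v U = U"
    using U projector_mem_iff[OF subspace_pM[OF k]] by (simp add: pointM_z0)
  have shift: "s - w = - e" if "e + s = w" for e s w :: "complex^'n"
    by (simp add: that[symmetric])
  have "EA z\<^sub>0 *v (cmat L *v (SM a *v U) + cmat (hess a) *v U) + SA a *v (cmat L *v U)
      = cmat L *v (SM a *v U) + cmat (hess a) *v U"
    using arg_cong[OF M, of "\<lambda>X. X *v U"]
    by (simp only: matrix_vector_mult_add_rdistrib matrix_vector_mul_assoc[symmetric] EU)
  then have *: "SA a *v (cmat L *v U) - (cmat L *v (SM a *v U) + cmat (hess a) *v U)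
      = - (EA z\<^sub>0 *v (cmat L *v (SM a *v U) + cmat (hess a) *v U))"
    by (rule shift)
  have amb: "clinear_ext (amb a) U = cmat (hess a) *v U + clinear_ext (\<Gamma> j x (L a)) (clinear_ext L U)"
    by (simp add: amb_eq vec_Complex_eq_iff flip: clinear_ext_cmat[OF derivatives(5)])
  have "SA a *v clinear_ext L U + clinear_ext (\<Gamma> j x (L a)) (clinear_ext L U)
    - (clinear_ext (amb a) U + clinear_ext L (SM a *v U))
    = - (EA z\<^sub>0 *v (cmat L *v (SM a *v U) + cmat (hess a) *v U))"
    unfolding *[symmetric] amb clinear_ext_cmat[OF linear_L] by (simp add: algebra_simps)
  also have "\<dots> \<in> comps j (pA x)"
    using pt.C_facts(1) by (intro vec.subspace_neg) (simp_all add: pointM_z0)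
  finally show ?thesis .
qed

text \<open>For \<open>Z\<close> in \<open>pM\<close>, tangency and the condition on base velocities
  hold automatically for the differential of the section, so only the vertical condition remains. By
  \<open>section_derivative\<close> it concerns derivatives in the direction
  \<open>Re Z - i Im Z\<close>, the conjugate of \<open>Z\<close>.\<close>

lemma section_holomorphic_iff:
  assumes Z: "Z \<in> comps k (pM x)"
  defines "F \<equiv> \<lambda>x. (x, pA x)"
  shows "(jac M (bundle_charts A Q) F k j x (vec_Re Z), jac M (bundle_charts A Q) F k j x (vec_Im Z))
      \<in> minus_i_eigenspace (J_prime A \<Gamma> Q j (F x)) \<longleftrightarrow>
    (\<forall>U\<in>comps k (pM x).
      ambient_dbar M A \<Gamma> k j x Z U + clinear_ext L (section_dbar M pM k x Z U) \<in> clinear_ext L ` comps k (pM x))"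
proof -
  let ?a = "vec_Re Z" and ?b = "vec_Im Z"
  let ?t = "\<lambda>a u. SA a *v u + clinear_ext (\<Gamma> j x (L a)) u"
  let ?s = "\<lambda>a U. clinear_ext (amb a) U + clinear_ext L (SM a *v U)"
  note C = pt.C_facts(1)
  have mem: "vec_Complex (L ?a) (L ?b) \<in> comps j (pA x)"
    unfolding comps_pA[OF k j] using Z by (auto simp: clinear_ext_def)
  have step: "?t ?a (clinear_ext L U) - \<i> *s ?t ?b (clinear_ext L U) \<in> comps j (pA x) \<longleftrightarrow>
      ?s ?a U - \<i> *s ?s ?b U \<in> comps j (pA x)" if U: "U \<in> comps k (pM x)" for U
  proof -
    have "(?t ?a (clinear_ext L U) - ?s ?a U) - \<i> *s (?t ?b (clinear_ext L U) - ?s ?b U) \<in> comps j (pA x)"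
      by (rule vec.subspace_diff[OF C section_derivative[OF U] vec.subspace_scale[OF C section_derivative[OF U]]])
    moreover have "(t - s) - \<i> *s (t' - s') = (t - \<i> *s t') - (s - \<i> *s s')" for t s t' s' :: "complex^'n"
      by (simp add: vec.scale_right_diff_distrib)
    ultimately have d: "(?t ?a (clinear_ext L U) - \<i> *s ?t ?b (clinear_ext L U)) - (?s ?a U - \<i> *s ?s ?b U) \<in> comps j (pA x)"
      by (simp only:)
    show ?thesis by (rule subspace_diff_mem_iff[OF C d])
  qed
  have split: "?s ?a U - \<i> *s ?s ?b U = ambient_dbar M A \<Gamma> k j x Z U + clinear_ext L (section_dbar M pM k x Z U)" for U
    by (simp add: ambient_dbar_def section_dbar_def Let_def clinear_ext_cmat[OF linear_L] vec.scale_right_distrib vec_smult_simps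
        matrix_vector_mult_diff_distrib algebra_simps)
  have image: "(\<forall>u\<in>comps j (pA x). \<Phi> u) \<longleftrightarrow> (\<forall>U\<in>comps k (pM x). \<Phi> (clinear_ext L U))" for \<Phi>
    by (simp add: comps_pA[OF k j])
  have "(jac M (bundle_charts A Q) F k j x ?a, jac M (bundle_charts A Q) F k j x ?b)
      \<in> minus_i_eigenspace (J_prime A \<Gamma> Q j (F x)) \<longleftrightarrow>
      (\<forall>u\<in>comps j (pA x). ?t ?a u - \<i> *s ?t ?b u \<in> comps j (pA x))"
    by (simp only: F_def jac_section pt.J_prime_eigenspace_iff fst_conv snd_conv mem jac_section_tangent simp_thms)
  also have "\<dots> \<longleftrightarrow> (\<forall>U\<in>comps k (pM x). ?s ?a U - \<i> *s ?s ?b U \<in> comps j (pA x))"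
    unfolding image by (rule ball_cong[OF refl]) (rule step)
  finally show ?thesis unfolding split comps_pA[OF k j] .
qed

end

lemma holomorphic_iff:
  assumes eigenspace: "\<And>x k. k \<in> charts_at M x \<Longrightarrow>
      minus_i_eigenspace (acs_of pM k x) = (\<lambda>Z. (vec_Re Z, vec_Im Z)) ` comps k (pM x)"
  shows "holomorphic M (acs_of pM) (bundle_charts A Q) (J_prime A \<Gamma> Q) (\<lambda>x. (x, pA x)) \<longleftrightarrow>
    (\<forall>x\<in>points M. \<forall>k\<in>charts_at M x. \<forall>j\<in>charts_at A x. \<forall>Z\<in>comps k (pM x). \<forall>U\<in>comps k (pM x).
      ambient_dbar M A \<Gamma> k j x Z U + clinear_ext (jac M A id k j x) (section_dbar M pM k x Z U)
        \<in> clinear_ext (jac M A id k j x) ` comps k (pM x))"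
  using section_map
  by (simp add: holomorphic_def eigenspace bundle_charts_at section_holomorphic_iff)

end

section \<open>Orientations\<close>

definition real_parts :: "(complex^'m) set \<Rightarrow> ((real^'m) \<times> (real^'m)) set" where
  "real_parts C = (\<lambda>Z. (vec_Re Z, vec_Im Z)) ` C"

definition structure_of :: "(complex^'m) set \<Rightarrow> real^'m \<Rightarrow> real^'m" where
  "structure_of C = snd (cr_of (real_parts C))"

text \<open>The rows of \<open>complex_frame\<close> expressed by vectors of the eigenspace, where
  \<open>J (Re Z) = Im Z\<close>. In this form the frame depends linearly on its vectors and does
  not mention \<open>J\<close>.\<close>

definition frame_of :: "('m \<Rightarrow> nat) \<Rightarrow> (nat \<Rightarrow> complex^'m) \<Rightarrow> real^'m^'m" where
  "frame_of \<sigma> u = (\<chi> a. if even (\<sigma> a) then vec_Re (u (\<sigma> a div 2)) else vec_Im (u (\<sigma> a div 2)))"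

text \<open>Under these conditions taking real parts is a real linear bijection from
  \<open>C\<close> to \<open>real^'m\<close>, so that \<open>C\<close> is the eigenspace of a
  complex structure on the whole space.\<close>

locale complex_structure_space =
  fixes C :: "(complex^'m) set"
  assumes subspace: "vec.subspace C" and dim: "2 * vec.dim C = CARD('m)"
    and conj_trivial: "\<And>Z. Z \<in> C \<Longrightarrow> vec_cnj Z \<in> C \<Longrightarrow> Z = 0"
begin

abbreviation "J \<equiv> structure_of C"

lemma Re_zero:
  assumes "Z \<in> C" "vec_Re Z = 0"
  shows "Z = 0"
proof (rule conj_trivial[OF assms(1)])
  have "vec_cnj Z = - Z" by (simp add: vec_Complex_eq_iff assms(2))
  then show "vec_cnj Z \<in> C" using vec.subspace_neg[OF subspace assms(1)] by simp
qed

lemma J_Re: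
  assumes Z: "Z \<in> C"
  shows "J (vec_Re Z) = vec_Im Z"
proof -
  have "W = Z" if "W \<in> C" "vec_Re W = vec_Re Z" for W
    using Re_zero[OF vec.subspace_diff[OF subspace that(1) Z]] that(2) by simp
  then show ?thesis
    using Z by (auto simp: structure_of_def cr_of_def real_parts_def intro!: the_equality)
qed

text \<open>Real coefficients of a frame turned into complex ones: as
  \<open>Re (- i c Z) = c Im Z\<close>, the real part of the result is the combination of the frame
  rows with coefficients \<open>c\<close>.\<close>

definition combine :: "('m \<Rightarrow> nat) \<Rightarrow> (nat \<Rightarrow> complex^'m) \<Rightarrow> real^'m \<Rightarrow> complex^'m" where
  "combine \<sigma> u c = (\<Sum>a\<in>UNIV.
    (if even (\<sigma> a) then complex_of_real (c $ a) else - \<i> * complex_of_real (c $ a)) *s u (\<sigma> a div 2))"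

lemma combine_mem: "(\<And>j. u j \<in> C) \<Longrightarrow> combine \<sigma> u c \<in> C"
  unfolding combine_def by (intro vec.subspace_sum[OF subspace] vec.subspace_scale[OF subspace])

lemma Re_combine: "vec_Re (combine \<sigma> u c) = transpose (frame_of \<sigma> u) *v c"
  by (simp add: combine_def vec_Re_def vec_eq_iff matrix_vector_mult_def transpose_def frame_of_def vec_Im_def
      if_distrib mult.commute cong: if_cong del: transpose_matrix_vector)
     (intro allI sum.cong refl, simp)

text \<open>A complex basis of \<open>C\<close> is used. A real relation among the rows gives an
  element of \<open>C\<close> with zero real part, hence zero; independence kills the grouped
  complex coefficients, whose real and imaginary parts are, up to sign, the coefficients of the
  relation.\<close>

lemma frame_exists:
  assumes \<sigma>: "bij_betw \<sigma> (UNIV :: 'm set) {..<CARD('m)}"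
  shows "\<exists>u. (\<forall>j. u j \<in> C) \<and> det (frame_of \<sigma> u) \<noteq> 0"
proof -
  obtain B where B: "B \<subseteq> C" "vec.independent B" "card B = vec.dim C"
    using vec.basis_exists[of C] by metis
  have finB: "finite B" using vec.finiteI_independent[OF B(2)] .
  obtain b where b: "bij_betw b {..<vec.dim C} B"
    using ex_bij_betw_nat_finite[OF finB] B(3) by (auto simp: atLeast0LessThan)
  \<comment> \<open>Padding by 0 keeps every \<open>u j\<close> in \<open>C\<close>; the frame never
    reads an index beyond the dimension, as \<open>less\<close> shows below.\<close>
  define u where "u j = (if j < vec.dim C then b j else 0)" for j
  have uC: "u j \<in> C" for j
    using b B(1) vec.subspace_0[OF subspace] by (auto simp: u_def bij_betw_def)
  define s where "s c a = (if even (\<sigma> a) then complex_of_real (c $ a) else - \<i> * complex_of_real (c $ a))"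
    for c :: "real^'m" and a
  have "invertible (transpose (frame_of \<sigma> u))"
  proof (rule invertible_if_inj)
    fix c assume "transpose (frame_of \<sigma> u) *v c = 0"
    define Z where "Z = combine \<sigma> u c"
    have "vec_Re Z = 0" using \<open>transpose (frame_of \<sigma> u) *v c = 0\<close> by (simp only: Z_def Re_combine)
    then have Z0: "Z = 0" using combine_mem[of u \<sigma> c] uC by (intro Re_zero) (simp_all add: Z_def)
    \<comment> \<open>The two rows numbered \<open>2 j\<close> and \<open>2 j + 1\<close> together
      contribute one complex coefficient of the basis vector \<open>b j\<close>.\<close>
    define w where "w j = (\<Sum>a\<in>{a. \<sigma> a div 2 = j}. s c a)" for j
    have less: "\<sigma> a div 2 < vec.dim C" for a
    proof -
      have "\<sigma> a < vec.dim C * 2" using bij_betwE[OF \<sigma>] dim by (simp add: mult.commute)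
      then show ?thesis by (rule less_mult_imp_div_less)
    qed
    have "Z = (\<Sum>j<vec.dim C. \<Sum>a\<in>{a\<in>UNIV. \<sigma> a div 2 = j}. s c a *s u (\<sigma> a div 2))"
      unfolding Z_def combine_def s_def[symmetric] using less by (intro sum.group[symmetric]) auto
    also have "\<dots> = (\<Sum>j<vec.dim C. w j *s b j)"
      unfolding w_def vec.scale_sum_left using less by (intro sum.cong) (auto simp: u_def)
    also have "\<dots> = (\<Sum>v\<in>B. w (the_inv_into {..<vec.dim C} b v) *s v)"
    proof -
      have "(\<Sum>j<vec.dim C. w (the_inv_into {..<vec.dim C} b (b j)) *s b j)
          = (\<Sum>v\<in>B. w (the_inv_into {..<vec.dim C} b v) *s v)"
        by (rule sum.reindex_bij_betw[OF b])
      moreover have "the_inv_into {..<vec.dim C} b (b j) = j" if "j \<in> {..<vec.dim C}" for j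
        using b that by (intro the_inv_into_f_f) (auto simp: bij_betw_def)
      ultimately show ?thesis by simp
    qed
    finally have "(\<Sum>v\<in>B. w (the_inv_into {..<vec.dim C} b v) *s v) = 0" using Z0 by simp
    from vec.independentD[OF B(2) finB subset_refl this]
    have w_B: "\<forall>v\<in>B. w (the_inv_into {..<vec.dim C} b v) = 0" by (rule ballI)
    have w0: "w j = 0" if "j < vec.dim C" for j
    proof -
      have "b j \<in> B" "the_inv_into {..<vec.dim C} b (b j) = j"
        using b that by (auto simp: bij_betw_def the_inv_into_f_f)
      then show ?thesis using w_B by force
    qed
    have inj: "a = a'" if "\<sigma> a = \<sigma> a'" for a a' using \<sigma> that by (auto simp: bij_betw_def inj_on_def)
    show "c = 0"
      unfolding vec_eq_iff zero_index
    proof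
      fix a
      have w: "w (\<sigma> a div 2) = 0" by (rule w0[OF less])
      show "c $ a = 0"
      proof (cases "even (\<sigma> a)")
        case True
        have "Re (w (\<sigma> a div 2)) = (\<Sum>a'\<in>{a'. \<sigma> a' div 2 = \<sigma> a div 2}. if a' = a then c $ a else 0)"
          unfolding w_def Re_sum
        proof (rule sum.cong[OF refl])
          fix a' assume "a' \<in> {a'. \<sigma> a' div 2 = \<sigma> a div 2}"
          then have "even (\<sigma> a') \<longleftrightarrow> a' = a" using True inj[of a' a] by (auto elim!: evenE)
          then show "Re (s c a') = (if a' = a then c $ a else 0)" by (auto simp: s_def)
        qed
        then show ?thesis using w by simp
      next
        case False
        have "Im (w (\<sigma> a div 2)) = (\<Sum>a'\<in>{a'. \<sigma> a' div 2 = \<sigma> a div 2}. if a' = a then - c $ a else 0)"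
          unfolding w_def Im_sum
        proof (rule sum.cong[OF refl])
          fix a' assume "a' \<in> {a'. \<sigma> a' div 2 = \<sigma> a div 2}"
          then have "odd (\<sigma> a') \<longleftrightarrow> a' = a" using False inj[of a' a] by (auto elim!: oddE)
          then show "Im (s c a') = (if a' = a then - c $ a else 0)" by (auto simp: s_def)
        qed
        then show ?thesis using w by simp
      qed
    qed
  qed
  then have "det (frame_of \<sigma> u) \<noteq> 0" by (simp add: invertible_det_nz)
  then show ?thesis using uC by blast
qed

lemma exists_numbering: "\<exists>\<sigma>. bij_betw \<sigma> (UNIV :: 'm set) {..<CARD('m)}"
  using ex_bij_betw_finite_nat[of "UNIV :: 'm set"] by (auto simp: atLeast0LessThan)

lemma Re_surj: "\<exists>Z\<in>C. vec_Re Z = e"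
proof -
  obtain \<sigma> where \<sigma>: "bij_betw \<sigma> (UNIV :: 'm set) {..<CARD('m)}" using exists_numbering by blast
  obtain u where u: "\<And>j. u j \<in> C" "det (frame_of \<sigma> u) \<noteq> 0" using frame_exists[OF \<sigma>] by blast
  have "invertible (transpose (frame_of \<sigma> u))" using u(2) by (simp add: invertible_det_nz)
  define c where "c = matrix_inv (transpose (frame_of \<sigma> u)) *v e"
  have c: "transpose (frame_of \<sigma> u) *v c = e"
    unfolding c_def matrix_vector_mul_assoc matrix_inv_works(1)[OF \<open>invertible _\<close>] by simp
  have "vec_Re (combine \<sigma> u c) = e" by (simp only: Re_combine c)
  then show ?thesis using combine_mem[of u \<sigma> c] u(1) by blast
qed

lemma complex_frame_eq: "(\<And>j. u j \<in> C) \<Longrightarrow> complex_frame \<sigma> J (\<lambda>j. vec_Re (u j)) = frame_of \<sigma> u"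
  by (simp add: complex_frame_def frame_of_def vec_eq_iff J_Re)

lemma complex_frame_frame_of: "\<exists>u. (\<forall>j. u j \<in> C) \<and> complex_frame \<sigma> J e = frame_of \<sigma> u"
proof -
  have "\<forall>j. \<exists>Z. Z \<in> C \<and> vec_Re Z = e j" using Re_surj by blast
  then obtain u where u: "\<And>j. u j \<in> C" "\<And>j. vec_Re (u j) = e j" by metis
  from complex_frame_eq[OF u(1), of \<sigma>] show ?thesis using u by auto
qed

end

text \<open>This eliminates the complex structures, which are defined through \<open>THE\<close>.
  What remains are determinants of frames taken from the subspaces, which behave well under linear
  maps and limits.\<close>

lemma same_orientation_iff:
  fixes C C' :: "(complex^'m) set"
  assumes "complex_structure_space C" "complex_structure_space C'"
  shows "same_orientation (structure_of C) (structure_of C') \<longleftrightarrow>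
    (\<exists>\<sigma> u u'. bij_betw \<sigma> (UNIV :: 'm set) {..<CARD('m)} \<and> (\<forall>j. u j \<in> C) \<and> (\<forall>j. u' j \<in> C') \<and>
      det (frame_of \<sigma> u) * det (frame_of \<sigma> u') > 0)" (is "?L \<longleftrightarrow> ?R")
proof -
  interpret c: complex_structure_space C by fact
  interpret c': complex_structure_space C' by fact
  show ?thesis
  proof
    assume ?L
    then obtain \<sigma> e e' where *: "bij_betw \<sigma> UNIV {..<CARD('m)}"
      "0 < det (complex_frame \<sigma> (structure_of C) e) * det (complex_frame \<sigma> (structure_of C') e')"
      unfolding same_orientation_def by blast
    obtain u u' where "\<forall>j. u j \<in> C" "complex_frame \<sigma> (structure_of C) e = frame_of \<sigma> u"
      "\<forall>j. u' j \<in> C'" "complex_frame \<sigma> (structure_of C') e' = frame_of \<sigma> u'"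
      using c.complex_frame_frame_of c'.complex_frame_frame_of by metis
    then show ?R using * by auto
  next
    assume ?R
    then obtain \<sigma> u u' where *: "bij_betw \<sigma> UNIV {..<CARD('m)}" "\<And>j. u j \<in> C" "\<And>j. u' j \<in> C'"
      "det (frame_of \<sigma> u) * det (frame_of \<sigma> u') > 0" by blast
    have "0 < det (complex_frame \<sigma> (structure_of C) (\<lambda>j. vec_Re (u j)))
        * det (complex_frame \<sigma> (structure_of C') (\<lambda>j. vec_Re (u' j)))"
      using *(4) by (simp only: c.complex_frame_eq[OF *(2)] c'.complex_frame_eq[OF *(3)])
    then show ?L unfolding same_orientation_def using *(1) by blast
  qed
qed

lemma same_orientation_refl:
  assumes "complex_structure_space C"
  shows "same_orientation (structure_of C) (structure_of C)"
proof -
  interpret complex_structure_space C by fact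
  obtain \<sigma> where \<sigma>: "bij_betw \<sigma> (UNIV :: 'a set) {..<CARD('a)}" using exists_numbering by blast
  obtain u where u: "\<And>j. u j \<in> C" "det (frame_of \<sigma> u) \<noteq> 0" using frame_exists[OF \<sigma>] by blast
  have "det (frame_of \<sigma> u) * det (frame_of \<sigma> u) > 0"
    using u(2) by (simp add: zero_less_mult_iff linorder_neq_iff) argo
  then show ?thesis unfolding same_orientation_iff[OF assms assms] using \<sigma> u(1) by blast
qed

lemma frame_of_clinear_ext: "frame_of \<sigma> (\<lambda>j. clinear_ext T (u j)) = (\<chi> a. T (frame_of \<sigma> u $ a))"
  by (simp add: frame_of_def vec_eq_iff)

text \<open>A real linear map multiplies both frame determinants by its own determinant, whose
  square is positive.\<close>

lemma same_orientation_image: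
  fixes C C' :: "(complex^'m) set" and T :: "real^'m \<Rightarrow> real^'m"
  assumes T: "linear T" "inj T"
    and C: "complex_structure_space C" "complex_structure_space C'"
    and TC: "complex_structure_space (clinear_ext T ` C)" "complex_structure_space (clinear_ext T ` C')"
    and same: "same_orientation (structure_of C) (structure_of C')"
  shows "same_orientation (structure_of (clinear_ext T ` C)) (structure_of (clinear_ext T ` C'))"
proof -
  obtain \<sigma> u u' where *: "bij_betw \<sigma> (UNIV :: 'm set) {..<CARD('m)}" "\<And>j. u j \<in> C" "\<And>j. u' j \<in> C'"
    "det (frame_of \<sigma> u) * det (frame_of \<sigma> u') > 0"
    using same unfolding same_orientation_iff[OF C] by blast
  have det: "det (frame_of \<sigma> (\<lambda>j. clinear_ext T (v j))) = det (frame_of \<sigma> v) * det (matrix T)" for v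
  proof -
    have "(\<chi> a. T (F $ a)) = F ** transpose (matrix T)" for F :: "real^'m^'m"
      by (simp add: vec_eq_iff matrix_matrix_mult_def transpose_def matrix_def linear_component_sum[OF T(1), of "F $ _"] mult.commute)
    then show ?thesis by (simp add: frame_of_clinear_ext det_mul det_transpose)
  qed
  have "det (matrix T) \<noteq> 0"
    using T by (simp add: det_nz_iff_inj)
  then have "det (matrix T) * det (matrix T) > 0" by (metis not_real_square_gt_zero)
  then have "det (frame_of \<sigma> (\<lambda>j. clinear_ext T (u j))) * det (frame_of \<sigma> (\<lambda>j. clinear_ext T (u' j))) > 0"
    unfolding det using *(4) by (metis mult_pos_pos mult.assoc mult.left_commute)
  then show ?thesis
    unfolding same_orientation_iff[OF TC] using *(1-3)
    by (intro exI[of _ \<sigma>] exI[of _ "\<lambda>j. clinear_ext T (u j)"] exI[of _ "\<lambda>j. clinear_ext T (u' j)"]) simp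
qed

lemma tendsto_det_frame:
  assumes "\<And>j. ((\<lambda>t. u t j) \<longlongrightarrow> v j) F"
  shows "((\<lambda>t. det (frame_of \<sigma> (u t))) \<longlongrightarrow> det (frame_of \<sigma> v)) F"
proof (rule tendsto_det)
  fix a b
  have "((\<lambda>t. u t (\<sigma> a div 2) $ b) \<longlongrightarrow> v (\<sigma> a div 2) $ b) F"
    by (intro tendsto_vec_nth assms)
  then have "((\<lambda>t. Re (u t (\<sigma> a div 2) $ b)) \<longlongrightarrow> Re (v (\<sigma> a div 2) $ b)) F"
    "((\<lambda>t. Im (u t (\<sigma> a div 2) $ b)) \<longlongrightarrow> Im (v (\<sigma> a div 2) $ b)) F"
    by (rule tendsto_Re, rule tendsto_Im)
  then show "((\<lambda>t. frame_of \<sigma> (u t) $ a $ b) \<longlongrightarrow> frame_of \<sigma> v $ a $ b) F"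
    by (simp add: frame_of_def vec_Re_def vec_Im_def)
qed

text \<open>Applying \<open>E t\<close> and \<open>B t\<close> to two fixed frames gives frames of
  the nearby subspaces which converge to the original ones, so the product of determinants stays
  positive. The subspaces are quantified inside the filter, so that one neighbourhood serves all of
  them.\<close>

lemma same_orientation_eventually:
  fixes C C' :: "(complex^'m) set" and E B :: "'t \<Rightarrow> complex^'m^'m"
  assumes C: "complex_structure_space C" "complex_structure_space C'"
    and same: "same_orientation (structure_of C) (structure_of C')"
    and E: "(E \<longlongrightarrow> E\<^sub>0) F" "\<And>Z. Z \<in> C \<Longrightarrow> E\<^sub>0 *v Z = Z" and B: "(B \<longlongrightarrow> mat 1) F"
  shows "\<forall>\<^sub>F t in F. \<forall>D D'. complex_structure_space D \<longrightarrow> complex_structure_space D' \<longrightarrow>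
    (\<forall>Z. E t *v Z \<in> D) \<longrightarrow> D' = (*v) (B t) ` C' \<longrightarrow>
    same_orientation (structure_of D) (structure_of D')"
proof -
  obtain \<sigma> u u' where *: "bij_betw \<sigma> (UNIV :: 'm set) {..<CARD('m)}" "\<And>j. u j \<in> C" "\<And>j. u' j \<in> C'"
    "det (frame_of \<sigma> u) * det (frame_of \<sigma> u') > 0"
    using same unfolding same_orientation_iff[OF C] by blast
  note lim = bounded_bilinear.tendsto[OF bounded_bilinear_matrix_vector_mult _ tendsto_const]
  have "((\<lambda>t. E t *v u j) \<longlongrightarrow> u j) F" "((\<lambda>t. B t *v u' j) \<longlongrightarrow> u' j) F" for j
    using lim[OF E(1), of "u j"] lim[OF B, of "u' j"] E(2)[OF *(2)] by simp_all
  then have "((\<lambda>t. det (frame_of \<sigma> (\<lambda>j. E t *v u j)) * det (frame_of \<sigma> (\<lambda>j. B t *v u' j))) \<longlongrightarrow>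
      det (frame_of \<sigma> u) * det (frame_of \<sigma> u')) F"
    by (intro tendsto_mult tendsto_det_frame)
  from order_tendstoD(1)[OF this *(4)] show ?thesis
  proof eventually_elim
    case (elim t)
    show ?case
    proof (intro allI impI)
      fix D D'
      assume D: "complex_structure_space D" "complex_structure_space D'" "\<forall>Z. E t *v Z \<in> D" "D' = (*v) (B t) ` C'"
      show "same_orientation (structure_of D) (structure_of D')"
        unfolding same_orientation_iff[OF D(1,2)] using *(1,3) D(3,4) elim
        by (intro exI[of _ \<sigma>] exI[of _ "\<lambda>j. E t *v u j"] exI[of _ "\<lambda>j. B t *v u' j"]) simp
    qed
  qed
qed

section \<open>The induced Weyl structure\<close>

lemma (in complex_structure_space) minus_i_eigenspace_real_parts:
  "minus_i_eigenspace (cr_of (real_parts C)) = real_parts C"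
proof (rule minus_i_eigenspace_cr_of)
  have mem: "(a, b) \<in> real_parts C \<longleftrightarrow> vec_Complex a b \<in> C" for a b
    unfolding real_parts_def
  proof
    show "(a, b) \<in> (\<lambda>Z. (vec_Re Z, vec_Im Z)) ` C" if "vec_Complex a b \<in> C"
      using that by (rule rev_image_eqI) simp
  qed auto
  have lin: "vec_Complex (a + a') (b + b') = vec_Complex a b + vec_Complex a' b'"
    "vec_Complex (s *\<^sub>R a) (s *\<^sub>R b) = complex_of_real s *s vec_Complex a b" for a b a' b' :: "real^'m" and s
    by (simp_all add: vec_Complex_def vec_eq_iff complex_eq_iff)
  show "Real_Vector_Spaces.subspace (real_parts C)"
  proof (rule subspaceI)
    show "0 \<in> real_parts C" using vec.subspace_0[OF subspace] by (simp add: zero_prod_def mem)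
    show "x + y \<in> real_parts C" if "x \<in> real_parts C" "y \<in> real_parts C" for x y
      using that vec.subspace_add[OF subspace] by (cases x; cases y) (simp add: mem lin)
    show "s *\<^sub>R x \<in> real_parts C" if "x \<in> real_parts C" for s x
      using that vec.subspace_scale[OF subspace] by (cases x) (simp add: mem lin)
  qed
  show "(- b, a) \<in> real_parts C" if "(a, b) \<in> real_parts C" for a b
  proof -
    have "vec_Complex (- b) a = \<i> *s vec_Complex a b" by (simp add: vec_Complex_eq_iff)
    then show ?thesis using that vec.subspace_scale[OF subspace] by (simp add: mem)
  qed
  show "a = 0 \<and> b = 0" if "(a, b) \<in> real_parts C" "(a, - b) \<in> real_parts C" for a b
  proof -
    have "vec_cnj (vec_Complex a b) = vec_Complex a (- b)" by (simp add: vec_Complex_eq_iff)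
    then have "vec_Complex a b = 0" using that conj_trivial[of "vec_Complex a b"] by (simp add: mem)
    then show ?thesis by (simp add: vec_Complex_eq_iff)
  qed
qed

lemma bilinear_component_expand:
  fixes b :: "real^'n \<Rightarrow> real^'n \<Rightarrow> real"
  assumes "bilinear b"
  shows "b x y = (\<Sum>c\<in>UNIV. \<Sum>d\<in>UNIV. (x $ c * y $ d) * b (axis c 1) (axis d 1))"
  using bilinear_component_sum[OF assms, of x y] by (simp add: mult_ac)

text \<open>Expanded in components, this is the product rule for real functions.\<close>

lemma has_derivative_bilinear_family:
  fixes b :: "'e::real_normed_vector \<Rightarrow> real^'n \<Rightarrow> real^'n \<Rightarrow> real"
  assumes W: "open W" "y \<in> W" and bil: "\<And>z. z \<in> W \<Longrightarrow> bilinear (b z)"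
    and b: "\<And>U V. ((\<lambda>z. b z U V) has_derivative (\<lambda>s. db s U V)) (at y)"
    and u: "(u has_derivative u') (at y)" and v: "(v has_derivative v') (at y)"
  shows "((\<lambda>z. b z (u z) (v z)) has_derivative
    (\<lambda>s. db s (u y) (v y) + b y (u' s) (v y) + b y (u y) (v' s))) (at y)"
proof -
  have comp: "((\<lambda>z. f z $ a) has_derivative (\<lambda>s. f' s $ a)) (at y)"
    if "(f has_derivative f') (at y)" for f :: "'e \<Rightarrow> real^'n" and f' a
    by (rule bounded_linear.has_derivative[OF bounded_linear_vec_nth that])
  have main: "((\<lambda>z. b z (f z) (h z)) has_derivative (\<lambda>s. \<Sum>c\<in>UNIV. \<Sum>d\<in>UNIV.
      (f y $ c * h y $ d) * db s (axis c 1) (axis d 1) + (f y $ c * h' s $ d + f' s $ c * h y $ d) * b y (axis c 1) (axis d 1))) (at y)"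
    if f: "(f has_derivative f') (at y)" and h: "(h has_derivative h') (at y)" for f h f' h'
  proof -
    have "((\<lambda>z. \<Sum>c\<in>UNIV. \<Sum>d\<in>UNIV. (f z $ c * h z $ d) * b z (axis c 1) (axis d 1)) has_derivative
      (\<lambda>s. \<Sum>c\<in>UNIV. \<Sum>d\<in>UNIV.
      (f y $ c * h y $ d) * db s (axis c 1) (axis d 1) + (f y $ c * h' s $ d + f' s $ c * h y $ d) * b y (axis c 1) (axis d 1))) (at y)"
      by (intro has_derivative_sum has_derivative_mult comp f h b)
    then show ?thesis
      by (rule has_derivative_transform_within_open[OF _ W])
         (simp add: bilinear_component_expand[OF bil])
  qed
  \<comment> \<open>The bilinear expansion of \<open>db\<close> comes from uniqueness of
    derivatives, by applying \<open>main\<close> to constant vector fields.\<close>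
  have db: "db s U V = (\<Sum>c\<in>UNIV. \<Sum>d\<in>UNIV. (U $ c * V $ d) * db s (axis c 1) (axis d 1))" for s U V
  proof -
    have "(\<lambda>s. db s U V) = (\<lambda>s. \<Sum>c\<in>UNIV. \<Sum>d\<in>UNIV. (U $ c * V $ d) * db s (axis c 1) (axis d 1)
        + (U $ c * (0 :: real^'n) $ d + (0 :: real^'n) $ c * V $ d) * b y (axis c 1) (axis d 1))"
      by (rule has_derivative_unique[OF b main[OF has_derivative_const has_derivative_const]])
    from fun_cong[OF this, of s] show ?thesis by simp
  qed
  show ?thesis
    using main[OF u v]
    unfolding db[of _ "u y" "v y"] bilinear_component_expand[OF bil[OF W(2)], of "u' _"]
      bilinear_component_expand[OF bil[OF W(2)], of _ "v' _"]
    by (simp add: sum.distrib algebra_simps)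
qed

locale weyl_section =
  fixes N :: "('i, 'a, real^'n) charted"
    and cN :: "('i \<Rightarrow> 'a \<Rightarrow> real^'n \<Rightarrow> real^'n \<Rightarrow> real) set"
    and DN :: "'i \<Rightarrow> 'a \<Rightarrow> real^'n \<Rightarrow> real^'n \<Rightarrow> real^'n"
    and M :: "('k, 'a, real^'m) charted"
    and DM :: "'k \<Rightarrow> 'a \<Rightarrow> real^'m \<Rightarrow> real^'m \<Rightarrow> real^'m"
    and r :: nat
    and p :: "'a \<Rightarrow> ('i \<Rightarrow> complex^'n) set"
  assumes weyl: "weyl_space N cN DN"
    and sub: "submanifold M N"
    and dim: "CARD('m) = 2 * r"
    and induced: "induced_connection M N cN DN DM"
    and section_p: "smooth_map M (bundle_charts N (isotropic_bundle N cN r)) (\<lambda>x. (x, p x))"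
    and tangent_p: "\<And>x. x \<in> points M \<Longrightarrow> p x \<subseteq> Range (inclusion_differential M N x)"
begin

definition "cM = restricted_conformal M N cN"
definition "pM x = (inclusion_differential M N x)\<inverse> `` p x"
definition "QM = positive_isotropic_bundle M cM pM"
definition "g = (SOME g. riemannian_metric N g \<and> cN = conformal_class N g)"
text \<open>The restriction of \<open>g\<close> to \<open>M\<close>. An arbitrary chart of
  \<open>N\<close> is chosen at each point because the result may depend only on charts of
  \<open>M\<close>; \<open>gM_eq\<close> then allows any chart of \<open>N\<close>.\<close>

definition "gM k x X Y = g (SOME i. i \<in> charts_at N x) x
    (jac M N id k (SOME i. i \<in> charts_at N x) x X) (jac M N id k (SOME i. i \<in> charts_at N x) x Y)"

lemma manifold_N: "smooth_manifold N" and manifold_M: "smooth_manifold M"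
  and immersion: "smooth_map M N id"
  and inj_jac: "k \<in> charts_at M x \<Longrightarrow> i \<in> charts_at N x \<Longrightarrow> inj (jac M N id k i x)"
proof -
  show "smooth_manifold N" using weyl unfolding weyl_space_def by (rule conjunct1)
  show "smooth_manifold M" "smooth_map M N id" using sub unfolding submanifold_def by simp_all
  show "inj (jac M N id k i x)" if "k \<in> charts_at M x" "i \<in> charts_at N x"
    using sub[unfolded submanifold_def, THEN conjunct2, THEN conjunct2, rule_format, OF charts_atD(3)[OF that(1)] that] .
qed

lemma points_subset: "x \<in> points M \<Longrightarrow> x \<in> points N"
  using immersion unfolding smooth_map_def by auto

lemma chart_N_exists: "x \<in> points M \<Longrightarrow> \<exists>i. i \<in> charts_at N x"
  using points_charts_at[OF points_subset] by blast

lemma g: "riemannian_metric N g" "cN = conformal_class N g"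
proof -
  have "\<exists>g. riemannian_metric N g \<and> cN = conformal_class N g"
    using weyl by (simp add: weyl_space_def conformal_structure_def)
  from someI_ex[OF this] show "riemannian_metric N g" "cN = conformal_class N g"
    by (simp_all only: g_def)
qed

lemma g_in: "g \<in> cN"
proof (rule subsetD[OF equalityD2[OF g(2)]])
  show "g \<in> conformal_class N g"
    unfolding conformal_class_def by (intro CollectI conjI g(1) exI[of _ "\<lambda>_. 1"]) simp
qed

lemma conformal_N:
  assumes "h \<in> cN" "x \<in> points N"
  shows "\<exists>\<rho>. \<forall>i\<in>charts_at N x. \<forall>X Y. h i x X Y = \<rho> * g i x X Y"
  using subsetD[OF equalityD1[OF g(2)] assms(1)] assms(2) unfolding conformal_class_def by blast

lemma weyl_N:
  assumes "i \<in> charts_at N x"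
  shows "\<exists>\<alpha>. \<forall>Y Z. frechet_derivative (\<lambda>y. g i (inv_chart N i y) Y Z) (at (coord N i x)) X
          - g i x (DN i x X Y) Z - g i x Y (DN i x X Z) = \<alpha> * g i x Y Z"
proof -
  have "preserves_conformal N cN DN" using weyl by (simp add: weyl_space_def)
  then obtain \<alpha> where "\<forall>x\<in>points N. \<forall>i\<in>charts_at N x. \<forall>X Y Z.
        frechet_derivative (\<lambda>y. g i (inv_chart N i y) Y Z) (at (coord N i x)) X
          - g i x (DN i x X Y) Z - g i x Y (DN i x X Z) = \<alpha> i x X * g i x Y Z"
    using g_in unfolding preserves_conformal_def by blast
  then show ?thesis using assms charts_atD(3)[OF assms] by blast
qed

lemma connection_bilinear:
  assumes "connection A \<Gamma>" "i \<in> charts_at A x"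
  shows "bilinear (\<Gamma> i x)"
  using assms(1)[unfolded connection_def, THEN conjunct2, THEN bspec, OF charts_atD(3)[OF assms(2)], THEN bspec, OF assms(2)]
  by simp

sublocale N: isotropic_subbundle N cN g DN "isotropic_bundle N cN r" r
proof
  show "bilinear (DN i x)" if "i \<in> charts_at N x" for x i
    using weyl that by (intro connection_bilinear[of N]) (simp_all add: weyl_space_def)
qed (use manifold_N g(1) g_in conformal_N weyl_N in simp_all)

lemma jac_linear_M: "k \<in> charts_at M x \<Longrightarrow> i \<in> charts_at N x \<Longrightarrow> linear (jac M N id k i x)"
  by (rule jac_linear[OF immersion]) simp_all

lemma gM_eq:
  assumes k: "k \<in> charts_at M x" and i: "i \<in> charts_at N x"
  shows "gM k x X Y = g i x (jac M N id k i x X) (jac M N id k i x Y)"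
proof -
  let ?i = "SOME i. i \<in> charts_at N x"
  have i': "?i \<in> charts_at N x" using i by (rule someI)
  have "jac M N id k ?i x = jac N N id i ?i x \<circ> jac M N id k i x"
    using i i' by (intro jac_compose[OF manifold_M manifold_N immersion smooth_manifold_smooth_id[OF manifold_N] k]) simp_all
  then show ?thesis
    unfolding gM_def using riemannian_metricD(4)[OF g(1) i i', symmetric] by simp
qed

abbreviation "rdom k i \<equiv> rep_domain M N id k i"

lemma rdom:
  assumes k: "k \<in> charts_at M x" and i: "i \<in> charts_at N x"
  shows "open (rdom k i)" "coord M k x \<in> rdom k i" "smooth_on (rdom k i) (local_rep M N id k i)"
  using rep_domain[OF immersion k, of i] i by simp_all

lemma rdom_inv_chart:
  assumes k: "k \<in> idx M" and i: "i \<in> idx N" and y: "y \<in> rdom k i"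
  shows "k \<in> charts_at M (inv_chart M k y)" "i \<in> charts_at N (inv_chart M k y)"
    "inv_chart N i (local_rep M N id k i y) = inv_chart M k y"
    "jac M N id k i (inv_chart M k y) = frechet_derivative (local_rep M N id k i) (at y)"
proof -
  note ch = rep_domain_inv_chart[OF manifold_M k i y, unfolded id_apply]
  show "k \<in> charts_at M (inv_chart M k y)" "i \<in> charts_at N (inv_chart M k y)" by (fact ch)+
  show "inv_chart N i (local_rep M N id k i y) = inv_chart M k y"
    by (simp add: local_rep_def inv_coord[OF manifold_N ch(2)])
  show "jac M N id k i (inv_chart M k y) = frechet_derivative (local_rep M N id k i) (at y)"
    by (simp add: jac_def ch(3))
qed

lemma metric_gM: "riemannian_metric M gM"
  unfolding riemannian_metric_def
proof (intro conjI ballI allI impI)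
  fix x k assume "x \<in> points M" and k: "k \<in> charts_at M x"
  obtain i where i: "i \<in> charts_at N x"
    using chart_N_exists[OF \<open>x \<in> points M\<close>] by blast
  note eq = gM_eq[OF k i] and gD = riemannian_metricD[OF g(1) i] and lin = jac_linear_M[OF k i]
  have gb: "linear (\<lambda>X. g i x X Y)" "linear (g i x Y)" for Y
    using gD(1) by (simp_all add: bilinear_def)
  show "bilinear (gM k x)"
    unfolding bilinear_def eq
    using linear_compose[OF lin gb(1)] linear_compose[OF lin gb(2)] by (simp add: o_def)
  show "gM k x X Y = gM k x Y X" for X Y unfolding eq by (rule gD(2))
  show "gM k x X X > 0" if "X \<noteq> 0" for X
    unfolding eq
  proof (rule gD(3))
    show "jac M N id k i x X \<noteq> 0"
      using that inj_jac[OF k i] linear_0[OF lin] by (metis injD)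
  qed
  fix k' X Y assume k': "k' \<in> charts_at M x"
  have "jac M N id k i x = jac M N id k' i x \<circ> jac M M id k k' x"
    using k k' i by (intro jac_compose[OF manifold_M manifold_M smooth_manifold_smooth_id[OF manifold_M] immersion]) simp_all
  then show "gM k x X Y = gM k' x (jac M M id k k' x X) (jac M M id k k' x Y)"
    unfolding gM_eq[OF k' i] eq by simp
next
  fix k X Y assume k: "k \<in> idx M"
  show "smooth_on (coord M k ` patch M k) (\<lambda>y. gM k (inv_chart M k y) X Y)"
  \<comment> \<open>A chart of \<open>M\<close> need not lie within a single chart of
    \<open>N\<close>, so smoothness is established near each point.\<close>
  proof (rule smooth_on_local)
    fix y assume y: "y \<in> coord M k ` patch M k"
    define x where "x = inv_chart M k y"
    have x: "k \<in> charts_at M x" "coord M k x = y" using coord_inv[OF y] k by (simp_all add: x_def charts_at_def)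
    then obtain i where i: "i \<in> charts_at N x"
      using chart_N_exists[OF charts_atD(3)[OF x(1)]] by blast
    let ?rep = "local_rep M N id k i"
    let ?W = "rdom k i"
    note W = rdom[OF x(1) i] and ch = rdom_inv_chart[OF k charts_atD(1)[OF i]]
    have rep_im: "?rep ` ?W \<subseteq> coord N i ` patch N i"
      using ch(2) by (auto simp: local_rep_def charts_at_def)
    have "smooth_on ?W (\<lambda>y. \<Sum>a\<in>UNIV. \<Sum>b\<in>UNIV. (frechet_derivative ?rep (at y) X $ a * frechet_derivative ?rep (at y) Y $ b) *
        g i (inv_chart N i (?rep y)) (axis a 1) (axis b 1))"
      by (intro smooth_on_sum smooth_on_bilinear[OF W(1) bounded_bilinear_mult] W(1)
          smooth_on_bounded_linear[OF W(1) bounded_linear_vec_nth] smooth_on_derivative W(3)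
          smooth_on_compose[OF W(1) open_coord[OF manifold_N charts_atD(1)[OF i]] W(3)
            riemannian_metric_smooth[OF g(1) charts_atD(1)[OF i]] rep_im])
    then have "smooth_on ?W (\<lambda>y. gM k (inv_chart M k y) X Y)"
    proof (rule smooth_on_cong[OF W(1), rotated])
      fix z assume z: "z \<in> ?W"
      show "(\<Sum>a\<in>UNIV. \<Sum>b\<in>UNIV. (frechet_derivative ?rep (at z) X $ a * frechet_derivative ?rep (at z) Y $ b) *
        g i (inv_chart N i (?rep z)) (axis a 1) (axis b 1)) = gM k (inv_chart M k z) X Y"
        unfolding gM_eq[OF ch(1,2)[OF z]] ch(3)[OF z] ch(4)[OF z]
        by (rule bilinear_component_expand[OF riemannian_metricD(1)[OF g(1) ch(2)[OF z]], symmetric])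
    qed
    then show "\<exists>W. open W \<and> y \<in> W \<and> smooth_on W (\<lambda>y. gM k (inv_chart M k y) X Y)"
      using W(1,2) x(2) by blast
  qed
qed

lemma ambient_normal:
  assumes k: "k \<in> charts_at M x" and i: "i \<in> charts_at N x"
  shows "g i x (second_fundamental_form M N DN DM k i x X Y) (jac M N id k i x V) = 0"
    and "second_fundamental_form M N DN DM k i x X Y
      = ambient_deriv M N DN k i x X (\<lambda>_. Y) - jac M N id k i x (DM k x X Y)"
proof -
  have fd_id: "frechet_derivative id (at y) = id" for y :: "real^'m"
    by (rule frechet_derivativeI) (simp add: id_def)
  have "cov_deriv id (DM k x) (\<lambda>_. Y) (coord M k x) X = DM k x X Y"
    by (simp add: cov_deriv_def fd_id)
  then show "second_fundamental_form M N DN DM k i x X Y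
      = ambient_deriv M N DN k i x X (\<lambda>_. Y) - jac M N id k i x (DM k x X Y)"
    by (simp only: second_fundamental_form_def)
  show "g i x (second_fundamental_form M N DN DM k i x X Y) (jac M N id k i x V) = 0"
    using induced[unfolded induced_connection_def, THEN conjunct2, rule_format,
        OF charts_atD(3)[OF k] k i smooth_on_const g_in]
    by (simp only: second_fundamental_form_def)
qed

text \<open>The one-form on \<open>M\<close> is the restriction of the one on \<open>N\<close>.
  Differentiating \<open>gM\<close> produces second derivatives of the inclusion, which combine with
  \<open>DN\<close> to ambient derivatives; paired with tangent vectors, these reduce to
  \<open>DM\<close> because the second fundamental form is normal.\<close>

lemma weyl_M:
  assumes k: "k \<in> charts_at M x"
  shows "\<exists>\<alpha>. \<forall>Y Z. frechet_derivative (\<lambda>y. gM k (inv_chart M k y) Y Z) (at (coord M k x)) X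
          - gM k x (DM k x X Y) Z - gM k x Y (DM k x X Z) = \<alpha> * gM k x Y Z"
proof -
  obtain i where i: "i \<in> charts_at N x"
    using chart_N_exists[OF charts_atD(3)[OF k]] by blast
  let ?rep = "local_rep M N id k i" and ?y = "coord M k x" and ?L = "jac M N id k i x"
  let ?pt = "inv_chart N i"
  let ?W = "rdom k i"
  note W = rdom[OF k i] and ch = rdom_inv_chart[OF charts_atD(1)[OF k] charts_atD(1)[OF i]]
  have rep_y: "?rep ?y = coord N i x" by (simp add: local_rep_def inv_coord[OF manifold_M k])
  have L: "frechet_derivative ?rep (at ?y) = ?L" by (simp add: jac_def)
  have rep': "(?rep has_derivative ?L) (at ?y)"
    using i by (intro jac_has_derivative[OF immersion k]) simp
  define db where "db s U V = frechet_derivative (\<lambda>y. g i (?pt y) U V) (at (coord N i x)) (?L s)" for s U V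
  define hess where "hess s V = frechet_derivative (\<lambda>y. frechet_derivative ?rep (at y) V) (at ?y) s" for s V
  have b: "((\<lambda>z. g i (?pt (?rep z)) U V) has_derivative (\<lambda>s. db s U V)) (at ?y)" for U V
  proof -
    have "coord N i x \<in> coord N i ` patch N i" using charts_atD(2)[OF i] by simp
    from smooth_on_differentiable[OF riemannian_metric_smooth[OF g(1) charts_atD(1)[OF i]] this]
    have "((\<lambda>y. g i (?pt y) U V) has_derivative frechet_derivative (\<lambda>y. g i (?pt y) U V) (at (coord N i x))) (at (?rep ?y))"
      by (simp add: frechet_derivative_works rep_y)
    from has_derivative_compose[OF rep' this] show ?thesis unfolding db_def .
  qed
  have hess: "((\<lambda>y. frechet_derivative ?rep (at y) V) has_derivative (\<lambda>s. hess s V)) (at ?y)" for V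
    unfolding hess_def using smooth_on_differentiable[OF smooth_on_derivative[OF W(3)] W(2)]
    by (simp add: frechet_derivative_works)
  have bil: "bilinear (g i (?pt (?rep z)))" if "z \<in> ?W" for z
    unfolding ch(3)[OF that] by (rule riemannian_metricD(1)[OF g(1) ch(2)[OF that]])
  have amb: "ambient_deriv M N DN k i x X (\<lambda>_. V) = hess X V + DN i x (?L X) (?L V)" for V
    by (simp add: ambient_deriv_def cov_deriv_def hess_def jac_def)
  have pt: "?pt (?rep ?y) = x" by (simp add: rep_y inv_coord[OF manifold_N i])
  have fd: "frechet_derivative (\<lambda>y. gM k (inv_chart M k y) Y Z) (at ?y)
      = (\<lambda>s. db s (?L Y) (?L Z) + g i x (hess s Y) (?L Z) + g i x (?L Y) (hess s Z))" for Y Z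
  proof (rule frechet_derivativeI)
    have "((\<lambda>z. g i (?pt (?rep z)) (frechet_derivative ?rep (at z) Y) (frechet_derivative ?rep (at z) Z)) has_derivative
      (\<lambda>s. db s (?L Y) (?L Z) + g i x (hess s Y) (?L Z) + g i x (?L Y) (hess s Z))) (at ?y)"
      using has_derivative_bilinear_family[OF W(1,2) bil b hess hess, of Y Z] by (simp only: L pt)
    then show "((\<lambda>y. gM k (inv_chart M k y) Y Z) has_derivative
      (\<lambda>s. db s (?L Y) (?L Z) + g i x (hess s Y) (?L Z) + g i x (?L Y) (hess s Z))) (at ?y)"
    proof (rule has_derivative_transform_within_open[OF _ W(1,2)])
      fix z assume z: "z \<in> ?W"
      show "g i (?pt (?rep z)) (frechet_derivative ?rep (at z) Y) (frechet_derivative ?rep (at z) Z)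
          = gM k (inv_chart M k z) Y Z"
        unfolding gM_eq[OF ch(1,2)[OF z]] ch(3)[OF z] ch(4)[OF z] ..
    qed
  qed
  obtain \<alpha> where \<alpha>: "\<And>Y Z. db X Y Z - g i x (DN i x (?L X) Y) Z - g i x Y (DN i x (?L X) Z) = \<alpha> * g i x Y Z"
    using weyl_N[OF i, of "?L X"] unfolding db_def by blast
  note gb = riemannian_metricD(1)[OF g(1) i]
  have normal: "g i x (hess X Y) (?L Z) + g i x (DN i x (?L X) (?L Y)) (?L Z) = gM k x (DM k x X Y) Z" for Y Z
    using ambient_normal(1)[OF k i, of X Y Z] unfolding ambient_normal(2)[OF k i] amb gM_eq[OF k i]
    by (simp add: bilinear_ladd[OF gb] bilinear_lsub[OF gb])
  have "frechet_derivative (\<lambda>y. gM k (inv_chart M k y) Y Z) (at ?y) X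
          - gM k x (DM k x X Y) Z - gM k x Y (DM k x X Z) = \<alpha> * gM k x Y Z" for Y Z
    using \<alpha>[of "?L Y" "?L Z"] normal[of Y Z] normal[of Z Y]
      riemannian_metricD(2)[OF g(1) i, of "?L Y"] riemannian_metricD(2)[OF metric_gM k, of Y]
    unfolding fd gM_eq[OF k i, of Y Z] by simp
  then show ?thesis by blast
qed

end

lemma acs_of_real_parts:
  "acs_of q k x = cr_of (real_parts (comps k (q x)))"
  by (simp add: acs_of_def real_parts_def)

section \<open>The isotropic and positive bundles of the submanifold\<close>

context weyl_section begin

lemma gM_in: "gM \<in> cM"
  unfolding cM_def restricted_conformal_def
  by (intro CollectI conjI metric_gM bexI[OF _ g_in] exI[of _ "\<lambda>_. 1"]) (simp add: gM_eq)

lemma conformal_M: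
  assumes h: "h \<in> cM" and x: "x \<in> points M"
  shows "\<exists>\<rho>. \<forall>k\<in>charts_at M x. \<forall>X Y. h k x X Y = \<rho> * gM k x X Y"
proof -
  obtain g' \<rho> where g': "g' \<in> cN" and \<rho>: "\<And>k i X Y. k \<in> charts_at M x \<Longrightarrow> i \<in> charts_at N x \<Longrightarrow>
      h k x X Y = \<rho> x * g' i x (jac M N id k i x X) (jac M N id k i x Y)"
    using h x unfolding cM_def restricted_conformal_def by blast
  obtain \<rho>' where \<rho>': "\<And>i X Y. i \<in> charts_at N x \<Longrightarrow> g' i x X Y = \<rho>' * g i x X Y"
    using conformal_N[OF g' points_subset[OF x]] by blast
  obtain i where i: "i \<in> charts_at N x" using chart_N_exists[OF x] by blast
  show ?thesis
    by (intro exI[of _ "\<rho> x * \<rho>'"] ballI allI) (simp add: \<rho>[OF _ i] \<rho>'[OF i] gM_eq[OF _ i])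
qed

lemma bilinear_DM: "k \<in> charts_at M x \<Longrightarrow> bilinear (DM k x)"
  using induced by (intro connection_bilinear[of M]) (simp_all add: induced_connection_def)

text \<open>For the bundle of all isotropic spaces the stability condition is immediate. Its
  pointwise facts are used in proving \<open>QM_stable\<close>, before \<open>QM\<close> itself can
  become an instance.\<close>

interpretation full: isotropic_subbundle M cM gM DM "isotropic_bundle M cM r" r
  by unfold_locales (use manifold_M metric_gM gM_in conformal_M bilinear_DM weyl_M in simp_all)

lemma complex_structure_comps:
  assumes P: "(x, P) \<in> isotropic_bundle M cM r" and k: "k \<in> charts_at M x"
  shows "complex_structure_space (comps k P)"
proof -
  interpret pt: isotropic_point M cM gM DM "isotropic_bundle M cM r" r x P k
    by unfold_locales (fact P k)+
  show ?thesis
  proof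
    show "vec.subspace (comps k P)" by (rule pt.C_facts(1))
    show "2 * vec.dim (comps k P) = CARD('m)" by (simp add: pt.C_facts(2) dim)
    show "Z = 0" if "Z \<in> comps k P" "vec_cnj Z \<in> comps k P" for Z
      by (rule pt.C_conj_trivial[OF that])
  qed
qed

lemma section_p_in: "x \<in> points M \<Longrightarrow> (x, p x) \<in> isotropic_bundle N cN r"
  using section_p by (auto simp: smooth_map_def points_def bundle_charts_def)

text \<open>Tangency of \<open>p\<close> gives the inclusion from left to right: every element of
  \<open>p x\<close> comes from a vector tangent to \<open>M\<close>. The other inclusion is built
  into \<open>pM\<close>.\<close>

lemma comps_p:
  assumes k: "k \<in> charts_at M x" and i: "i \<in> charts_at N x"
  shows "comps i (p x) = clinear_ext (jac M N id k i x) ` comps k (pM x)"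
proof -
  have incl: "w i = clinear_ext (jac M N id k i x) (v k)" if "(v, w) \<in> inclusion_differential M N x" for v w
    using that k i unfolding inclusion_differential_def by blast
  have "p x \<subseteq> Range (inclusion_differential M N x)" by (rule tangent_p[OF charts_atD(3)[OF k]])
  then have 1: "\<exists>v\<in>pM x. (v, w) \<in> inclusion_differential M N x" if "w \<in> p x" for w
    using that unfolding pM_def by blast
  have 2: "\<exists>w\<in>p x. (v, w) \<in> inclusion_differential M N x" if "v \<in> pM x" for v
    using that unfolding pM_def by blast
  show ?thesis
  proof (intro equalityI subsetI)
    fix Z assume "Z \<in> comps i (p x)"
    then obtain w where w: "w \<in> p x" "Z = w i" by (auto simp: comps_def)
    obtain v where v: "v \<in> pM x" "(v, w) \<in> inclusion_differential M N x" using 1[OF w(1)] by blast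
    have "v k \<in> comps k (pM x)" using v(1) by (auto simp: comps_def)
    then show "Z \<in> clinear_ext (jac M N id k i x) ` comps k (pM x)"
      unfolding w(2) incl[OF v(2)] by (rule imageI)
  next
    fix Z assume "Z \<in> clinear_ext (jac M N id k i x) ` comps k (pM x)"
    then obtain v where v: "v \<in> pM x" "Z = clinear_ext (jac M N id k i x) (v k)" by (auto simp: comps_def)
    obtain w where w: "w \<in> p x" "(v, w) \<in> inclusion_differential M N x" using 2[OF v(1)] by blast
    show "Z \<in> comps i (p x)" unfolding v(2) incl[OF w(2), symmetric] using w(1) by (auto simp: comps_def)
  qed
qed

text \<open>The complexified differential of the inclusion is injective and isometric for
  \<open>gM\<close>, so the linear structure, dimension and isotropy of \<open>p x\<close> pull back
  to \<open>pM x\<close>.\<close>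

lemma pM_facts:
  assumes k: "k \<in> charts_at M x"
  shows subspace_pM: "vec.subspace (comps k (pM x))" and pM_in_iso: "(x, pM x) \<in> isotropic_bundle M cM r"
proof -
  have x: "x \<in> points M" using k by (rule charts_atD)
  obtain i where i: "i \<in> charts_at N x" using chart_N_exists[OF x] by blast
  let ?L = "jac M N id k i x"
  note lin = jac_linear_M[OF k i]
  have ext: "clinear_ext ?L = (*v) (cmat ?L)" by (rule ext) (rule clinear_ext_cmat[OF lin])
  have inj: "inj ((*v) (cmat ?L))" using inj_clinear_ext[OF inj_jac[OF k i]] by (simp only: ext)
  have C: "vec.subspace (comps i (p x))" "vec.dim (comps i (p x)) = r"
    "\<And>Z W. Z \<in> comps i (p x) \<Longrightarrow> W \<in> comps i (p x) \<Longrightarrow> cbilinear_form_ext (g i x) Z W = 0"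
    using section_p_in[OF x] i g_in unfolding isotropic_bundle_def by blast+
  have image: "comps i (p x) = (*v) (cmat ?L) ` comps k (pM x)" using comps_p[OF k i] by (simp only: ext)
  have vim: "comps k (pM x) = {Z. cmat ?L *v Z \<in> comps i (p x)}"
    unfolding image using inj by (auto dest: injD)
  show sub: "vec.subspace (comps k (pM x))"
    unfolding vim using C(1)
    by (intro vec.subspaceI CollectI)
       (auto simp: matrix_vector_right_distrib vec_smult_simps intro: vec.subspace_add vec.subspace_scale vec.subspace_0)
  show "(x, pM x) \<in> isotropic_bundle M cM r"
  proof (rule isotropic_bundleI[OF manifold_M metric_gM _ k _ sub])
    show "\<exists>\<rho>. \<forall>k\<in>charts_at M x. \<forall>X Y. h k x X Y = \<rho> * gM k x X Y" if "h \<in> cM" for h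
      by (rule conformal_M[OF that x])
    show "pM x \<subseteq> tangent_C M x" unfolding pM_def inclusion_differential_def by auto
    show "vec.dim (comps k (pM x)) = r" using C(2) unfolding image dim_image_inj[OF inj] .
    fix Z W assume ZW: "Z \<in> comps k (pM x)" "W \<in> comps k (pM x)"
    have "cbilinear_form_ext (gM k x) Z W = cbilinear_form_ext (g i x) (clinear_ext ?L Z) (clinear_ext ?L W)"
      by (simp add: cbilinear_form_ext_def gM_eq[OF k i])
    also have "\<dots> = 0" using ZW unfolding comps_p[OF k i, symmetric] by (intro C(3)) (simp_all add: comps_p[OF k i])
    finally show "cbilinear_form_ext (gM k x) Z W = 0" .
  qed
qed

text \<open>In the charts, \<open>L\<^sup>+ E L\<close> with \<open>L\<^sup>+ = (L\<^sup>T L)\<inverse> L\<^sup>T\<close> is a smooth, not necessarily orthogonal,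
  projection onto the subspaces.\<close>

lemma smooth_EM:
  assumes k: "k \<in> idx M"
  shows "smooth_on (coord M k ` patch M k) (\<lambda>y. projector (comps k (pM (inv_chart M k y))))"
proof (rule smooth_on_local)
  let ?pt = "inv_chart M k" and ?Q = "isotropic_bundle N cN r"
  let ?F = "\<lambda>x. (x, p x)"
  fix y assume y: "y \<in> coord M k ` patch M k"
  define x where "x = ?pt y"
  have x: "k \<in> charts_at M x" "coord M k x = y" using coord_inv[OF y] k by (simp_all add: x_def charts_at_def)
  note xM = charts_atD(3)[OF x(1)]
  obtain i where i: "i \<in> charts_at N x" using chart_N_exists[OF xM] by blast
  let ?rep = "local_rep M N id k i"
  have iQ: "i \<in> charts_at (bundle_charts N ?Q) (?F x)"
    using i section_p_in[OF xM] by (simp add: charts_at_def bundle_charts_def)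
  note V = rep_domain[OF section_p x(1) iQ] and W' = rdom[OF x(1) i] and ch_W = rdom_inv_chart[OF k charts_atD(1)[OF i]]
  define W where "W = rep_domain M (bundle_charts N ?Q) ?F k i \<inter> rdom k i"
  have W: "open W" "y \<in> W" using V(1,2) W'(1,2) x(2) by (auto simp: W_def)
  define L where "L y = cmat (frechet_derivative ?rep (at y))" for y
  define E where "E y = projector (comps i (p (?pt y)))" for y
  define Lp where "Lp y = matrix_inv (transpose (L y) ** L y) ** transpose (L y)" for y
  define F where "F y = Lp y ** (E y ** L y)" for y
  have smooth_L: "smooth_on W L"
    unfolding L_def by (intro smooth_on_cmat W smooth_on_derivative smooth_on_subset[OF W'(3)]) (simp add: W_def)
  have "smooth_on (rep_domain M (bundle_charts N ?Q) ?F k i) E"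
    using smooth_on_bounded_linear[OF V(1) bounded_linear_snd V(4)]
    by (simp add: local_rep_def bundle_charts_def E_def[abs_def])
  then have smooth_E: "smooth_on W E" by (rule smooth_on_subset) (simp add: W_def)
  have facts: "invertible (transpose (L z) ** L z)" "F z ** F z = F z" "range ((*v) (F z)) = comps k (pM (?pt z))"
    if z: "z \<in> W" for z
  proof -
    have ch: "k \<in> charts_at M (?pt z)" "i \<in> charts_at N (?pt z)" and
      jac: "jac M N id k i (?pt z) = frechet_derivative ?rep (at z)"
      using ch_W z by (simp_all add: W_def)
    have ext: "clinear_ext (jac M N id k i (?pt z)) = (*v) (L z)"
      unfolding L_def jac[symmetric] by (rule ext) (rule clinear_ext_cmat[OF jac_linear_M[OF ch]])
    have inj: "inj ((*v) (L z))" using inj_clinear_ext[OF inj_jac[OF ch]] by (simp only: ext)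
    have image: "comps i (p (?pt z)) = (*v) (L z) ` comps k (pM (?pt z))"
      using comps_p[OF ch] by (simp only: ext)
    \<comment> \<open>\<open>L z\<close> has real entries, so its transpose is its adjoint; together
      with injectivity this makes \<open>transpose (L z) ** L z\<close> invertible.\<close>
    have tr: "inner (L z *v v) w = inner v (transpose (L z) *v w)" for v w
    proof -
      have "(\<chi> a b. cnj (L z $ b $ a)) = transpose (L z)" by (simp add: L_def cmat_def transpose_def vec_eq_iff)
      then show ?thesis by (simp only: inner_conjugate_transpose)
    qed
    show inv: "invertible (transpose (L z) ** L z)"
    proof (rule invertible_if_inj)
      fix v assume "transpose (L z) ** L z *v v = 0"
      then have "inner (L z *v v) (L z *v v) = 0" by (simp only: tr matrix_vector_mul_assoc inner_zero_right)
      then have "L z *v v = 0" by (simp only: inner_eq_zero_iff)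
      also have "0 = L z *v 0" by simp
      finally show "v = 0" by (rule injD[OF inj])
    qed
    have left_inv: "Lp z *v (L z *v v) = v" for v
      by (simp add: Lp_def matrix_vector_mul_assoc matrix_inv_works(2)[OF inv] flip: matrix_mul_assoc)
    have subN: "vec.subspace (comps i (p (?pt z)))"
      using section_p_in[OF charts_atD(3)[OF ch(1)]] ch(2) unfolding isotropic_bundle_def by blast
    have Fv: "F z *v v = Lp z *v (E z *v (L z *v v))" for v
      by (simp add: F_def matrix_vector_mul_assoc matrix_mul_assoc)
    have F_id: "F z *v v = v" if "v \<in> comps k (pM (?pt z))" for v
    proof -
      have "L z *v v \<in> comps i (p (?pt z))" unfolding image using that by (rule imageI)
      then have "E z *v (L z *v v) = L z *v v" using projector_mem_iff[OF subN] by (simp add: E_def)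
      then show ?thesis by (simp only: Fv left_inv)
    qed
    have F_mem: "F z *v v \<in> comps k (pM (?pt z))" for v
    proof -
      have "E z *v (L z *v v) \<in> comps i (p (?pt z))" unfolding E_def by (rule projector_mem[OF subN])
      then obtain u where u: "u \<in> comps k (pM (?pt z))" "E z *v (L z *v v) = L z *v u" unfolding image by blast
      then show ?thesis by (simp only: Fv left_inv)
    qed
    show "F z ** F z = F z"
      unfolding matrix_eq matrix_vector_mul_assoc[symmetric] by (intro allI F_id F_mem)
    show "range ((*v) (F z)) = comps k (pM (?pt z))"
    proof (intro equalityI subsetI)
      show "v \<in> range ((*v) (F z))" if "v \<in> comps k (pM (?pt z))" for v
        using F_id[OF that, symmetric] by (rule range_eqI)
    qed (use F_mem in blast)
  qed
  have "smooth_on W F"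
    unfolding F_def Lp_def
    by (intro smooth_on_bilinear[OF W(1) bounded_bilinear_matrix_mult] smooth_E smooth_L
        smooth_on_bounded_linear[OF W(1) bounded_linear_transpose]
        smooth_on_compose[OF W(1) open_invertible _ smooth_on_matrix_inv])
       (use facts(1) in auto)
  then have "smooth_on W (\<lambda>y. orth_projector_of (F y))"
    by (rule smooth_on_orth_projector_of[OF W(1)]) (rule facts(2))
  then have "smooth_on W (\<lambda>y. projector (comps k (pM (?pt y))))"
    by (rule smooth_on_cong[OF W(1), rotated]) (simp add: projector_range[OF facts(2), symmetric] facts(3))
  then show "\<exists>W. open W \<and> y \<in> W \<and> smooth_on W (\<lambda>y. projector (comps k (pM (?pt y))))"
    using W by blast
qed

lemma half_dim: "CARD('m) div 2 = r" by (simp add: dim)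

lemma QM_iff: "(x, P) \<in> QM \<longleftrightarrow> (x, P) \<in> isotropic_bundle M cM r \<and>
    (\<forall>k\<in>charts_at M x. same_orientation (structure_of (comps k (pM x))) (structure_of (comps k P)))"
  unfolding QM_def positive_isotropic_bundle_def half_dim acs_of_real_parts structure_of_def by simp

lemma pM_in_QM: "x \<in> points M \<Longrightarrow> (x, pM x) \<in> QM"
  unfolding QM_iff
proof (intro conjI ballI)
  assume "x \<in> points M"
  then obtain k where "k \<in> charts_at M x" using points_charts_at[of x M] by blast
  then show iso: "(x, pM x) \<in> isotropic_bundle M cM r" by (rule pM_in_iso)
  show "same_orientation (structure_of (comps k (pM x))) (structure_of (comps k (pM x)))"
    if "k \<in> charts_at M x" for k
    by (rule same_orientation_refl[OF complex_structure_comps[OF iso that]])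
qed

text \<open>The projectors onto \<open>pM\<close> vary continuously, so
  \<open>same_orientation_eventually\<close> compares orientations at nearby points in the chart
  \<open>k\<close>. The comparison passes to the other charts at such a point by
  \<open>same_orientation_image\<close>.\<close>

lemma QM_stable:
  assumes Q: "(x, P) \<in> QM" and k: "k \<in> charts_at M x" and B: "(B \<longlongrightarrow> mat 1) (at (0::real))"
  shows "\<forall>\<^sub>F t in at 0. \<forall>P'. (inv_chart M k (coord M k x + t *\<^sub>R X), P') \<in> isotropic_bundle M cM r \<longrightarrow>
          comps k P' = (*v) (B t) ` comps k P \<longrightarrow>
          (inv_chart M k (coord M k x + t *\<^sub>R X), P') \<in> QM"
proof -
  let ?pt = "inv_chart M k"
  let ?z = "\<lambda>t. coord M k x + t *\<^sub>R X"
  define E where "E t = projector (comps k (pM (?pt (?z t))))" for t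
  have kM: "k \<in> idx M" and zM: "coord M k x \<in> coord M k ` patch M k"
    using charts_atD(1,2)[OF k] by auto
  have lim: "(?z \<longlongrightarrow> coord M k x) (at 0)" by (auto intro!: tendsto_eq_intros)
  have "continuous_on (coord M k ` patch M k) (\<lambda>y. projector (comps k (pM (?pt y))))"
    by (rule smooth_on_continuous[OF smooth_EM[OF kM]])
  then have "isCont (\<lambda>y. projector (comps k (pM (?pt y)))) (coord M k x)"
    using continuous_on_eq_continuous_at[OF open_coord[OF manifold_M kM]] zM by blast
  from isCont_tendsto_compose[OF this lim]
  have E: "(E \<longlongrightarrow> projector (comps k (pM x))) (at 0)"
    unfolding E_def[abs_def] by (simp add: inv_coord[OF manifold_M k])
  have cs: "complex_structure_space (comps k (pM x))" "complex_structure_space (comps k P)"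
    using complex_structure_comps[OF pM_in_iso[OF k] k] complex_structure_comps[OF _ k, of P] Q
    by (simp_all add: QM_iff)
  have same: "same_orientation (structure_of (comps k (pM x))) (structure_of (comps k P))"
    using Q k by (simp add: QM_iff)
  have fixed: "projector (comps k (pM x)) *v Z = Z" if "Z \<in> comps k (pM x)" for Z
    using that projector_mem_iff[OF subspace_pM[OF k]] by blast
  have ev: "\<forall>\<^sub>F t in at 0. \<forall>D D'. complex_structure_space D \<longrightarrow> complex_structure_space D' \<longrightarrow>
    (\<forall>Z. E t *v Z \<in> D) \<longrightarrow> D' = (*v) (B t) ` comps k P \<longrightarrow>
    same_orientation (structure_of D) (structure_of D')"
    by (rule same_orientation_eventually[OF cs same E fixed B])
  have patch_ev: "\<forall>\<^sub>F t in at 0. ?z t \<in> coord M k ` patch M k"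
    by (rule topological_tendstoD[OF lim open_coord[OF manifold_M kM] zM])
  show ?thesis
    using ev patch_ev
  proof eventually_elim
    case (elim t)
    let ?x = "?pt (?z t)"
    have kx: "k \<in> charts_at M ?x" using coord_inv(2)[OF elim(2)] kM by (simp add: charts_at_def)
    show ?case
    proof (intro allI impI)
      fix P' assume P': "(?x, P') \<in> isotropic_bundle M cM r" "comps k P' = (*v) (B t) ` comps k P"
      note pt = pM_in_iso[OF kx]
      have memE: "\<forall>Z. E t *v Z \<in> comps k (pM ?x)"
        unfolding E_def by (intro allI projector_mem subspace_pM[OF kx])
      have k_same: "same_orientation (structure_of (comps k (pM ?x))) (structure_of (comps k P'))"
        using elim(1) complex_structure_comps[OF pt kx] complex_structure_comps[OF P'(1) kx] memE P'(2) by blast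
      show "(?x, P') \<in> QM"
        unfolding QM_iff
      proof (intro conjI ballI P'(1))
        fix k' assume k': "k' \<in> charts_at M ?x"
        let ?T = "jac M M id k k' ?x"
        have T: "linear ?T"
          using k' by (intro jac_linear[OF smooth_manifold_smooth_id[OF manifold_M] kx]) simp
        have inj: "inj ?T" using jac_inverse[OF manifold_M kx k'] by (metis injI)
        note ch = comps_change[OF comps_subset_tangent[OF pt] kx k'] comps_change[OF comps_subset_tangent[OF P'(1)] kx k']
        show "same_orientation (structure_of (comps k' (pM ?x))) (structure_of (comps k' P'))"
          unfolding ch
          by (rule same_orientation_image[OF T inj complex_structure_comps[OF pt kx] complex_structure_comps[OF P'(1) kx]
                complex_structure_comps[OF pt k', unfolded ch] complex_structure_comps[OF P'(1) k', unfolded ch] k_same])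
      qed
    qed
  qed
qed

sublocale M: isotropic_subbundle M cM gM DM QM r
proof
  show "QM \<subseteq> isotropic_bundle M cM r" using QM_iff by auto
qed (use manifold_M metric_gM gM_in conformal_M bilinear_DM weyl_M QM_stable in simp_all)

text \<open>In charts the section is a coordinate change of \<open>M\<close> paired with the smooth
  projectors of \<open>smooth_EM\<close> composed with that change.\<close>

lemma section_pM: "smooth_map M (bundle_charts M QM) (\<lambda>x. (x, pM x))"
  unfolding smooth_map_def
proof (intro conjI ballI)
  show "(\<lambda>x. (x, pM x)) ` points M \<subseteq> points (bundle_charts M QM)"
  proof (rule image_subsetI)
    fix x assume x: "x \<in> points M"
    then obtain k where "k \<in> charts_at M x" using points_charts_at[of x M] by blast
    then show "(x, pM x) \<in> points (bundle_charts M QM)"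
      using pM_in_QM[OF x] by (auto simp: points_def bundle_charts_def charts_at_def)
  qed
  fix k j assume k: "k \<in> idx M" and "j \<in> idx (bundle_charts M QM)"
  then have j: "j \<in> idx M" by (simp add: bundle_charts_def)
  let ?S = "coord M k ` {x \<in> patch M k. (x, pM x) \<in> patch (bundle_charts M QM) j}"
  have S: "?S = coord M k ` {x \<in> patch M k. id x \<in> patch M j}"
    using pM_in_QM k by (intro image_cong) (auto simp: bundle_charts_def points_def)
  have id: "open ?S" "smooth_on ?S (local_rep M M id k j)"
    using smooth_manifold_smooth_id[OF manifold_M] k j unfolding S smooth_map_def by blast+
  show "open ?S" by fact
  have patch_j: "inv_chart M k y \<in> patch M j" if "y \<in> ?S" for y
    using that inv_coord[OF manifold_M, of k] k unfolding S by (auto simp: charts_at_def)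
  then have im: "local_rep M M id k j ` ?S \<subseteq> coord M j ` patch M j"
    unfolding local_rep_def id_apply by blast
  have pt: "inv_chart M j (local_rep M M id k j y) = inv_chart M k y"
    if "y \<in> ?S" for y
    using patch_j[OF that] j inv_coord[OF manifold_M, of j] by (simp add: local_rep_def charts_at_def)
  have "smooth_on ?S (\<lambda>y. projector (comps j (pM (inv_chart M j (local_rep M M id k j y)))))"
    by (rule smooth_on_compose[OF id(1) open_coord[OF manifold_M j] id(2) smooth_EM[OF j] im])
  from smooth_on_Pair[OF id(1,2) this]
  show "smooth_on ?S (local_rep M (bundle_charts M QM) (\<lambda>x. (x, pM x)) k j)"
    by (rule smooth_on_cong[OF id(1), rotated]) (simp add: pt, simp add: local_rep_def bundle_charts_def)
qed

section \<open>Comparison of the two holomorphy conditions\<close>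

sublocale SN: immersed_section N cN g DN "isotropic_bundle N cN r" r M pM p
  by unfold_locales (fact manifold_M immersion section_p comps_p smooth_EM subspace_pM)+

sublocale SM: immersed_section M cM gM DM QM r M pM pM
proof
  show "smooth_map M M id" by (rule smooth_manifold_smooth_id[OF manifold_M])
  show "comps j (pM x) = clinear_ext (jac M M id k j x) ` comps k (pM x)"
    if "k \<in> charts_at M x" "j \<in> charts_at M x" for k j x
    by (rule comps_change[OF comps_subset_tangent[OF pM_in_iso[OF that(1)]] that])
qed (fact manifold_M section_pM smooth_EM subspace_pM)+

text \<open>The covariant derivative for \<open>DM\<close>, in the direction conjugate to
  \<open>Z\<close>, of the local section of \<open>pM\<close> that extends \<open>U\<close> by the
  projectors.\<close>

definition nabla :: "'k \<Rightarrow> 'a \<Rightarrow> complex^'m \<Rightarrow> complex^'m \<Rightarrow> complex^'m" where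
  "nabla k x Z U = (clinear_ext (DM k x (vec_Re Z)) U - \<i> *s clinear_ext (DM k x (vec_Im Z)) U)
    + section_dbar M pM k x Z U"

lemma eigenspace_pM:
  assumes "k \<in> charts_at M x"
  shows "minus_i_eigenspace (acs_of pM k x) = (\<lambda>Z. (vec_Re Z, vec_Im Z)) ` comps k (pM x)"
  unfolding acs_of_real_parts real_parts_def[symmetric]
  by (rule complex_structure_space.minus_i_eigenspace_real_parts[OF complex_structure_comps[OF pM_in_iso[OF assms] assms]])

lemma holomorphic_M_iff:
  "holomorphic M (acs_of pM) (bundle_charts M QM) (J_prime M DM QM) (\<lambda>x. (x, pM x)) \<longleftrightarrow>
    (\<forall>x\<in>points M. \<forall>k\<in>charts_at M x. \<forall>Z\<in>comps k (pM x). \<forall>U\<in>comps k (pM x). nabla k x Z U \<in> comps k (pM x))"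
proof -
  have step: "ambient_dbar M M DM k j x Z U + clinear_ext (jac M M id k j x) (section_dbar M pM k x Z U)
      \<in> clinear_ext (jac M M id k j x) ` comps k (pM x) \<longleftrightarrow> nabla k x Z U \<in> comps k (pM x)"
    if k: "k \<in> charts_at M x" and j: "j \<in> charts_at M x" for x k j Z U
  proof -
    let ?T = "jac M M id k j x"
    have inj: "inj ?T" using jac_inverse[OF manifold_M k j] by (metis injI)
    have lin: "linear ?T" by (rule SM.linear_L[OF k j])
    have "connection M DM" using induced by (simp add: induced_connection_def)
    \<comment> \<open>For the identity of \<open>M\<close> the ambient derivative is the left side
      of the transformation rule in \<open>connection\<close>, whose right side is the image of
      \<open>DM\<close>.\<close>
    then have "ambient_deriv M M DM k j x a (\<lambda>_. V) = ?T (DM k x a V)" for a V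
      unfolding connection_def ambient_deriv_def using charts_atD(3)[OF k] k j by blast
    then have "ambient_dbar M M DM k j x Z U + clinear_ext ?T (section_dbar M pM k x Z U) = clinear_ext ?T (nabla k x Z U)"
      by (simp add: vec_Complex_eq_iff ambient_dbar_def nabla_def linear_add[OF lin] linear_diff[OF lin])
    then show ?thesis by (simp only: inj_image_mem_iff[OF inj_clinear_ext[OF inj]])
  qed
  show ?thesis by (subst SM.holomorphic_iff, erule eigenspace_pM) (auto simp: step)
qed

text \<open>By the Gauss formula the derivative is the sum of the normal vector \<open>?b\<close>
  and the image of \<open>nabla\<close>. Since \<open>p\<close> is tangent to \<open>M\<close>, such
  a sum lies in \<open>p\<close> exactly when its normal part is zero and its tangent part lies in
  \<open>p\<close>.\<close>

lemma holomorphic_N_iff: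
  "holomorphic M (acs_of pM) (bundle_charts N (isotropic_bundle N cN r)) (J_prime N DN (isotropic_bundle N cN r)) (\<lambda>x. (x, p x)) \<longleftrightarrow>
    (\<forall>x\<in>points M. \<forall>k\<in>charts_at M x. \<forall>i\<in>charts_at N x. \<forall>Z\<in>comps k (pM x). \<forall>U\<in>comps k (pM x).
      cbilinear_ext (second_fundamental_form M N DN DM k i x) (vec_cnj Z) U = 0 \<and> nabla k x Z U \<in> comps k (pM x))"
proof (subst SN.holomorphic_iff, erule eigenspace_pM, intro ball_cong refl)
  fix x k i Z U assume k: "k \<in> charts_at M x" and i: "i \<in> charts_at N x"
  let ?L = "jac M N id k i x" and ?B = "second_fundamental_form M N DN DM k i x"
  let ?C = "comps k (pM x)" and ?b = "cbilinear_ext (second_fundamental_form M N DN DM k i x) (vec_cnj Z) U"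
  have lin: "linear ?L" by (rule jac_linear_M[OF k i])
  note B_eq = ambient_normal(2)[OF k i]
  have amb: "ambient_deriv M N DN k i x a (\<lambda>_. V) = ?B a V + ?L (DM k x a V)" for a V using B_eq[of a V] by simp
  \<comment> \<open>The conjugate of \<open>Z\<close> has imaginary part \<open>- Im Z\<close>, and
    this sign has to be moved out of the form to match \<open>ambient_dbar\<close>.\<close>
  have neg: "?B (- a) V = - ?B a V" for a V
    unfolding B_eq by (simp add: linear_neg[OF SN.linear_amb_left[OF k i]] bilinear_lneg[OF bilinear_DM[OF k]] linear_neg[OF lin])
  have split: "ambient_dbar M N DN k i x Z U + clinear_ext ?L (section_dbar M pM k x Z U) = ?b + clinear_ext ?L (nabla k x Z U)"
    by (simp add: vec_Complex_eq_iff ambient_dbar_def nabla_def amb cbilinear_ext_def linear_add[OF lin] linear_diff[OF lin] neg)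
  have "?b + clinear_ext ?L n \<in> clinear_ext ?L ` ?C \<longleftrightarrow> ?b = 0 \<and> n \<in> ?C" for n
  proof
    assume "?b + clinear_ext ?L n \<in> clinear_ext ?L ` ?C"
    then obtain u where u: "u \<in> ?C" "?b + clinear_ext ?L n = clinear_ext ?L u" by auto
    then have eq: "?b = clinear_ext ?L u - clinear_ext ?L n" by (simp add: eq_diff_eq)
    note gD = riemannian_metricD[OF g(1) i]
    \<comment> \<open>A vector that is both tangent and normal vanishes by positive definiteness. As
      \<open>g\<close> is real, this is applied to real and imaginary parts separately.\<close>
    have orth: "?L v = 0" if "?L v = b" "\<And>v'. g i x b (?L v') = 0" for v b
      using gD(3)[of "?L v"] that by force
    note nl = ambient_normal(1)[OF k i]
    have "?L (vec_Re u - vec_Re n) = 0"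
    proof (rule orth[OF _ ])
      show "?L (vec_Re u - vec_Re n) = ?B (vec_Re Z) (vec_Re U) + ?B (vec_Im Z) (vec_Im U)"
        using arg_cong[OF eq, of vec_Re] by (simp add: cbilinear_ext_def linear_diff[OF lin] neg)
    qed (simp add: bilinear_ladd[OF gD(1)] nl)
    moreover have "?L (vec_Im u - vec_Im n) = 0"
    proof (rule orth[OF _ ])
      show "?L (vec_Im u - vec_Im n) = ?B (vec_Re Z) (vec_Im U) - ?B (vec_Im Z) (vec_Re U)"
        using arg_cong[OF eq, of vec_Im] by (simp add: cbilinear_ext_def linear_diff[OF lin] neg)
    qed (simp add: bilinear_lsub[OF gD(1)] nl)
    ultimately have "clinear_ext ?L u = clinear_ext ?L n"
      by (simp add: vec_Complex_eq_iff linear_diff[OF lin])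
    then have "u = n" "?b = 0"
      using injD[OF inj_clinear_ext[OF inj_jac[OF k i]]] eq by simp_all
    then show "?b = 0 \<and> n \<in> ?C" using u(1) by simp
  qed auto
  then show "ambient_dbar M N DN k i x Z U + clinear_ext ?L (section_dbar M pM k x Z U) \<in> clinear_ext ?L ` ?C \<longleftrightarrow>
      ?b = 0 \<and> nabla k x Z U \<in> ?C"
    unfolding split .
qed

lemma one_one_geodesic_iff:
  "one_one_geodesic M N DN DM pM \<longleftrightarrow> (\<forall>x\<in>points M. \<forall>k\<in>charts_at M x. \<forall>i\<in>charts_at N x.
    \<forall>Z\<in>comps k (pM x). \<forall>U\<in>comps k (pM x).
      cbilinear_ext (second_fundamental_form M N DN DM k i x) (vec_cnj Z) U = 0)"
  unfolding one_one_geodesic_def comps_def by blast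

text \<open>In the characterisation over \<open>N\<close> the condition on \<open>nabla\<close> is
  repeated for every chart of \<open>N\<close>. Such a chart exists at each point of
  \<open>M\<close>, so this condition separates from the one on the second fundamental form.\<close>

lemma holomorphic_section_iff:
  "holomorphic M (acs_of pM) (bundle_charts N (isotropic_bundle N cN r)) (J_prime N DN (isotropic_bundle N cN r)) (\<lambda>x. (x, p x)) \<longleftrightarrow>
    one_one_geodesic M N DN DM pM \<and>
    holomorphic M (acs_of pM) (bundle_charts M QM) (J_prime M DM QM) (\<lambda>x. (x, pM x))"
  unfolding holomorphic_N_iff holomorphic_M_iff one_one_geodesic_iff using chart_N_exists by blast

end

theorem proposition4p2:
  fixes N :: "('i, 'a, real^'n) charted"
    and cN :: "('i \<Rightarrow> 'a \<Rightarrow> real^'n \<Rightarrow> real^'n \<Rightarrow> real) set"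
    and DN :: "'i \<Rightarrow> 'a \<Rightarrow> real^'n \<Rightarrow> real^'n \<Rightarrow> real^'n"
    and M :: "('k, 'a, real^'m) charted"
    and cM :: "('k \<Rightarrow> 'a \<Rightarrow> real^'m \<Rightarrow> real^'m \<Rightarrow> real) set"
    and DM :: "'k \<Rightarrow> 'a \<Rightarrow> real^'m \<Rightarrow> real^'m \<Rightarrow> real^'m"
    and r :: nat
    and p :: "'a \<Rightarrow> ('i \<Rightarrow> complex^'n) set"
    and pM :: "'a \<Rightarrow> ('k \<Rightarrow> complex^'m) set"
    and QN :: "('a \<times> ('i \<Rightarrow> complex^'n) set) set"
    and QM :: "('a \<times> ('k \<Rightarrow> complex^'m) set) set"
  assumes weyl: "weyl_space N cN DN"
    and r: "1 \<le> r" "2 * r < CARD('n)"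
    and sub: "submanifold M N"
    and dim: "CARD('m) = 2 * r"
    and cM: "cM = restricted_conformal M N cN"
    and DM: "induced_connection M N cN DN DM"
    and QN: "QN = isotropic_bundle N cN r"
    and section_p: "smooth_map M (bundle_charts N QN) (\<lambda>x. (x, p x))"
    and tangent_p: "\<forall>x\<in>points M. p x \<subseteq> Range (inclusion_differential M N x)"
    and pM: "pM = (\<lambda>x. (inclusion_differential M N x)\<inverse> `` p x)"
    and QM: "QM = positive_isotropic_bundle M cM pM"
  shows "holomorphic M (acs_of pM) (bundle_charts N QN) (J_prime N DN QN) (\<lambda>x. (x, p x))
     \<longleftrightarrow>
     one_one_geodesic M N DN DM pM \<and>
     holomorphic M (acs_of pM) (bundle_charts M QM) (J_prime M DM QM) (\<lambda>x. (x, pM x))"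
proof -
  interpret w: weyl_section N cN DN M DM r p
    by unfold_locales (use weyl sub dim DM section_p tangent_p QN in auto)
  have pM_eq: "pM = w.pM" unfolding pM by (rule ext) (simp only: w.pM_def)
  have QM_eq: "QM = w.QM" unfolding QM cM w.QM_def w.cM_def pM_eq by (rule refl)
  show ?thesis unfolding QN QM_eq pM_eq by (rule w.holomorphic_section_iff)
qed

end
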